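(* Let $n$ be a positive integer, $\varepsilon\in(0,1)$, let $p\in[0,1]$ satisfy $p\ge 10^{8}\varepsilon^{-2}n^{-1/2}$, and let $b$ be an integer with $b\le 10^{-24}\varepsilon^{6}p^{-1}$. Then there is a randomised strategy for Maker in the $(1:b)$ Maker-Breaker game played on $E(K_n)$ which, against any strategy of Breaker, produces a random graph $\Gamma$ distributed as $G(n,p)$ on the vertex set $V(K_n)$ and is such that, with high probability, Maker claims all edges of a subgraph $G$ of $\Gamma$ with vertex set $V(K_n)$ satisfying $\delta(G)\ge(1-\varepsilon)pn$ and $$e\big(G[N_\Gamma(v)]\big)\ge(1-\varepsilon)\frac{p^3n^2}{2}\qquad\text{for every vertex } v\in V(\Gamma).$$
   Context: The $(1:b)$ Maker-Breaker game on $E(K_n)$: in each round, first Maker claims one unclaimed edge of $K_n$, and then Breaker claims up to $b$ unclaimed edges of $K_n$; play continues until all edges are claimed. The bias $b$ is a non-negative integer. Both players see all edges claimed so far. $G(n,p)$ is the binomial random graph on $n$ vertices in which each pair is an edge independently with probability $p$. The random graph $\Gamma$ is generated by Maker using her own randomness (flipping $p$-biased coins for pairs, possibly in an order depending on the play so far, and completing it at the end of the game); for every fixed strategy of Breaker, $\Gamma$ has the distribution $G(n,p)$. $\delta(G)$ is the minimum degree of $G$; $N_\Gamma(v)$ is the set of neighbours of $v$ in $\Gamma$; $G[S]$ is the subgraph of $G$ induced on $S$, and $e(\cdot)$ denotes the number of edges. "With high probability" means with probability tending to $1$ as $n\to\infty$ (where $p=p(n)$ and $b=b(n)$ may depend on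 $n$ subject to the stated inequalities). *)

theory Defs
  imports "HOL-Probability.Probability"
begin

section \<open>Graphs on the vertex set \<open>{..<n}\<close>\<close>

text \<open>All graphs considered here are simple graphs with vertex set \<open>{..<n}\<close>, so a graph is
  given by its edge set, a subset of \<open>complete_edges n\<close>.\<close>

type_synonym edge = "nat set"

definition complete_edges :: "nat \<Rightarrow> edge set" where
  "complete_edges n = {e. e \<subseteq> {..<n} \<and> card e = 2}"

definition nbrs :: "edge set \<Rightarrow> nat \<Rightarrow> nat set" where
  "nbrs G v = {u. {u, v} \<in> G \<and> u \<noteq> v}"

definition min_degree :: "nat \<Rightarrow> edge set \<Rightarrow> nat" where
  "min_degree n G = Min ((\<lambda>v. card (nbrs G v)) ` {..<n})"

definition induced :: "edge set \<Rightarrow> nat set \<Rightarrow> edge set" where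
  "induced G S = {e \<in> G. e \<subseteq> S}"

definition random_subset :: "'a set \<Rightarrow> real \<Rightarrow> 'a set pmf" where
  "random_subset A p = map_pmf (\<lambda>f. {e \<in> A. f e}) (Pi_pmf A False (\<lambda>_. bernoulli_pmf p))"

definition gnp :: "nat \<Rightarrow> real \<Rightarrow> edge set pmf" where
  "gnp n p = random_subset (complete_edges n) p"


section \<open>The \<open>(1:b)\<close> Maker-Breaker game on the edges of the complete graph\<close>

text \<open>The state of the game is the chronological list of everything that has happened so far.
  \<open>Coin e x\<close> records that Maker has privately flipped the \<open>p\<close>-biased coin of the pair \<open>e\<close> with
  outcome \<open>x\<close> (so \<open>x\<close> says whether \<open>e\<close> is an edge of the random graph); \<open>Round e F\<close> records a
  round in which Maker claimed \<open>e\<close> and Breaker then claimed the edges in \<open>F\<close>.\<close>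

datatype event = is_Coin: Coin edge bool | is_Round: Round edge "edge set"

datatype action = Flip edge | Claim edge

definition maker_edges :: "event list \<Rightarrow> edge set" where
  "maker_edges H = {e. \<exists>F. Round e F \<in> set H}"

definition breaker_edges :: "event list \<Rightarrow> edge set" where
  "breaker_edges H = \<Union> {F. \<exists>e. Round e F \<in> set H}"

definition claimed :: "event list \<Rightarrow> edge set" where
  "claimed H = maker_edges H \<union> breaker_edges H"

definition exposed :: "event list \<Rightarrow> edge set" where
  "exposed H = {e. \<exists>x. Coin e x \<in> set H}"

definition present :: "event list \<Rightarrow> edge set" where
  "present H = {e. Coin e True \<in> set H}"

text \<open>A randomised strategy of Maker chooses her next action at random, with a distribution that
  depends on the full state. As long as some edge is unclaimed, she either flips the coin of a
  pair whose coin has not been flipped yet, or makes her move in the game.\<close>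

type_synonym maker_strategy = "event list \<Rightarrow> action pmf"

definition legal_maker :: "nat \<Rightarrow> maker_strategy \<Rightarrow> bool" where
  "legal_maker n \<sigma> \<longleftrightarrow> (\<forall>H. \<not> complete_edges n \<subseteq> claimed H \<longrightarrow>
     set_pmf (\<sigma> H) \<subseteq> Claim ` (complete_edges n - claimed H) \<union> Flip ` (complete_edges n - exposed H))"

text \<open>Breaker sees the previous rounds of the game, but not the coins, and the edge which Maker
  has just claimed.\<close>

type_synonym breaker_strategy = "event list \<Rightarrow> edge \<Rightarrow> edge set"

definition legal_breaker :: "nat \<Rightarrow> nat \<Rightarrow> breaker_strategy \<Rightarrow> bool" where
  "legal_breaker n b \<tau> \<longleftrightarrow> (\<forall>H e. \<tau> H e \<subseteq> complete_edges n - insert e (claimed H) \<and> card (\<tau> H e) \<le> b)"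

definition step :: "nat \<Rightarrow> real \<Rightarrow> maker_strategy \<Rightarrow> breaker_strategy \<Rightarrow> event list \<Rightarrow> event list pmf" where
  "step n p \<sigma> \<tau> H =
     (if complete_edges n \<subseteq> claimed H then return_pmf H
      else bind_pmf (\<sigma> H) (\<lambda>a. case a of
             Flip e \<Rightarrow> map_pmf (\<lambda>x. H @ [Coin e x]) (bernoulli_pmf p)
           | Claim e \<Rightarrow> return_pmf (H @ [Round e (\<tau> (filter is_Round H) e)])))"

primrec run :: "nat \<Rightarrow> real \<Rightarrow> maker_strategy \<Rightarrow> breaker_strategy \<Rightarrow> nat \<Rightarrow> event list pmf" where
  "run n p \<sigma> \<tau> 0 = return_pmf []"
| "run n p \<sigma> \<tau> (Suc k) = bind_pmf (run n p \<sigma> \<tau> k) (step n p \<sigma> \<tau>)"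

text \<open>Every step before the end of the game flips a new coin or claims a new edge, so
  \<open>2 * card (complete_edges n)\<close> steps suffice for all edges to be claimed
  (lemma \<open>run_complete\<close> below). The coins that have not been flipped by then are flipped at
  the end. The result is the pair of Maker's graph and the random graph.\<close>

definition game :: "nat \<Rightarrow> real \<Rightarrow> maker_strategy \<Rightarrow> breaker_strategy \<Rightarrow> (edge set \<times> edge set) pmf" where
  "game n p \<sigma> \<tau> =
     bind_pmf (run n p \<sigma> \<tau> (2 * card (complete_edges n))) (\<lambda>H.
       map_pmf (\<lambda>R. (maker_edges H, present H \<union> R)) (random_subset (complete_edges n - exposed H) p))"

lemma finite_complete_edges: "finite (complete_edges n)"
  by (rule finite_subset[of _ "Pow {..<n}"]) (auto simp: complete_edges_def)

lemma claimed_snoc: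
  "claimed (H @ [Coin e x]) = claimed H"
  "claimed (H @ [Round e F]) = claimed H \<union> insert e F"
  by (auto simp: claimed_def maker_edges_def breaker_edges_def)

lemma exposed_snoc:
  "exposed (H @ [Coin e x]) = insert e (exposed H)"
  "exposed (H @ [Round e F]) = exposed H"
  by (auto simp: exposed_def)

lemma run_measure:
  assumes "legal_maker n \<sigma>" and "H \<in> set_pmf (run n p \<sigma> \<tau> k)"
  shows "complete_edges n \<subseteq> claimed H \<or>
    card (complete_edges n - claimed H) + card (complete_edges n - exposed H) + k
      \<le> 2 * card (complete_edges n)"
  using assms(2)
proof (induction k arbitrary: H)
  case 0
  then show ?case
    by (simp add: claimed_def maker_edges_def breaker_edges_def exposed_def)
next
  case (Suc k)
  let ?K = "complete_edges n"
  from Suc.prems obtain H0 where H0: "H0 \<in> set_pmf (run n p \<sigma> \<tau> k)"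
    and H: "H \<in> set_pmf (step n p \<sigma> \<tau> H0)"
    by auto
  show ?case
  proof (cases "?K \<subseteq> claimed H0")
    case True
    then show ?thesis using H by (simp add: step_def)
  next
    case False
    with Suc.IH[OF H0] have IH:
      "card (?K - claimed H0) + card (?K - exposed H0) + k \<le> 2 * card ?K" by blast
    from H False obtain a where a: "a \<in> set_pmf (\<sigma> H0)"
      and Ha: "H \<in> set_pmf (case a of
             Flip e \<Rightarrow> map_pmf (\<lambda>x. H0 @ [Coin e x]) (bernoulli_pmf p)
           | Claim e \<Rightarrow> return_pmf (H0 @ [Round e (\<tau> (filter is_Round H0) e)]))"
      by (auto simp: step_def)
    from a assms(1) False
    have "a \<in> Claim ` (?K - claimed H0) \<union> Flip ` (?K - exposed H0)"
      unfolding legal_maker_def by blast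
    then consider (c) e where "a = Claim e" "e \<in> ?K - claimed H0"
      | (f) e where "a = Flip e" "e \<in> ?K - exposed H0" by blast
    then have "card (?K - claimed H) + card (?K - exposed H)
        < card (?K - claimed H0) + card (?K - exposed H0)"
    proof cases
      case c
      have "?K - claimed H \<subset> ?K - claimed H0" "?K - exposed H = ?K - exposed H0"
        using c Ha by (auto simp: claimed_snoc exposed_snoc)
      then show ?thesis
        by (simp add: psubset_card_mono finite_complete_edges)
    next
      case f
      have "?K - exposed H \<subset> ?K - exposed H0" "?K - claimed H = ?K - claimed H0"
        using f Ha by (auto simp: claimed_snoc exposed_snoc)
      then show ?thesis
        by (simp add: psubset_card_mono finite_complete_edges)
    qed
    with IH show ?thesis by linarith
  qed
qed

lemma run_complete:
  assumes "legal_maker n \<sigma>"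
    and "H \<in> set_pmf (run n p \<sigma> \<tau> (2 * card (complete_edges n)))"
  shows "complete_edges n \<subseteq> claimed H"
  using run_measure[OF assms] finite_complete_edges[of n] by auto

end

theory Submission
  imports Defs "HOL-Real_Asymp.Real_Asymp"
begin

text \<open>
  Maker needs no randomness beyond the coins of \<open>\<Gamma>\<close>. In each round she flips coins until one of
  them succeeds on an unclaimed pair, and claims that pair at once. An edge of \<open>\<Gamma>\<close> is therefore lost
  only if Breaker had claimed it before its coin was flipped; such a pair is called \<^emph>\<open>stolen\<close>. Breaker
  does not see the coins, so whatever he steals is an edge of \<open>\<Gamma>\<close> with probability only \<open>p\<close>,
  independently of the past. Everything thus reduces to bounds on the number of stolen pairs, followed
  by an exponential supermartingale bound for coins flipped in an adaptive order
  (\<open>adaptive_tail\<close>). Write \<open>c\<close> for the tiny upper bound on \<open>b p\<close>.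

  For the degrees it suffices that only a small multiple of \<open>n\<close> pairs is stolen at every vertex.
  For the neighbourhood of \<open>v\<close>, a stolen pair \<open>xy\<close> with \<open>x, y \<in> N(v)\<close> is of one of two kinds. If one of the pairs \<open>vx\<close>, \<open>vy\<close>
  had not been exposed when Breaker took \<open>xy\<close>, then he did not know that \<open>xy\<close> lies in \<open>N(v)\<close>; these
  triangles are counted by weighting each flip with the number of triangles that it would close, and
  concentration is again enough. Otherwise Breaker could aim at \<open>N(v)\<close>, and Maker has to
  prevent him from stealing more than a small multiple of \<open>p\<^sup>2 n\<^sup>2\<close> such pairs.

  She cannot defend all neighbourhoods alike, because a pair lies in about \<open>p\<^sup>2 n\<close> of them. But Breaker
  makes at most \<open>b e(\<Gamma>)\<close> claims that matter, which is of order \<open>c n\<^sup>2\<close>, so a Cauchy-Schwarz argument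
  with the codegrees of \<open>\<Gamma>\<close> shows that only a small multiple of \<open>1/p\<^sup>2\<close> vertices ever
  becomes \<^emph>\<open>dangerous\<close>, that is, has many aimed steals in its neighbourhood (\<open>dangerous_count\<close>). So few neighbourhoods
  hardly overlap, and it costs little to charge each stolen pair to a single dangerous vertex.

  What remains is a box game: there is a box of pairs for each vertex star and for each neighbourhood,
  and each claim of Breaker charges at most three boxes. Maker flips
  coins in the box with the greatest unanswered debt. An exponential potential keeps every debt of order
  \<open>b log n\<close> (\<open>debt_le\<close>). A box of \<open>m\<close> pairs contains about \<open>p m\<close> edges of \<open>\<Gamma>\<close>, so by the time it is
  exhausted Breaker has stolen of order \<open>b p m \<le> c m\<close> pairs of it, up to lower-order terms.
\<close>

section \<open>Random subsets\<close>

lemma random_subset_insert: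
  assumes "finite A" "e \<notin> A"
  shows "random_subset (insert e A) p =
    bind_pmf (bernoulli_pmf p) (\<lambda>x. map_pmf (\<lambda>R. if x then insert e R else R) (random_subset A p))"
proof -
  have "random_subset (insert e A) p = bind_pmf (bernoulli_pmf p) (\<lambda>x.
      map_pmf (\<lambda>f. {d \<in> insert e A. (f(e := x)) d}) (Pi_pmf A False (\<lambda>_. bernoulli_pmf p)))"
    unfolding random_subset_def
    by (subst Pi_pmf_insert'[OF assms]) (simp add: map_bind_pmf map_pmf_def bind_assoc_pmf bind_return_pmf)
  moreover have "{d \<in> insert e A. (f(e := x)) d} =
      (if x then insert e {d \<in> A. f d} else {d \<in> A. f d})" for f x
    using assms(2) by auto
  ultimately show ?thesis
    unfolding random_subset_def by (simp add: pmf.map_comp o_def)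
qed

lemma random_subset_empty: "random_subset {} p = return_pmf {}"
  by (simp add: random_subset_def map_pmf_def bind_return_pmf)

lemma set_random_subset: "finite A \<Longrightarrow> set_pmf (random_subset A p) \<subseteq> Pow A"
  by (auto simp: random_subset_def)

lemma finite_set_random_subset: "finite A \<Longrightarrow> finite (set_pmf (random_subset A p))"
  by (meson finite_Pow_iff finite_subset set_random_subset)

definition expect :: "real \<Rightarrow> 'a set \<Rightarrow> ('a set \<Rightarrow> real) \<Rightarrow> real" where
  "expect p A f = measure_pmf.expectation (random_subset A p) f"

lemma integrable_random_subset:
  "finite A \<Longrightarrow> integrable (measure_pmf (random_subset A p)) (f :: 'a set \<Rightarrow> real)"
  by (intro integrable_measure_pmf_finite finite_set_random_subset)

lemma expect_empty: "expect p {} f = f {}"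
  by (simp add: expect_def random_subset_empty)

text \<open>All computations with \<^const>\<open>random_subset\<close> below go through this recursion: the coin of one element
  is independent of the others.\<close>

lemma expect_insert:
  assumes "finite A" "e \<notin> A" "0 \<le> p" "p \<le> 1"
  shows "expect p (insert e A) f = p * expect p A (\<lambda>R. f (insert e R)) + (1 - p) * expect p A f"
proof -
  have "expect p (insert e A) f = (\<Sum>x\<in>UNIV. pmf (bernoulli_pmf p) x *\<^sub>R
      measure_pmf.expectation (map_pmf (\<lambda>R. if x then insert e R else R) (random_subset A p)) f)"
    unfolding expect_def random_subset_insert[OF assms(1,2)]
    by (intro pmf_expectation_bind) (auto simp: finite_set_random_subset assms)
  then show ?thesis
    using assms by (simp add: UNIV_bool expect_def)
qed

lemma expect_mono:
  assumes "finite A" "\<And>X. X \<subseteq> A \<Longrightarrow> f X \<le> g X"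
  shows "expect p A f \<le> expect p A g"
  unfolding expect_def
  using assms set_random_subset[OF assms(1)]
  by (intro integral_mono_AE integrable_random_subset) (auto simp: AE_measure_pmf_iff)

lemma expect_cong:
  assumes "finite A" "\<And>X. X \<subseteq> A \<Longrightarrow> f X = g X"
  shows "expect p A f = expect p A g"
  using assms expect_mono[OF assms(1), of f g p] expect_mono[OF assms(1), of g f p] by force

lemma expect_const: "expect p A (\<lambda>_. c) = c"
  by (simp add: expect_def)

lemma expect_add:
  "finite A \<Longrightarrow> expect p A (\<lambda>X. f X + g X) = expect p A f + expect p A g"
  unfolding expect_def by (intro Bochner_Integration.integral_add integrable_random_subset)

lemma expect_cmult: "expect p A (\<lambda>X. c * f X) = c * expect p A f"
  by (simp add: expect_def)

lemma expect_indicator: "expect p A (indicator S) = measure_pmf.prob (random_subset A p) S"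
  by (simp add: expect_def)

lemma expect_of_bool: "expect p A (\<lambda>X. of_bool (P X)) = measure_pmf.prob (random_subset A p) {X. P X}"
  unfolding expect_indicator[symmetric] by (rule arg_cong[of _ _ "expect p A"]) (auto simp: indicator_def)

text \<open>Disjoint parts of a random subset are independent, so the coins may be flipped in two stages.\<close>

lemma expect_Un:
  assumes "finite A" "finite B" "A \<inter> B = {}" "0 \<le> p" "p \<le> 1"
  shows "expect p (A \<union> B) f = expect p A (\<lambda>X. expect p B (\<lambda>Y. f (X \<union> Y)))"
  using assms(1,3)
proof (induction A arbitrary: f rule: finite_induct)
  case empty
  then show ?case by (simp add: expect_empty)
next
  case (insert e A)
  then show ?case
    using assms by (simp add: expect_insert)
qed

lemma expect_restrict:
  assumes "finite A" "T \<subseteq> A" "0 \<le> p" "p \<le> 1"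
  shows "expect p A (\<lambda>X. f (X \<inter> T)) = expect p T f"
proof -
  have fin: "finite T" using assms finite_subset by blast
  have "expect p A (\<lambda>X. f (X \<inter> T)) = expect p (T \<union> (A - T)) (\<lambda>X. f (X \<inter> T))"
    using assms by (simp add: Un_absorb1)
  also have "\<dots> = expect p T (\<lambda>X. expect p (A - T) (\<lambda>Y. f ((X \<union> Y) \<inter> T)))"
    using assms fin by (intro expect_Un) auto
  also have "\<dots> = expect p T (\<lambda>X. expect p (A - T) (\<lambda>Y. f X))"
    using assms fin by (intro expect_cong) (auto intro!: arg_cong[of _ _ f])
  finally show ?thesis by (simp add: expect_const)
qed

lemma expect_power_card:
  assumes "finite A" "0 \<le> p" "p \<le> 1"
  shows "expect p A (\<lambda>X. c ^ card X) = (1 + (c - 1) * p) ^ card A"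
  using assms(1)
proof (induction A rule: finite_induct)
  case empty
  then show ?case by (simp add: expect_empty)
next
  case (insert e A)
  have "expect p A (\<lambda>R. c ^ card (insert e R)) = expect p A (\<lambda>R. c * c ^ card R)"
  proof (intro expect_cong)
    fix X assume "X \<subseteq> A"
    then have "finite X" "e \<notin> X" using insert finite_subset by auto
    then show "c ^ card (insert e X) = c * c ^ card X" by simp
  qed (use insert in auto)
  then show ?case
    using assms insert by (simp add: expect_insert expect_cmult algebra_simps)
qed

lemma expect_markov:
  assumes "finite A" "\<And>X. X \<subseteq> A \<Longrightarrow> 0 \<le> f X" "\<And>X. X \<subseteq> A \<Longrightarrow> P X \<Longrightarrow> a \<le> f X" "0 < a"
  shows "measure_pmf.prob (random_subset A p) {X. P X} \<le> expect p A f / a"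
proof -
  have "expect p A (\<lambda>X. of_bool (P X)) \<le> expect p A (\<lambda>X. (1 / a) * f X)"
    using assms by (intro expect_mono) (auto simp: field_simps)
  then show ?thesis using expect_cmult[of p A "1 / a" f] by (simp add: expect_of_bool)
qed

text \<open>Markov's inequality for \<open>exp (card (X \<inter> T))\<close>, whose mean is at most \<open>exp (2 * p * card T)\<close>
  because \<open>e - 1 \<le> 2\<close>.\<close>

lemma upper_tail:
  assumes "finite A" "T \<subseteq> A" "0 \<le> p" "p \<le> 1"
  shows "measure_pmf.prob (random_subset A p) {X. real (card (X \<inter> T)) > 2 * p * real (card T) + t} \<le> exp (- t)"
proof -
  have fin: "finite T" using assms finite_subset by blast
  let ?a = "2 * p * real (card T) + t"
  have "measure_pmf.prob (random_subset A p) {X. real (card (X \<inter> T)) > ?a}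
      \<le> expect p A (\<lambda>X. (exp 1) ^ card (X \<inter> T)) / exp ?a"
    using assms by (intro expect_markov) (auto simp flip: exp_of_nat_mult)
  also have "expect p A (\<lambda>X. (exp 1) ^ card (X \<inter> T)) = (1 + (exp 1 - 1) * p) ^ card T"
    using assms fin by (subst expect_restrict) (auto simp: expect_power_card)
  also have "\<dots> \<le> exp (2 * p) ^ card T"
  proof (intro power_mono)
    have "exp 1 \<le> (3::real)" by (rule exp_le)
    then have "1 + (exp 1 - 1) * p \<le> 1 + 2 * p" using assms by (intro add_left_mono mult_right_mono) auto
    then show "1 + (exp 1 - 1) * p \<le> exp (2 * p)" using exp_ge_add_one_self[of "2*p"] by linarith
  qed (use assms in auto)
  also have "\<dots> = exp (2 * p * real (card T))" by (simp add: exp_of_nat_mult mult.commute)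
  finally show ?thesis by (simp add: divide_right_mono exp_add exp_minus field_simps)
qed

lemma exp_minus_le: "(x::real) \<ge> 0 \<Longrightarrow> exp (- x) \<le> 1 - x + x\<^sup>2 / 2"
proof -
  assume x: "x \<ge> 0"
  define f where "f = (\<lambda>x::real. 1 - x + x\<^sup>2 / 2 - exp (- x))"
  have "f 0 \<le> f x"
  proof (rule DERIV_nonneg_imp_nondecreasing[OF x])
    fix y :: real assume "0 \<le> y"
    have "(f has_real_derivative (- 1 + y + exp (- y))) (at y)"
      unfolding f_def by (auto intro!: derivative_eq_intros)
    moreover have "- 1 + y + exp (- y) \<ge> 0" using exp_ge_add_one_self[of "-y"] by simp
    ultimately show "\<exists>z. (f has_real_derivative z) (at y) \<and> 0 \<le> z" by blast
  qed
  then show ?thesis by (simp add: f_def)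
qed

text \<open>Markov's inequality for \<open>exp (- \<kappa> * card (X \<inter> T))\<close>; the exponent \<open>\<kappa>\<close> is within a constant factor
  of the optimal one for a relative deviation \<open>\<kappa>\<close>.\<close>

lemma lower_tail:
  assumes "finite A" "T \<subseteq> A" "0 \<le> p" "p \<le> 1" "0 \<le> \<kappa>"
  shows "measure_pmf.prob (random_subset A p) {X. real (card (X \<inter> T)) < (1 - \<kappa>) * p * real (card T)}
    \<le> exp (- (\<kappa>\<^sup>2 * p * real (card T) / 2))"
proof -
  have fin: "finite T" using assms finite_subset by blast
  let ?m = "real (card T)"
  let ?a = "- \<kappa> * ((1 - \<kappa>) * p * ?m)"
  have "measure_pmf.prob (random_subset A p) {X. real (card (X \<inter> T)) < (1 - \<kappa>) * p * ?m}
      \<le> expect p A (\<lambda>X. (exp (- \<kappa>)) ^ card (X \<inter> T)) / exp ?a"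
  proof (intro expect_markov)
    fix X assume "real (card (X \<inter> T)) < (1 - \<kappa>) * p * ?m"
    then have "\<kappa> * real (card (X \<inter> T)) \<le> \<kappa> * ((1 - \<kappa>) * p * ?m)"
      using assms by (intro mult_left_mono) auto
    then show "exp ?a \<le> exp (- \<kappa>) ^ card (X \<inter> T)"
      by (simp add: mult.commute flip: exp_of_nat_mult)
  qed (use assms in auto)
  also have "expect p A (\<lambda>X. (exp (- \<kappa>)) ^ card (X \<inter> T)) = (1 + (exp (- \<kappa>) - 1) * p) ^ card T"
    using assms fin by (subst expect_restrict) (auto simp: expect_power_card)
  also have "\<dots> \<le> exp ((\<kappa>\<^sup>2 / 2 - \<kappa>) * p) ^ card T"
  proof (intro power_mono)
    have "(exp (- \<kappa>) - 1) * p \<le> (\<kappa>\<^sup>2 / 2 - \<kappa>) * p"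
      using exp_minus_le[of \<kappa>] assms by (intro mult_right_mono) auto
    then show "1 + (exp (- \<kappa>) - 1) * p \<le> exp ((\<kappa>\<^sup>2 / 2 - \<kappa>) * p)"
      using exp_ge_add_one_self[of "(\<kappa>\<^sup>2 / 2 - \<kappa>) * p"] by linarith
    have "(1 - exp (- \<kappa>)) * p \<le> 1 * 1" using assms by (intro mult_mono) auto
    then show "0 \<le> 1 + (exp (- \<kappa>) - 1) * p" by (simp add: algebra_simps)
  qed
  also have "\<dots> = exp ((\<kappa>\<^sup>2 / 2 - \<kappa>) * p * ?m)" by (simp add: exp_of_nat_mult mult.commute)
  also have "exp ((\<kappa>\<^sup>2 / 2 - \<kappa>) * p * ?m) / exp ?a = exp (- (\<kappa>\<^sup>2 * p * ?m / 2))"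
    by (simp add: field_simps power2_eq_square flip: exp_diff)
  finally show ?thesis by (simp add: divide_right_mono)
qed

lemma expect_prod_blocks:
  assumes "finite I" "finite A" "\<And>i. i \<in> I \<Longrightarrow> T i \<subseteq> A" "disjoint_family_on T I" "0 \<le> p" "p \<le> 1"
  shows "expect p A (\<lambda>X. \<Prod>i\<in>I. h i (X \<inter> T i)) = (\<Prod>i\<in>I. expect p (T i) (h i))"
  using assms(1-4)
proof (induction I arbitrary: A rule: finite_induct)
  case empty
  then show ?case by (simp add: expect_const)
next
  case (insert i I)
  let ?B = "A - T i"
  have disj: "T j \<inter> T i = {}" if "j \<in> I" for j
    using insert.prems(3) insert.hyps that by (auto simp: disjoint_family_on_def)
  have fin: "finite (T i)" using insert.prems finite_subset by (metis insertI1)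
  have "expect p A (\<lambda>X. \<Prod>j\<in>insert i I. h j (X \<inter> T j))
      = expect p (T i \<union> ?B) (\<lambda>X. \<Prod>j\<in>insert i I. h j (X \<inter> T j))"
    using insert.prems by (simp add: Un_absorb1)
  also have "\<dots> = expect p (T i) (\<lambda>X. expect p ?B (\<lambda>Y. \<Prod>j\<in>insert i I. h j ((X \<union> Y) \<inter> T j)))"
    using assms insert.prems fin by (intro expect_Un) auto
  also have "\<dots> = expect p (T i) (\<lambda>X. expect p ?B (\<lambda>Y. h i X * (\<Prod>j\<in>I. h j (Y \<inter> T j))))"
  proof (intro expect_cong)
    fix X Y assume "X \<subseteq> T i" "Y \<subseteq> ?B"
    then have "(X \<union> Y) \<inter> T i = X" "\<And>j. j \<in> I \<Longrightarrow> (X \<union> Y) \<inter> T j = Y \<inter> T j"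
      using disj by fast+
    then show "(\<Prod>j\<in>insert i I. h j ((X \<union> Y) \<inter> T j)) = h i X * (\<Prod>j\<in>I. h j (Y \<inter> T j))"
      using insert.hyps by simp
  qed (use fin insert.prems in auto)
  also have "\<dots> = expect p (T i) (\<lambda>X. (\<Prod>j\<in>I. expect p (T j) (h j)) * h i X)"
  proof -
    have "expect p ?B (\<lambda>Y. \<Prod>j\<in>I. h j (Y \<inter> T j)) = (\<Prod>j\<in>I. expect p (T j) (h j))"
      using insert.prems disj by (intro insert.IH) (auto simp: disjoint_family_on_def)
    then show ?thesis by (simp add: expect_cmult mult.commute)
  qed
  also have "\<dots> = (\<Prod>j\<in>I. expect p (T j) (h j)) * expect p (T i) (h i)"
    by (rule expect_cmult)
  finally show ?case using insert.hyps by (simp add: mult.commute)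
qed

text \<open>Expose \<open>A\<close> first. If, whenever the outcome on \<open>A\<close> is typical, the coins of \<open>B\<close> are unlikely to
  produce the bad event, then the bad event together with a typical outcome on \<open>A\<close> is unlikely.\<close>

lemma prob_two_stage:
  assumes "finite A" "finite B" "A \<inter> B = {}" "0 \<le> p" "p \<le> 1" "0 \<le> \<beta>"
    and "\<And>X. X \<subseteq> A \<Longrightarrow> Q X \<Longrightarrow> measure_pmf.prob (random_subset B p) {Y. P (X \<union> Y)} \<le> \<beta>"
  shows "measure_pmf.prob (random_subset (A \<union> B) p) {Z. Q (Z \<inter> A) \<and> P Z} \<le> \<beta>"
proof -
  have "measure_pmf.prob (random_subset (A \<union> B) p) {Z. Q (Z \<inter> A) \<and> P Z}
      = expect p A (\<lambda>X. expect p B (\<lambda>Y. of_bool (Q ((X \<union> Y) \<inter> A) \<and> P (X \<union> Y))))"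
    using assms by (simp add: expect_Un flip: expect_of_bool)
  also have "\<dots> \<le> expect p A (\<lambda>X. \<beta>)"
  proof (intro expect_mono)
    fix X assume X: "X \<subseteq> A"
    have "expect p B (\<lambda>Y. of_bool (Q ((X \<union> Y) \<inter> A) \<and> P (X \<union> Y))) =
        expect p B (\<lambda>Y. of_bool (Q X) * of_bool (P (X \<union> Y)))"
    proof (intro expect_cong)
      fix Y assume "Y \<subseteq> B"
      then have "(X \<union> Y) \<inter> A = X" using X assms(3) by fast
      then show "of_bool (Q ((X \<union> Y) \<inter> A) \<and> P (X \<union> Y)) = (of_bool (Q X) * of_bool (P (X \<union> Y)) :: real)"
        by simp
    qed (use assms in auto)
    also have "\<dots> \<le> \<beta>"
      using assms(6,7) X by (cases "Q X") (simp_all add: expect_cmult expect_of_bool expect_const)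
    finally show "expect p B (\<lambda>Y. of_bool (Q ((X \<union> Y) \<inter> A) \<and> P (X \<union> Y))) \<le> \<beta>" .
  qed (use assms in auto)
  finally show ?thesis by (simp add: expect_const)
qed

section \<open>Pseudorandom graphs\<close>

definition pairs :: "nat set \<Rightarrow> edge set" where
  "pairs S = {e. e \<subseteq> S \<and> card e = 2}"

definition codeg :: "edge set \<Rightarrow> nat \<Rightarrow> nat \<Rightarrow> nat" where
  "codeg G u v = card (nbrs G u \<inter> nbrs G v)"

definition star :: "nat \<Rightarrow> nat \<Rightarrow> edge set" where
  "star n v = {e \<in> complete_edges n. v \<in> e}"

text \<open>The pairs whose coins decide which elements of \<open>S\<close> are neighbours of \<open>v\<close>.\<close>

definition spokes :: "nat set \<Rightarrow> nat \<Rightarrow> edge set" where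
  "spokes S v = (\<lambda>x. {x, v}) ` (S - {v})"

text \<open>The properties of \<open>G(n,p)\<close> on which the analysis of the play rests. Codegrees have mean \<open>p\<^sup>2 n\<close>,
  which may be a constant, so a few of them exceed any constant multiple of \<open>p\<^sup>2 n\<close>. The last
  condition says that the large codegrees at a vertex contribute little even to the sum of squares.
  The constants \<open>3\<close>, \<open>6\<close> and \<open>400\<close> are generous: \<open>6\<close> is \<open>2\<close> (from the upper tail) times \<open>3\<close>, and
  \<open>400\<close> is the square of the threshold \<open>20\<close> for a codegree that counts as large.\<close>

definition pseudorandom_at :: "nat \<Rightarrow> real \<Rightarrow> real \<Rightarrow> real \<Rightarrow> nat \<Rightarrow> edge set \<Rightarrow> bool" where
  "pseudorandom_at n p \<epsilon> t v \<Gamma> \<longleftrightarrow>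
     (1 - \<epsilon> / 10) * p * (real n - 1) \<le> real (card (nbrs \<Gamma> v)) \<and>
     real (card (nbrs \<Gamma> v)) \<le> 3 * p * real n \<and>
     (1 - \<epsilon> / 10) * p * real (card (pairs (nbrs \<Gamma> v))) \<le> real (card (induced \<Gamma> (nbrs \<Gamma> v))) \<and>
     real (card (induced \<Gamma> (nbrs \<Gamma> v))) \<le> 2 * p * real (card (pairs (nbrs \<Gamma> v))) + t \<and>
     (\<forall>u<n. u \<noteq> v \<longrightarrow> real (codeg \<Gamma> v u) \<le> 6 * (p\<^sup>2 * real n) + t) \<and>
     (\<forall>D. D \<subseteq> {..<n} - {v} \<longrightarrow> (\<Sum>u\<in>D. (real (codeg \<Gamma> v u))\<^sup>2)
        \<le> 400 * real (card D) * (p\<^sup>2 * real n)\<^sup>2 + \<epsilon> / 100 * (p\<^sup>2 * (real n)\<^sup>2))"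

definition pseudorandom :: "nat \<Rightarrow> real \<Rightarrow> real \<Rightarrow> real \<Rightarrow> edge set \<Rightarrow> bool" where
  "pseudorandom n p \<epsilon> t \<Gamma> \<longleftrightarrow> (\<forall>v<n. pseudorandom_at n p \<epsilon> t v \<Gamma>)"

lemma card_pairs: "finite S \<Longrightarrow> card (pairs S) = card S choose 2"
  unfolding pairs_def by (rule n_subsets)

lemma finite_pairs: "finite S \<Longrightarrow> finite (pairs S)"
  unfolding pairs_def by (rule finite_subset[of _ "Pow S"]) auto

lemma pairs_mono: "S \<subseteq> T \<Longrightarrow> pairs S \<subseteq> pairs T"
  by (auto simp: pairs_def)

lemma card_pairs_real: "finite S \<Longrightarrow> real (card (pairs S)) = real (card S) * (real (card S) - 1) / 2"
  by (cases "card S") (simp_all add: card_pairs choose_two real_of_nat_div field_simps)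

lemma card_pairs_le: "finite S \<Longrightarrow> 2 * real (card (pairs S)) \<le> (real (card S))\<^sup>2"
  by (simp add: card_pairs_real power2_eq_square algebra_simps)

lemma doubleton_complete_edges: "{u, v} \<in> complete_edges n \<longleftrightarrow> u < n \<and> v < n \<and> u \<noteq> v"
  by (auto simp: complete_edges_def card_insert_if)

lemma nbrs_subset: "G \<subseteq> complete_edges n \<Longrightarrow> nbrs G v \<subseteq> {..<n} - {v}"
  by (auto simp: nbrs_def complete_edges_def)

lemma finite_nbrs: "G \<subseteq> complete_edges n \<Longrightarrow> finite (nbrs G v)"
  by (rule finite_subset[OF nbrs_subset]) auto

lemma finite_star: "finite (star n v)"
  by (simp add: star_def finite_complete_edges)

lemma nbrs_star: "v < n \<Longrightarrow> G \<subseteq> complete_edges n \<Longrightarrow> nbrs (G \<inter> star n v) v = nbrs G v"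
  by (auto simp: nbrs_def star_def)

lemma edge_at:
  assumes "e \<in> complete_edges n" "v \<in> e"
  obtains u where "e = {u, v}" "u \<noteq> v" "u < n" "v < n"
proof -
  from assms(1) have c: "card e = 2" "e \<subseteq> {..<n}" by (auto simp: complete_edges_def)
  from c(1) obtain a b where "e = {a, b}" "a \<noteq> b" by (auto simp: card_2_iff)
  with assms(2) c(2) that show ?thesis by (auto simp: insert_commute)
qed

lemma star_spokes: "v < n \<Longrightarrow> star n v = spokes {..<n} v"
proof (intro equalityI subsetI)
  fix e assume "e \<in> star n v"
  then have "e \<in> complete_edges n" "v \<in> e" by (auto simp: star_def)
  then show "e \<in> spokes {..<n} v" by (rule edge_at) (auto simp: spokes_def)
qed (auto simp: star_def spokes_def doubleton_complete_edges)

lemma inj_spokes: "inj_on (\<lambda>x. {x, v}) (S - {v})"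
  by (auto simp: inj_on_def doubleton_eq_iff)

lemma card_spokes: "card (spokes S v) = card (S - {v})"
  unfolding spokes_def by (intro card_image inj_spokes)

lemma card_spokes_Int:
  assumes "\<And>x. x \<in> S \<Longrightarrow> x \<noteq> v \<Longrightarrow> {x, v} \<in> G \<longleftrightarrow> x \<in> N"
  shows "card (G \<inter> spokes S v) = card (S \<inter> N - {v})"
proof -
  have "G \<inter> spokes S v = (\<lambda>x. {x, v}) ` (S \<inter> N - {v})"
    using assms by (auto simp: spokes_def)
  then show ?thesis
    using card_image[OF inj_on_subset[OF inj_spokes[of v S]], of "S \<inter> N - {v}"] by auto
qed

lemma card_star: "v < n \<Longrightarrow> card (star n v) = n - 1"
  by (simp add: star_spokes card_spokes)

lemma card_nbrs:
  assumes "G \<subseteq> complete_edges n" "v < n"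
  shows "card (nbrs G v) = card (G \<inter> star n v)"
proof -
  have "card (G \<inter> spokes {..<n} v) = card ({..<n} \<inter> nbrs G v - {v})"
    by (intro card_spokes_Int) (auto simp: nbrs_def)
  also have "{..<n} \<inter> nbrs G v - {v} = nbrs G v" using nbrs_subset[OF assms(1), of v] by auto
  finally show ?thesis using assms by (simp add: star_spokes)
qed

lemma codeg_spokes: "codeg G v u = card (G \<inter> spokes (nbrs G v) u)"
proof -
  have "card (G \<inter> spokes (nbrs G v) u) = card (nbrs G v \<inter> nbrs G u - {u})"
    by (intro card_spokes_Int) (auto simp: nbrs_def)
  also have "nbrs G v \<inter> nbrs G u - {u} = nbrs G v \<inter> nbrs G u" by (auto simp: nbrs_def)
  finally show ?thesis by (simp add: codeg_def)
qed

lemma induced_pairs: "G \<subseteq> complete_edges n \<Longrightarrow> induced G S = G \<inter> pairs S"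
  by (auto simp: induced_def pairs_def complete_edges_def)

lemma square_le_power: "(real c)\<^sup>2 \<le> 2 * 2 ^ c"
proof (induction c)
  case (Suc c)
  have "c \<le> 2 \<or> c \<ge> 3" by auto
  then show ?case
  proof
    assume "c \<le> 2"
    then have "c = 0 \<or> c = 1 \<or> c = 2" by auto
    then show ?thesis by auto
  next
    assume "c \<ge> 3"
    then have "real c * real c \<ge> 3 * real c" by (intro mult_right_mono) auto
    moreover have "(real (Suc c))\<^sup>2 = real c * real c + 2 * real c + 1" "(real c)\<^sup>2 = real c * real c"
      by (simp_all add: power2_eq_square algebra_simps)
    moreover have "3 \<le> real c" using \<open>c \<ge> 3\<close> by simp
    ultimately have "(real (Suc c))\<^sup>2 \<le> 2 * (real c)\<^sup>2" by linarith
    then show ?thesis using Suc by simp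
  qed
qed simp

lemma exp_le_one_plus_double: "0 \<le> x \<Longrightarrow> x \<le> 1 \<Longrightarrow> exp x \<le> 1 + 2 * (x::real)"
proof -
  assume x: "0 \<le> x" "x \<le> 1"
  then have "x\<^sup>2 \<le> x" by (simp add: power2_eq_square mult_left_le_one_le)
  then show ?thesis using exp_bound[OF x] by linarith
qed

text \<open>A binomial variable with mean at most \<open>3\<mu>\<close> exceeds \<open>20\<mu>\<close> with probability exponentially small in
  \<open>\<mu>\<close>. The bound \<open>2 * exp (- 13 * \<mu>) * 4 ^ c\<close> dominates the truncated square: one factor \<open>2 ^ c\<close> of \<open>4 ^ c\<close>
  pays for the square, and the other for \<open>exp (13 * \<mu>)\<close>, as \<open>c > 20 * \<mu>\<close> and \<open>20 ln 2 > 13\<close>.\<close>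

lemma codegree_tail_mean:
  fixes p \<mu> M :: real
  assumes "finite T" "0 \<le> p" "p \<le> 1" "0 \<le> \<mu>" "p * real (card T) \<le> 3 * \<mu>"
  shows "expect p T (\<lambda>X. if 20 * \<mu> < real (card X) \<and> real (card X) \<le> M then (real (card X))\<^sup>2 else 0)
    \<le> 2 * exp (- 4 * \<mu>)"
proof -
  have "expect p T (\<lambda>X. if 20 * \<mu> < real (card X) \<and> real (card X) \<le> M then (real (card X))\<^sup>2 else 0)
      \<le> expect p T (\<lambda>X. 2 * exp (- 13 * \<mu>) * 4 ^ card X)"
  proof (intro expect_mono)
    fix X
    let ?c = "card X"
    show "(if 20 * \<mu> < real ?c \<and> real ?c \<le> M then (real ?c)\<^sup>2 else 0) \<le> 2 * exp (- 13 * \<mu>) * 4 ^ ?c"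
    proof (cases "20 * \<mu> < real ?c \<and> real ?c \<le> M")
      case True
      have "exp (13 * \<mu>) \<le> exp (ln 2 * real ?c)"
      proof -
        have "(2/3) * real ?c \<le> ln 2 * real ?c"
          using ln2_ge_two_thirds by (intro mult_right_mono) auto
        moreover have "13 * \<mu> \<le> (2/3) * real ?c" using True assms by linarith
        ultimately show ?thesis by simp
      qed
      also have "\<dots> = 2 ^ ?c" by (simp add: exp_of_nat2_mult)
      finally have "1 \<le> exp (- 13 * \<mu>) * 2 ^ ?c" by (simp add: exp_minus field_simps)
      then have "2 * 2 ^ ?c * 1 \<le> 2 * 2 ^ ?c * (exp (- 13 * \<mu>) * 2 ^ ?c)"
        by (intro mult_left_mono) auto
      moreover have "(4::real) ^ ?c = 2 ^ ?c * 2 ^ ?c" by (simp flip: power_mult_distrib)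
      ultimately have "2 * 2 ^ ?c \<le> 2 * exp (- 13 * \<mu>) * 4 ^ ?c" by (simp add: mult.assoc mult.left_commute)
      then show ?thesis using square_le_power[of ?c] True by simp
    qed auto
  qed (use assms in auto)
  also have "\<dots> = 2 * exp (- 13 * \<mu>) * (1 + 3 * p) ^ card T"
    using assms by (simp add: expect_cmult expect_power_card)
  also have "\<dots> \<le> 2 * exp (- 13 * \<mu>) * exp (9 * \<mu>)"
  proof (intro mult_left_mono)
    have "(1 + 3 * p) ^ card T \<le> exp (3 * p) ^ card T"
      using assms by (intro power_mono) auto
    also have "\<dots> = exp (3 * (p * real (card T)))" by (simp add: mult_ac flip: exp_of_nat_mult)
    also have "\<dots> \<le> exp (9 * \<mu>)" using assms by simp
    finally show "(1 + 3 * p) ^ card T \<le> exp (9 * \<mu>)" .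
  qed auto
  also have "\<dots> = 2 * exp (- 4 * \<mu>)" by (simp flip: exp_add)
  finally show ?thesis .
qed

text \<open>The summands depend on disjoint blocks of coins and are bounded by \<open>M\<^sup>2\<close>, so the exponential moment
  of their sum, scaled by \<open>M\<^sup>2\<close>, factorises. The mean of the sum is at most half of the threshold
  \<open>\<delta> * \<mu> * n\<close>, because a single mean is exponentially small in \<open>\<mu>\<close>.\<close>

lemma codegree_tail_sum:
  fixes p \<mu> M \<delta> :: real
  assumes "finite A" "finite I" "\<And>u. u \<in> I \<Longrightarrow> T u \<subseteq> A" "disjoint_family_on T I" "0 \<le> p" "p \<le> 1"
    and "0 \<le> \<mu>" "\<And>u. u \<in> I \<Longrightarrow> p * real (card (T u)) \<le> 3 * \<mu>" "0 < M" "real (card I) \<le> n"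
    and "8 * exp (- 4 * \<mu>) \<le> \<delta> * \<mu>"
  shows "measure_pmf.prob (random_subset A p) {X. (\<Sum>u\<in>I. if 20 * \<mu> < real (card (X \<inter> T u)) \<and>
      real (card (X \<inter> T u)) \<le> M then (real (card (X \<inter> T u)))\<^sup>2 else 0) > \<delta> * \<mu> * n}
    \<le> exp (- (\<delta> * \<mu> * n / (2 * M\<^sup>2)))"
proof -
  define g where "g = (\<lambda>X :: 'a set. if 20 * \<mu> < real (card X) \<and> real (card X) \<le> M then (real (card X))\<^sup>2 else 0)"
  let ?E = "exp (\<delta> * \<mu> * n / M\<^sup>2)"
  have g: "0 \<le> g X / M\<^sup>2" "g X / M\<^sup>2 \<le> 1" for X
    using assms(9) by (auto simp: g_def divide_simps intro: power_mono)
  have mgf: "expect p (T u) (\<lambda>X. exp (g X / M\<^sup>2)) \<le> exp (4 * exp (- 4 * \<mu>) / M\<^sup>2)" if "u \<in> I" for u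
  proof -
    have fin: "finite (T u)" using assms(1,3) that finite_subset by blast
    have "expect p (T u) (\<lambda>X. exp (g X / M\<^sup>2)) \<le> expect p (T u) (\<lambda>X. 1 + (2 / M\<^sup>2) * g X)"
      using exp_le_one_plus_double[OF g] by (intro expect_mono fin) auto
    also have "\<dots> = 1 + (2 / M\<^sup>2) * expect p (T u) g"
      using fin by (simp only: expect_add expect_cmult expect_const)
    also have "\<dots> \<le> 1 + (2 / M\<^sup>2) * (2 * exp (- 4 * \<mu>))"
      unfolding g_def using codegree_tail_mean[OF fin, of p \<mu> M] assms that
      by (intro add_left_mono mult_left_mono) auto
    also have "\<dots> \<le> exp ((2 / M\<^sup>2) * (2 * exp (- 4 * \<mu>)))" by (rule exp_ge_add_one_self)
    finally show ?thesis by simp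
  qed
  have "measure_pmf.prob (random_subset A p) {X. (\<Sum>u\<in>I. g (X \<inter> T u)) > \<delta> * \<mu> * n}
      \<le> expect p A (\<lambda>X. \<Prod>u\<in>I. exp (g (X \<inter> T u) / M\<^sup>2)) / ?E"
    using assms(1,2,9) by (intro expect_markov)
      (auto simp: prod_nonneg divide_right_mono simp flip: exp_sum sum_divide_distrib)
  also have "expect p A (\<lambda>X. \<Prod>u\<in>I. exp (g (X \<inter> T u) / M\<^sup>2)) =
      (\<Prod>u\<in>I. expect p (T u) (\<lambda>X. exp (g X / M\<^sup>2)))"
    using assms by (intro expect_prod_blocks) auto
  also have "\<dots> \<le> (\<Prod>u\<in>I. exp (4 * exp (- 4 * \<mu>) / M\<^sup>2))"
    using mgf by (intro prod_mono) (auto simp: expect_def intro!: integral_nonneg_AE)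
  also have "\<dots> = exp (real (card I) * (4 * exp (- 4 * \<mu>) / M\<^sup>2))" by (simp flip: exp_of_nat_mult)
  also have "\<dots> \<le> exp (\<delta> * \<mu> * n / (2 * M\<^sup>2))"
  proof -
    have "real (card I) * (4 * exp (- 4 * \<mu>)) \<le> n * (\<delta> * \<mu> / 2)"
      using assms by (intro mult_mono) auto
    then show ?thesis using assms(9) by (simp add: divide_simps mult_ac)
  qed
  also have "exp (\<delta> * \<mu> * n / (2 * M\<^sup>2)) / ?E = exp (- (\<delta> * \<mu> * n / (2 * M\<^sup>2)))"
    using assms(9) by (simp add: field_simps flip: exp_diff)
  finally show ?thesis by (simp add: g_def divide_right_mono)
qed

lemma prob_mono_on:
  assumes "finite A" "\<And>X. X \<subseteq> A \<Longrightarrow> P X \<Longrightarrow> Q X"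
  shows "measure_pmf.prob (random_subset A p) {X. P X} \<le> measure_pmf.prob (random_subset A p) {X. Q X}"
  unfolding expect_of_bool[symmetric] using assms by (intro expect_mono) auto

lemma prob_disj:
  "measure_pmf.prob M {X. P X \<or> Q X} \<le> measure_pmf.prob M {X. P X} + measure_pmf.prob M {X. Q X}"
  by (simp add: Collect_disj_eq measure_Un_le)

lemma prob_bex:
  assumes "finite I" "\<And>i. i \<in> I \<Longrightarrow> measure_pmf.prob M {X. P i X} \<le> \<beta>"
  shows "measure_pmf.prob M {X. \<exists>i\<in>I. P i X} \<le> real (card I) * \<beta>"
proof -
  have "{X. \<exists>i\<in>I. P i X} = (\<Union>i\<in>I. {X. P i X})" by auto
  then have "measure_pmf.prob M {X. \<exists>i\<in>I. P i X} \<le> (\<Sum>i\<in>I. measure_pmf.prob M {X. P i X})"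
    using measure_pmf.finite_measure_subadditive_finite[OF assms(1), of "\<lambda>i. {X. P i X}" M] by simp
  also have "\<dots> \<le> (\<Sum>i\<in>I. \<beta>)" using assms(2) by (rule sum_mono)
  finally show ?thesis by simp
qed

definition codegree_excess :: "nat \<Rightarrow> real \<Rightarrow> real \<Rightarrow> edge set \<Rightarrow> nat \<Rightarrow> real" where
  "codegree_excess n \<mu> M \<Gamma> v = (\<Sum>u\<in>{..<n} - nbrs \<Gamma> v - {v}.
     if 20 * \<mu> < real (codeg \<Gamma> v u) \<and> real (codeg \<Gamma> v u) \<le> M then (real (codeg \<Gamma> v u))\<^sup>2 else 0)"

text \<open>Codegrees up to \<open>20 * \<mu>\<close> give the main term. A larger codegree forces \<open>\<mu> < t\<close> and is then at most \<open>M\<close>;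
  it is counted by \<open>codegree_excess\<close> unless \<open>u\<close> is a neighbour of \<open>v\<close>. The neighbours
  are treated by the trivial bound \<open>M\<^sup>2\<close> since there are only few of them: their codegrees with \<open>v\<close>
  depend on overlapping sets of coins.\<close>

lemma codegree_square_sum:
  fixes \<mu> M \<delta> t :: real
  assumes "finite D" "D \<subseteq> {..<n} - {v}" "finite (nbrs \<Gamma> v)" "0 \<le> \<mu>" "0 \<le> \<delta>" "0 \<le> t"
    and cod: "\<And>u. u \<in> D \<Longrightarrow> real (codeg \<Gamma> v u) \<le> 6 * \<mu> + t"
    and M: "M = 5 / 2 * t"
    and exc: "codegree_excess n \<mu> M \<Gamma> v \<le> \<delta>"
    and small: "real (card (nbrs \<Gamma> v)) * M\<^sup>2 \<le> \<delta>"
  shows "(\<Sum>u\<in>D. (real (codeg \<Gamma> v u))\<^sup>2) \<le> 400 * real (card D) * \<mu>\<^sup>2 + 2 * \<delta>"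
proof -
  let ?N = "nbrs \<Gamma> v"
  let ?g = "\<lambda>u. if 20 * \<mu> < real (codeg \<Gamma> v u) \<and> real (codeg \<Gamma> v u) \<le> M then (real (codeg \<Gamma> v u))\<^sup>2 else 0"
  have "(real (codeg \<Gamma> v u))\<^sup>2 \<le> 400 * \<mu>\<^sup>2 + (of_bool (u \<in> ?N) * M\<^sup>2 + of_bool (u \<notin> ?N) * ?g u)"
    if u: "u \<in> D" for u
  proof (cases "real (codeg \<Gamma> v u) \<le> 20 * \<mu>")
    case True
    then have "(real (codeg \<Gamma> v u))\<^sup>2 \<le> (20 * \<mu>)\<^sup>2" by (intro power_mono) auto
    then show ?thesis by (auto simp: power_mult_distrib add_increasing2)
  next
    case False
    then have "real (codeg \<Gamma> v u) \<le> M" using cod[OF u] M assms(4) by linarith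
    moreover from this have "(real (codeg \<Gamma> v u))\<^sup>2 \<le> M\<^sup>2" by (intro power_mono) auto
    ultimately show ?thesis using False by (auto intro: add_increasing)
  qed
  then have "(\<Sum>u\<in>D. (real (codeg \<Gamma> v u))\<^sup>2)
      \<le> (\<Sum>u\<in>D. 400 * \<mu>\<^sup>2 + (of_bool (u \<in> ?N) * M\<^sup>2 + of_bool (u \<notin> ?N) * ?g u))"
    by (rule sum_mono)
  also have "\<dots> = 400 * real (card D) * \<mu>\<^sup>2 + (real (card (D \<inter> ?N)) * M\<^sup>2 + (\<Sum>u\<in>D - ?N. ?g u))"
  proof -
    have "(\<Sum>u\<in>D. of_bool (u \<in> ?N) * M\<^sup>2) = real (card (D \<inter> ?N)) * M\<^sup>2"
      using assms(1) by (simp add: sum.inter_restrict[symmetric] of_bool_def if_distrib[of "\<lambda>x. x * _"] cong: if_cong)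
    moreover have "(\<Sum>u\<in>D. of_bool (u \<notin> ?N) * ?g u) = (\<Sum>u\<in>D - ?N. ?g u)"
      using assms(1) by (intro sum.mono_neutral_cong_right) auto
    ultimately show ?thesis by (simp only: sum.distrib) simp
  qed
  also have "real (card (D \<inter> ?N)) * M\<^sup>2 \<le> \<delta>"
    using assms(3) by (intro order.trans[OF mult_right_mono small]) (auto intro: card_mono)
  also have "(\<Sum>u\<in>D - ?N. ?g u) \<le> \<delta>"
    using assms(2) by (intro order.trans[OF sum_mono2 exc[unfolded codegree_excess_def]]) auto
  finally show ?thesis by simp
qed

text \<open>Expose the star of \<open>v\<close> first. Given the neighbourhood \<open>S\<close> of \<open>v\<close>, the number of edges inside \<open>S\<close> and
  the codegrees with \<open>v\<close> are binomial variables in the remaining coins.\<close>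

lemma prob_pseudorandom_at:
  fixes n v :: nat and p \<epsilon> t :: real
  defines "\<mu> \<equiv> p\<^sup>2 * real n" and "M \<equiv> 5 / 2 * t"
  assumes v: "v < n" and p: "0 \<le> p" "p \<le> 1" and eps: "0 < \<epsilon>" "\<epsilon> < 1" and t: "0 < t"
    and N1: "t \<le> p * real n"
    and N2: "t \<le> (\<epsilon> / 10)\<^sup>2 * p * (real n - 1) / 2"
    and N3: "\<And>s. (1 - \<epsilon> / 10) * p * (real n - 1) \<le> s \<Longrightarrow> t \<le> (\<epsilon> / 10)\<^sup>2 * p * (s * (s - 1) / 2) / 2"
    and N5: "8 * exp (- 4 * \<mu>) \<le> \<epsilon> / 200 * \<mu>"
    and N6: "t \<le> \<epsilon> / 200 * \<mu> * real n / (2 * M\<^sup>2)"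
    and N7: "3 * p * real n * M\<^sup>2 \<le> \<epsilon> / 200 * \<mu> * real n"
  shows "measure_pmf.prob (gnp n p) {\<Gamma>. \<not> pseudorandom_at n p \<epsilon> t v \<Gamma>} \<le> (real n + 5) * exp (- t)"
proof -
  let ?K = "complete_edges n"
  let ?S = "star n v"
  let ?O = "?K - ?S"
  define \<kappa> where "\<kappa> = \<epsilon> / 10"
  define low where "low = (\<lambda>\<Gamma>. real (card (nbrs \<Gamma> v)) < (1 - \<kappa>) * p * (real n - 1))"
  define high where "high = (\<lambda>\<Gamma>. real (card (nbrs \<Gamma> v)) > 3 * p * real n)"
  define low2 where "low2 = (\<lambda>\<Gamma>. real (card (induced \<Gamma> (nbrs \<Gamma> v))) < (1 - \<kappa>) * p * real (card (pairs (nbrs \<Gamma> v))))"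
  define high2 where "high2 = (\<lambda>\<Gamma>. real (card (induced \<Gamma> (nbrs \<Gamma> v))) > 2 * p * real (card (pairs (nbrs \<Gamma> v))) + t)"
  define cod where "cod = (\<lambda>\<Gamma>. \<exists>u\<in>{..<n}-{v}. real (codeg \<Gamma> v u) > 6 * \<mu> + t)"
  define exc where "exc = (\<lambda>\<Gamma>. codegree_excess n \<mu> M \<Gamma> v > \<epsilon> / 200 * \<mu> * real n)"
  define bad2 where "bad2 = (\<lambda>\<Gamma>. low2 \<Gamma> \<or> high2 \<Gamma> \<or> cod \<Gamma> \<or> exc \<Gamma>)"
  define good1 where "good1 = (\<lambda>\<Gamma>. \<not> low \<Gamma> \<and> \<not> high \<Gamma>)"
  have fin: "finite ?K" "finite ?S" "finite ?O" and SK: "?S \<subseteq> ?K"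
    by (auto simp: finite_complete_edges finite_star star_def)
  have mu: "0 \<le> \<mu>" using p by (simp add: \<mu>_def)
  have \<kappa>: "0 \<le> \<kappa>" using eps by (simp add: \<kappa>_def)

  have ok: "low \<Gamma> \<or> high \<Gamma> \<or> (good1 (\<Gamma> \<inter> ?S) \<and> bad2 \<Gamma>)" if "\<Gamma> \<subseteq> ?K" "\<not> pseudorandom_at n p \<epsilon> t v \<Gamma>" for \<Gamma>
  proof (rule ccontr)
    assume contra: "\<not> ?thesis"
    have "nbrs (\<Gamma> \<inter> ?S) v = nbrs \<Gamma> v" using nbrs_star[OF v that(1)] .
    then have "good1 (\<Gamma> \<inter> ?S) \<longleftrightarrow> good1 \<Gamma>" by (simp add: good1_def low_def high_def)
    with contra have *: "\<not> low \<Gamma>" "\<not> high \<Gamma>" "\<not> low2 \<Gamma>" "\<not> high2 \<Gamma>" "\<not> cod \<Gamma>" "\<not> exc \<Gamma>"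
      by (auto simp: good1_def bad2_def)
    have sq: "(\<Sum>u\<in>D. (real (codeg \<Gamma> v u))\<^sup>2) \<le> 400 * real (card D) * \<mu>\<^sup>2 + 2 * (\<epsilon> / 200 * \<mu> * real n)"
      if D: "D \<subseteq> {..<n} - {v}" for D
    proof (rule codegree_square_sum[where t = t and M = M])
      show "finite D" using D finite_subset by blast
      show "real (codeg \<Gamma> v u) \<le> 6 * \<mu> + t" if "u \<in> D" for u
        using *(5) D that by (force simp: cod_def not_less)
      have "real (card (nbrs \<Gamma> v)) * M\<^sup>2 \<le> (3 * p * real n) * M\<^sup>2"
        using *(2) by (intro mult_right_mono) (auto simp: high_def)
      then show "real (card (nbrs \<Gamma> v)) * M\<^sup>2 \<le> \<epsilon> / 200 * \<mu> * real n" using N7 by linarith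
    qed (use D mu eps t *(6) finite_nbrs[OF \<open>\<Gamma> \<subseteq> ?K\<close>] in \<open>auto simp: M_def exc_def\<close>)
    have "(\<Sum>u\<in>D. (real (codeg \<Gamma> v u))\<^sup>2) \<le> 400 * real (card D) * (p\<^sup>2 * real n)\<^sup>2 + \<epsilon> / 100 * (p\<^sup>2 * (real n)\<^sup>2)"
      if D: "D \<subseteq> {..<n} - {v}" for D
      using sq[OF D] by (simp add: \<mu>_def power2_eq_square mult_ac)
    moreover have "real (codeg \<Gamma> v u) \<le> 6 * (p\<^sup>2 * real n) + t" if "u < n" "u \<noteq> v" for u
      using *(5) that by (force simp: cod_def not_less \<mu>_def)
    ultimately have "pseudorandom_at n p \<epsilon> t v \<Gamma>" using *(1-4)
      by (simp add: pseudorandom_at_def low_def high_def low2_def high2_def not_less \<kappa>_def)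
    with that(2) show False by blast
  qed

  have n1: "1 \<le> n" using v by simp
  have "measure_pmf.prob (random_subset ?K p) {\<Gamma>. low \<Gamma>}
      \<le> measure_pmf.prob (random_subset ?K p) {\<Gamma>. real (card (\<Gamma> \<inter> ?S)) < (1 - \<kappa>) * p * real (card ?S)}"
    using v n1 by (intro prob_mono_on fin) (simp add: low_def card_nbrs card_star of_nat_diff)
  also have "\<dots> \<le> exp (- (\<kappa>\<^sup>2 * p * real (card ?S) / 2))"
    using fin SK p \<kappa> by (intro lower_tail)
  also have "\<dots> \<le> exp (- t)" using N2 v n1 by (simp add: card_star \<kappa>_def of_nat_diff)
  finally have p1: "measure_pmf.prob (random_subset ?K p) {\<Gamma>. low \<Gamma>} \<le> exp (- t)" .

  have "measure_pmf.prob (random_subset ?K p) {\<Gamma>. high \<Gamma>}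
      \<le> measure_pmf.prob (random_subset ?K p) {\<Gamma>. real (card (\<Gamma> \<inter> ?S)) > 2 * p * real (card ?S) + t}"
  proof (intro prob_mono_on fin)
    fix \<Gamma> assume "\<Gamma> \<subseteq> ?K" "high \<Gamma>"
    moreover have "2 * p * real (card ?S) \<le> 2 * p * real n"
      using v p by (intro mult_left_mono) (auto simp: card_star)
    ultimately show "real (card (\<Gamma> \<inter> ?S)) > 2 * p * real (card ?S) + t"
      using N1 v by (simp add: high_def card_nbrs)
  qed
  also have "\<dots> \<le> exp (- t)" using fin SK p by (intro upper_tail)
  finally have p2: "measure_pmf.prob (random_subset ?K p) {\<Gamma>. high \<Gamma>} \<le> exp (- t)" .

  have stage2: "measure_pmf.prob (random_subset ?O p) {Y. bad2 (X \<union> Y)} \<le> (real n + 3) * exp (- t)"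
    if X: "X \<subseteq> ?S" "good1 X" for X
  proof -
    define S where "S = nbrs X v"
    have XK: "X \<subseteq> ?K" using X SK by blast
    have S: "finite S" "S \<subseteq> {..<n} - {v}" using nbrs_subset[OF XK] finite_nbrs[OF XK] by (auto simp: S_def)
    have PO: "pairs S \<subseteq> ?O" using S by (auto simp: pairs_def complete_edges_def star_def)
    have TO: "spokes S u \<subseteq> ?O" if "u < n" "u \<noteq> v" for u
      using S that by (auto simp: spokes_def star_def doubleton_complete_edges)
    have cardT: "card (spokes S u) \<le> card S" for u
      using S by (auto simp: card_spokes intro: card_mono)
    have S_low: "(1 - \<kappa>) * p * (real n - 1) \<le> real (card S)" and S_high: "real (card S) \<le> 3 * p * real n"
      using X(2) by (auto simp: good1_def low_def high_def S_def)
    have nb: "nbrs (X \<union> Y) v = S" if "Y \<subseteq> ?O" for Y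
      using that v by (fastforce simp: nbrs_def S_def star_def)
    have ind: "induced (X \<union> Y) S = Y \<inter> pairs S" if "Y \<subseteq> ?O" for Y
    proof -
      have "X \<union> Y \<subseteq> ?K" using that XK by blast
      then show ?thesis using PO X(1) by (auto simp: induced_pairs)
    qed
    have cdg: "codeg (X \<union> Y) v u = card (Y \<inter> spokes S u)" if "Y \<subseteq> ?O" "u < n" "u \<noteq> v" for Y u
    proof -
      have "(X \<union> Y) \<inter> spokes S u = Y \<inter> spokes S u" using TO[OF that(2,3)] X(1) by auto
      then show ?thesis by (simp add: codeg_spokes nb[OF that(1)])
    qed
    have q1: "measure_pmf.prob (random_subset ?O p) {Y. low2 (X \<union> Y)} \<le> exp (- t)"
    proof -
      have "measure_pmf.prob (random_subset ?O p) {Y. low2 (X \<union> Y)}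
        \<le> measure_pmf.prob (random_subset ?O p) {Y. real (card (Y \<inter> pairs S)) < (1 - \<kappa>) * p * real (card (pairs S))}"
        using fin by (intro prob_mono_on) (auto simp: low2_def nb ind)
      also have "\<dots> \<le> exp (- (\<kappa>\<^sup>2 * p * real (card (pairs S)) / 2))"
        using fin PO p \<kappa> by (intro lower_tail)
      also have "\<dots> \<le> exp (- t)"
        using N3[OF S_low[unfolded \<kappa>_def]] S(1) by (simp add: card_pairs_real \<kappa>_def)
      finally show ?thesis .
    qed
    have q2: "measure_pmf.prob (random_subset ?O p) {Y. high2 (X \<union> Y)} \<le> exp (- t)"
    proof -
      have "measure_pmf.prob (random_subset ?O p) {Y. high2 (X \<union> Y)}
        \<le> measure_pmf.prob (random_subset ?O p) {Y. real (card (Y \<inter> pairs S)) > 2 * p * real (card (pairs S)) + t}"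
        using fin by (intro prob_mono_on) (auto simp: high2_def nb ind)
      also have "\<dots> \<le> exp (- t)" using fin PO p by (intro upper_tail)
      finally show ?thesis .
    qed
    have q3: "measure_pmf.prob (random_subset ?O p) {Y. cod (X \<union> Y)} \<le> real n * exp (- t)"
    proof -
      have "measure_pmf.prob (random_subset ?O p) {Y. cod (X \<union> Y)}
        \<le> measure_pmf.prob (random_subset ?O p) {Y. \<exists>u\<in>{..<n}-{v}. real (card (Y \<inter> spokes S u)) > 2 * p * real (card (spokes S u)) + t}"
      proof (intro prob_mono_on fin)
        fix Y assume Y: "Y \<subseteq> ?O" "cod (X \<union> Y)"
        then obtain u where u: "u < n" "u \<noteq> v" "real (codeg (X \<union> Y) v u) > 6 * \<mu> + t"
          by (auto simp: cod_def)
        have "2 * p * real (card (spokes S u)) \<le> 2 * p * (3 * p * real n)"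
          using p S_high cardT[of u] by (intro mult_left_mono) auto
        also have "\<dots> = 6 * \<mu>" by (simp add: \<mu>_def power2_eq_square)
        finally show "\<exists>u\<in>{..<n}-{v}. real (card (Y \<inter> spokes S u)) > 2 * p * real (card (spokes S u)) + t"
          using u cdg[OF Y(1) u(1,2)] by (intro bexI[of _ u]) auto
      qed
      also have "\<dots> \<le> real (card ({..<n}-{v})) * exp (- t)"
        using fin TO p by (intro prob_bex upper_tail) auto
      also have "\<dots> \<le> real n * exp (- t)"
        using v by (intro mult_right_mono) auto
      finally show ?thesis .
    qed
    have q4: "measure_pmf.prob (random_subset ?O p) {Y. exc (X \<union> Y)} \<le> exp (- t)"
    proof -
      let ?I = "{..<n} - S - {v}"
      let ?sum = "\<lambda>Y. \<Sum>u\<in>?I. if 20 * \<mu> < real (card (Y \<inter> spokes S u)) \<and>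
        real (card (Y \<inter> spokes S u)) \<le> M then (real (card (Y \<inter> spokes S u)))\<^sup>2 else 0"
      have "measure_pmf.prob (random_subset ?O p) {Y. exc (X \<union> Y)}
        \<le> measure_pmf.prob (random_subset ?O p) {Y. ?sum Y > \<epsilon> / 200 * \<mu> * real n}"
      proof (intro prob_mono_on fin)
        fix Y assume Y: "Y \<subseteq> ?O" "exc (X \<union> Y)"
        have "codegree_excess n \<mu> M (X \<union> Y) v = ?sum Y"
          unfolding codegree_excess_def nb[OF Y(1)] by (intro sum.cong) (auto simp: cdg[OF Y(1)])
        then show "?sum Y > \<epsilon> / 200 * \<mu> * real n" using Y(2) by (simp add: exc_def)
      qed
      also have "\<dots> \<le> exp (- (\<epsilon> / 200 * \<mu> * real n / (2 * M\<^sup>2)))"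
      proof (rule codegree_tail_sum)
        show "disjoint_family_on (spokes S) ?I"
          by (auto simp: disjoint_family_on_def spokes_def doubleton_eq_iff)
        show "p * real (card (spokes S u)) \<le> 3 * \<mu>" for u
        proof -
          have "p * real (card (spokes S u)) \<le> p * (3 * p * real n)"
            using p S_high cardT[of u] by (intro mult_left_mono) auto
          then show ?thesis by (simp add: \<mu>_def power2_eq_square)
        qed
        have "card ?I \<le> card {..<n}" by (intro card_mono) auto
        then show "real (card ?I) \<le> real n" by simp
      qed (use TO fin p mu t N5 in \<open>auto simp: M_def\<close>)
      also have "\<dots> \<le> exp (- t)" using N6 by simp
      finally show ?thesis .
    qed
    have "measure_pmf.prob (random_subset ?O p) {Y. bad2 (X \<union> Y)} \<le>
        exp (- t) + (exp (- t) + (real n * exp (- t) + exp (- t)))"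
      unfolding bad2_def
      by (intro order.trans[OF prob_disj] add_mono q1 q2 q3 q4)
    then show ?thesis by (simp add: algebra_simps)
  qed
  have "measure_pmf.prob (random_subset (?S \<union> ?O) p) {\<Gamma>. good1 (\<Gamma> \<inter> ?S) \<and> bad2 \<Gamma>} \<le> (real n + 3) * exp (- t)"
    using fin p by (intro prob_two_stage stage2) auto
  then have p3: "measure_pmf.prob (random_subset ?K p) {\<Gamma>. good1 (\<Gamma> \<inter> ?S) \<and> bad2 \<Gamma>} \<le> (real n + 3) * exp (- t)"
    using SK by (simp add: Un_absorb1)
  have "measure_pmf.prob (random_subset ?K p) {\<Gamma>. \<not> pseudorandom_at n p \<epsilon> t v \<Gamma>}
      \<le> measure_pmf.prob (random_subset ?K p) {\<Gamma>. low \<Gamma> \<or> high \<Gamma> \<or> (good1 (\<Gamma> \<inter> ?S) \<and> bad2 \<Gamma>)}"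
    by (rule prob_mono_on[OF fin(1) ok])
  also have "\<dots> \<le> exp (- t) + (exp (- t) + (real n + 3) * exp (- t))"
    by (intro order.trans[OF prob_disj] add_mono p1 p2 p3)
  finally show ?thesis unfolding gnp_def by (simp add: algebra_simps)
qed

lemma prob_pseudorandom:
  fixes n :: nat and p \<epsilon> t :: real
  defines "\<mu> \<equiv> p\<^sup>2 * real n" and "M \<equiv> 5 / 2 * t"
  assumes p: "0 \<le> p" "p \<le> 1" and eps: "0 < \<epsilon>" "\<epsilon> < 1" and t: "0 < t"
    and N1: "t \<le> p * real n"
    and N2: "t \<le> (\<epsilon> / 10)\<^sup>2 * p * (real n - 1) / 2"
    and N3: "\<And>s. (1 - \<epsilon> / 10) * p * (real n - 1) \<le> s \<Longrightarrow> t \<le> (\<epsilon> / 10)\<^sup>2 * p * (s * (s - 1) / 2) / 2"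
    and N5: "8 * exp (- 4 * \<mu>) \<le> \<epsilon> / 200 * \<mu>"
    and N6: "t \<le> \<epsilon> / 200 * \<mu> * real n / (2 * M\<^sup>2)"
    and N7: "3 * p * real n * M\<^sup>2 \<le> \<epsilon> / 200 * \<mu> * real n"
  shows "measure_pmf.prob (gnp n p) {\<Gamma>. \<not> pseudorandom n p \<epsilon> t \<Gamma>} \<le> real n * ((real n + 5) * exp (- t))"
proof -
  have "measure_pmf.prob (gnp n p) {\<Gamma>. \<not> pseudorandom n p \<epsilon> t \<Gamma>}
      \<le> real (card {..<n}) * ((real n + 5) * exp (- t))"
    unfolding pseudorandom_def not_all not_imp Bex_def[symmetric] lessThan_iff[symmetric]
    using assms by (intro prob_bex prob_pseudorandom_at) auto
  then show ?thesis by simp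
qed

section \<open>Sums and unions over the prefixes of a history\<close>

text \<open>Quantities that accumulate during the play are functions of the state alone if they are written as sums
  or unions over all prefixes of the history, each taken together with the event that follows it.\<close>

definition psum :: "(event list \<Rightarrow> event \<Rightarrow> real) \<Rightarrow> event list \<Rightarrow> real" where
  "psum w H = (\<Sum>k<length H. w (take k H) (H ! k))"

definition gather :: "(event list \<Rightarrow> event \<Rightarrow> 'a set) \<Rightarrow> event list \<Rightarrow> 'a set" where
  "gather g H = (\<Union>k<length H. g (take k H) (H ! k))"

lemma psum_Nil [simp]: "psum w [] = 0"
  by (simp add: psum_def)

lemma psum_snoc [simp]: "psum w (H @ [z]) = psum w H + w H z"
  by (simp add: psum_def nth_append)

lemma gather_Nil [simp]: "gather g [] = {}"
  by (simp add: gather_def)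

lemma gather_snoc [simp]: "gather g (H @ [z]) = gather g H \<union> g H z"
  by (auto simp: gather_def nth_append lessThan_Suc)

text \<open>A weight \<open>w H e\<close> is what the flip of \<open>e\<close> at history \<open>H\<close> contributes if the coin succeeds. The
  following two sums are the total weight at stake and the total weight realised.\<close>

definition flip_sum :: "(event list \<Rightarrow> edge \<Rightarrow> real) \<Rightarrow> event list \<Rightarrow> real" where
  "flip_sum w = psum (\<lambda>H z. case z of Coin e x \<Rightarrow> w H e | Round e S \<Rightarrow> 0)"

definition hit_sum :: "(event list \<Rightarrow> edge \<Rightarrow> real) \<Rightarrow> event list \<Rightarrow> real" where
  "hit_sum w = psum (\<lambda>H z. case z of Coin e x \<Rightarrow> if x then w H e else 0 | Round e S \<Rightarrow> 0)"

lemma flip_sum_simps [simp]: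
  "flip_sum w [] = 0"
  "flip_sum w (H @ [Coin e x]) = flip_sum w H + w H e"
  "flip_sum w (H @ [Round e S]) = flip_sum w H"
  by (simp_all add: flip_sum_def)

lemma hit_sum_simps [simp]:
  "hit_sum w [] = 0"
  "hit_sum w (H @ [Coin e x]) = hit_sum w H + (if x then w H e else 0)"
  "hit_sum w (H @ [Round e S]) = hit_sum w H"
  by (simp_all add: hit_sum_def)

lemma present_snoc [simp]:
  "present (H @ [Coin e x]) = (if x then insert e (present H) else present H)"
  "present (H @ [Round e S]) = present H"
  by (auto simp: present_def)

lemma maker_edges_snoc [simp]:
  "maker_edges (H @ [Coin e x]) = maker_edges H"
  "maker_edges (H @ [Round e S]) = insert e (maker_edges H)"
  by (auto simp: maker_edges_def)

lemma breaker_edges_snoc [simp]: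
  "breaker_edges (H @ [Coin e x]) = breaker_edges H"
  "breaker_edges (H @ [Round e S]) = breaker_edges H \<union> S"
  by (auto simp: breaker_edges_def)

lemmas [simp] = claimed_snoc exposed_snoc

lemma state_Nil [simp]:
  "present [] = {}" "exposed [] = {}" "claimed [] = {}" "maker_edges [] = {}" "breaker_edges [] = {}"
  by (auto simp: present_def exposed_def claimed_def maker_edges_def breaker_edges_def)

lemma present_subset_exposed: "present H \<subseteq> exposed H"
  by (auto simp: present_def exposed_def)

lemma claimed_filter: "claimed (filter is_Round H) = claimed H"
  by (auto simp: claimed_def maker_edges_def breaker_edges_def)

section \<open>Maker's strategy\<close>

definition stolen :: "event list \<Rightarrow> edge set" where
  "stolen = gather (\<lambda>H z. case z of Coin e x \<Rightarrow> {} | Round e S \<Rightarrow> S - exposed H)"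

text \<open>The steals that Breaker could aim at the neighbourhood of \<open>v\<close>: both edges that join the pair
  to \<open>v\<close> were already present when he claimed it.\<close>

definition stolen_in :: "nat \<Rightarrow> event list \<Rightarrow> edge set" where
  "stolen_in v = gather (\<lambda>H z. case z of Coin e x \<Rightarrow> {}
     | Round e S \<Rightarrow> {f \<in> S - exposed H. f \<subseteq> nbrs (present H) v})"

type_synonym box = "nat + nat"

text \<open>The threshold \<open>\<theta>\<close> is the number of aimed steals that makes a vertex dangerous; it will be a small
  multiple of \<open>p\<^sup>2 n\<^sup>2\<close>. The box \<open>Inl x\<close> stands for the pairs at \<open>x\<close>, and the box \<open>Inr v\<close> for
  the pairs inside the known part of the neighbourhood of \<open>v\<close>, which grows during the play.\<close>

locale strategy =
  fixes n b :: nat and \<theta> :: real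
begin

abbreviation K :: "edge set" where "K \<equiv> complete_edges n"

definition dangerous :: "event list \<Rightarrow> nat set" where
  "dangerous H = {v. v < n \<and> \<theta> \<le> real (card (stolen_in v H))}"

text \<open>Among the dangerous neighbourhoods that contain a pair only the first one is charged, so that a
  claim of Breaker never charges more than one of them.\<close>

definition assigned :: "nat \<Rightarrow> event list \<Rightarrow> edge \<Rightarrow> bool" where
  "assigned v H f \<longleftrightarrow> v \<in> dangerous H \<and> f \<subseteq> nbrs (present H) v \<and>
     (\<forall>u\<in>dangerous H. u < v \<longrightarrow> \<not> f \<subseteq> nbrs (present H) u)"

definition boxes :: "box set" where
  "boxes = Inl ` {..<n} \<union> Inr ` {..<n}"

primrec box :: "box \<Rightarrow> event list \<Rightarrow> edge set" where
  "box (Inl x) H = star n x"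
| "box (Inr v) H = {e \<in> K. e \<subseteq> nbrs (present H) v}"

definition active :: "box \<Rightarrow> event list \<Rightarrow> bool" where
  "active i H \<longleftrightarrow> \<not> box i H \<subseteq> exposed H"

primrec charged :: "box \<Rightarrow> event list \<Rightarrow> edge set \<Rightarrow> edge set" where
  "charged (Inl x) H S = {f \<in> S - exposed H. x \<in> f}"
| "charged (Inr v) H S = {f \<in> S - exposed H. assigned v H f}"

definition attack :: "box \<Rightarrow> event list \<Rightarrow> real" where
  "attack i = psum (\<lambda>H z. case z of Coin e x \<Rightarrow> 0 | Round e S \<Rightarrow> real (card (charged i H S)))"

text \<open>Two events relieve a box: Maker finds an edge to claim in it, or its last unexposed pair is flipped.
  The latter happens at most once for a star; the box \<open>Inr v\<close> is refilled whenever \<open>v\<close> gains a neighbour, so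
  there it happens at most as often as the degree of \<open>v\<close>.\<close>

definition wins :: "box \<Rightarrow> event list \<Rightarrow> real" where
  "wins i = psum (\<lambda>H z. case z of Coin e x \<Rightarrow> of_bool (x \<and> e \<notin> claimed H \<and> e \<in> box i H) | Round e S \<Rightarrow> 0)"

definition exhausts :: "box \<Rightarrow> event list \<Rightarrow> real" where
  "exhausts i = psum (\<lambda>H z. of_bool (active i H \<and> \<not> active i (H @ [z])))"

text \<open>The factor \<open>6 * b\<close> is twice the total charge \<open>3 * b\<close> of a round; this is what makes the potential
  argument work.\<close>

definition debt :: "box \<Rightarrow> event list \<Rightarrow> real" where
  "debt i H = attack i H - 6 * real b * (wins i H + exhausts i H)"

definition best :: "event list \<Rightarrow> box" where
  "best H = (SOME i. i \<in> boxes \<and> active i H \<and> (\<forall>j\<in>boxes. active j H \<longrightarrow> debt j H \<le> debt i H))"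

definition pending :: "event list \<Rightarrow> edge set" where
  "pending H = K \<inter> present H - claimed H"

definition act :: "event list \<Rightarrow> action" where
  "act H = (if pending H \<noteq> {} then Claim (SOME e. e \<in> pending H)
     else if K \<subseteq> exposed H then Claim (SOME e. e \<in> K - claimed H)
     else Flip (SOME e. e \<in> box (best H) H - exposed H))"

text \<open>The play is continued beyond the end of the game until all coins have been flipped, so that a
  complete history determines \<open>\<Gamma>\<close>.\<close>

definition over :: "event list \<Rightarrow> bool" where
  "over H \<longleftrightarrow> K \<subseteq> claimed H \<and> K \<subseteq> exposed H"

lemma box_subset: "box i H \<subseteq> K"
  by (cases i) (auto simp: star_def)

lemma finite_boxes: "finite boxes"
  by (simp add: boxes_def)

lemma card_boxes: "card boxes = 2 * n"
  unfolding boxes_def by (subst card_Un_disjoint) (auto simp: card_image)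

lemma best:
  assumes "\<not> K \<subseteq> exposed H"
  shows "best H \<in> boxes" "active (best H) H" "\<And>j. j \<in> boxes \<Longrightarrow> active j H \<Longrightarrow> debt j H \<le> debt (best H) H"
proof -
  let ?A = "{i \<in> boxes. active i H}"
  obtain e where e: "e \<in> K" "e \<notin> exposed H" using assms by auto
  then have "card e = 2" "e \<subseteq> {..<n}" by (auto simp: complete_edges_def)
  then obtain x where x: "x \<in> e" "x < n" by (auto simp: card_2_iff)
  have "Inl x \<in> ?A" using e x by (auto simp: boxes_def active_def star_def)
  then have ne: "?A \<noteq> {}" by blast
  have fin: "finite ?A" using finite_boxes by simp
  have "Max ((\<lambda>i. debt i H) ` ?A) \<in> (\<lambda>i. debt i H) ` ?A" using ne fin by (intro Max_in) auto
  then obtain i where "i \<in> ?A" "Max ((\<lambda>i. debt i H) ` ?A) = debt i H" by blast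
  then have i: "i \<in> ?A" "\<And>j. j \<in> ?A \<Longrightarrow> debt j H \<le> debt i H"
    using Max_ge[of "(\<lambda>i. debt i H) ` ?A"] fin by auto
  then have "\<exists>i. i \<in> boxes \<and> active i H \<and> (\<forall>j\<in>boxes. active j H \<longrightarrow> debt j H \<le> debt i H)" by blast
  from someI_ex[OF this] show "best H \<in> boxes" "active (best H) H"
    "\<And>j. j \<in> boxes \<Longrightarrow> active j H \<Longrightarrow> debt j H \<le> debt (best H) H"
    unfolding best_def by blast+
qed

lemma act_cases:
  assumes "\<not> over H"
  obtains (claim_pending) e where "act H = Claim e" "e \<in> pending H"
  | (claim_any) e where "act H = Claim e" "pending H = {}" "K \<subseteq> exposed H" "e \<in> K - claimed H"
  | (flip) e where "act H = Flip e" "pending H = {}" "\<not> K \<subseteq> exposed H" "e \<in> box (best H) H - exposed H"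
proof (cases "pending H = {}")
  case False
  then have "(SOME e. e \<in> pending H) \<in> pending H" by (simp add: some_in_eq)
  then show ?thesis using False claim_pending by (simp add: act_def)
next
  case True
  show ?thesis
  proof (cases "K \<subseteq> exposed H")
    case Tr: True
    then have "K - claimed H \<noteq> {}" using assms by (auto simp: over_def)
    then have "(SOME e. e \<in> K - claimed H) \<in> K - claimed H" by (metis some_in_eq)
    then show ?thesis using True Tr claim_any by (simp add: act_def)
  next
    case False
    then have "box (best H) H - exposed H \<noteq> {}" using best(2) by (auto simp: active_def)
    then have "(SOME e. e \<in> box (best H) H - exposed H) \<in> box (best H) H - exposed H" by (metis some_in_eq)
    then show ?thesis using True False flip by (simp add: act_def)
  qed
qed

lemma act_Flip: "\<not> over H \<Longrightarrow> act H = Flip e \<Longrightarrow> e \<in> K - exposed H"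
  by (erule act_cases) (use box_subset in auto)

lemma act_Claim: "\<not> over H \<Longrightarrow> act H = Claim e \<Longrightarrow> e \<in> K - claimed H"
  by (erule act_cases) (auto simp: pending_def)

lemma legal_maker: "legal_maker n (\<lambda>H. return_pmf (act H))"
  unfolding legal_maker_def
proof (intro allI impI)
  fix H assume "\<not> K \<subseteq> claimed H"
  then have "\<not> over H" by (simp add: over_def)
  then show "set_pmf (return_pmf (act H)) \<subseteq> Claim ` (K - claimed H) \<union> Flip ` (K - exposed H)"
    using act_Flip act_Claim by (cases "act H") auto
qed

end

section \<open>The game as a function of the random graph\<close>

locale play = strategy n b \<theta> for n b :: nat and \<theta> :: real +
  fixes \<tau> :: breaker_strategy
  assumes legal: "legal_breaker n b \<tau>"
begin

definition reply :: "event list \<Rightarrow> edge \<Rightarrow> edge set" where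
  "reply H e = \<tau> (filter is_Round H) e"

text \<open>Reading the coins off a graph \<open>\<Gamma>\<close> that was drawn in advance turns the play into a
  deterministic process.\<close>

definition advance :: "edge set \<Rightarrow> event list \<Rightarrow> event list" where
  "advance \<Gamma> H = (if over H then H else case act H of
     Flip e \<Rightarrow> H @ [Coin e (e \<in> \<Gamma>)] | Claim e \<Rightarrow> H @ [Round e (reply H e)])"

definition history :: "edge set \<Rightarrow> nat \<Rightarrow> event list" where
  "history \<Gamma> k = (advance \<Gamma> ^^ k) []"

definition game_advance :: "edge set \<Rightarrow> event list \<Rightarrow> event list" where
  "game_advance \<Gamma> H = (if K \<subseteq> claimed H then H else advance \<Gamma> H)"

definition game_history :: "edge set \<Rightarrow> nat \<Rightarrow> event list" where
  "game_history \<Gamma> k = (game_advance \<Gamma> ^^ k) []"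

lemma reply: "reply H e \<subseteq> K - insert e (claimed H)" "card (reply H e) \<le> b" "finite (reply H e)"
proof -
  show 1: "reply H e \<subseteq> K - insert e (claimed H)" "card (reply H e) \<le> b"
    using legal[unfolded legal_breaker_def, rule_format, of "filter is_Round H" e]
    by (simp_all add: reply_def claimed_filter)
  show "finite (reply H e)" by (rule finite_subset[OF 1(1)]) (simp add: finite_complete_edges)
qed

lemma history_Suc: "history \<Gamma> (Suc k) = advance \<Gamma> (history \<Gamma> k)"
  by (simp add: history_def)

lemma game_history_Suc: "game_history \<Gamma> (Suc k) = game_advance \<Gamma> (game_history \<Gamma> k)"
  by (simp add: game_history_def)

text \<open>Principle of deferred decisions: it makes no difference whether the unexposed coins are flipped
  before or after the next step.\<close>

lemma step_coupling:
  "bind_pmf (step n p (\<lambda>H. return_pmf (act H)) \<tau> H)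
     (\<lambda>H'. map_pmf (\<lambda>R. (H', present H' \<union> R)) (random_subset (K - exposed H') p))
   = map_pmf (\<lambda>R. (game_advance (present H \<union> R) H, present H \<union> R)) (random_subset (K - exposed H) p)"
proof (cases "K \<subseteq> claimed H")
  case True
  then show ?thesis by (simp add: step_def game_advance_def bind_return_pmf)
next
  case False
  then have no: "\<not> over H" by (simp add: over_def)
  show ?thesis
  proof (cases "act H")
    case (Claim e)
    then show ?thesis using False no
      by (simp add: step_def game_advance_def advance_def bind_return_pmf reply_def)
  next
    case (Flip e)
    then have e: "e \<in> K" "e \<notin> exposed H" using act_Flip[OF no] by auto
    let ?A = "K - insert e (exposed H)"
    have ins: "K - exposed H = insert e ?A" using e by auto
    have np: "e \<notin> present H" using e present_subset_exposed by blast
    have fin: "finite ?A" by (simp add: finite_complete_edges)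
    have "map_pmf (\<lambda>R. (game_advance (present H \<union> R) H, present H \<union> R)) (random_subset (K - exposed H) p) =
       bind_pmf (bernoulli_pmf p) (\<lambda>x. map_pmf (\<lambda>R. (game_advance (present H \<union> (if x then insert e R else R)) H,
         present H \<union> (if x then insert e R else R))) (random_subset ?A p))"
      unfolding ins by (subst random_subset_insert[OF fin]) (auto simp: map_bind_pmf pmf.map_comp o_def)
    also have "\<dots> = bind_pmf (bernoulli_pmf p) (\<lambda>x. map_pmf (\<lambda>R. (H @ [Coin e x],
         present (H @ [Coin e x]) \<union> R)) (random_subset ?A p))"
    proof (intro bind_pmf_cong map_pmf_cong refl)
      fix x R assume "R \<in> set_pmf (random_subset ?A p)"
      then have "e \<notin> R" using set_random_subset[OF fin] by blast
      then show "(game_advance (present H \<union> (if x then insert e R else R)) H,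
         present H \<union> (if x then insert e R else R)) = (H @ [Coin e x], present (H @ [Coin e x]) \<union> R)"
        using np False no Flip by (auto simp: game_advance_def advance_def)
    qed
    also have "\<dots> = bind_pmf (step n p (\<lambda>H. return_pmf (act H)) \<tau> H)
     (\<lambda>H'. map_pmf (\<lambda>R. (H', present H' \<union> R)) (random_subset (K - exposed H') p))"
      using False Flip by (simp add: step_def bind_return_pmf bind_map_pmf)
    finally show ?thesis by simp
  qed
qed

lemma run_coupling:
  "bind_pmf (run n p (\<lambda>H. return_pmf (act H)) \<tau> k)
     (\<lambda>H. map_pmf (\<lambda>R. (H, present H \<union> R)) (random_subset (K - exposed H) p))
   = map_pmf (\<lambda>\<Gamma>. (game_history \<Gamma> k, \<Gamma>)) (gnp n p)"
proof (induction k)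
  case 0
  show ?case by (simp add: bind_return_pmf game_history_def gnp_def)
next
  case (Suc k)
  let ?\<sigma> = "\<lambda>H. return_pmf (act H)"
  have "bind_pmf (run n p ?\<sigma> \<tau> (Suc k))
      (\<lambda>H. map_pmf (\<lambda>R. (H, present H \<union> R)) (random_subset (K - exposed H) p))
    = bind_pmf (run n p ?\<sigma> \<tau> k) (\<lambda>H. map_pmf (\<lambda>R. (game_advance (present H \<union> R) H, present H \<union> R))
        (random_subset (K - exposed H) p))"
    by (simp add: bind_assoc_pmf step_coupling)
  also have "\<dots> = map_pmf (\<lambda>(H, \<Gamma>). (game_advance \<Gamma> H, \<Gamma>)) (bind_pmf (run n p ?\<sigma> \<tau> k)
     (\<lambda>H. map_pmf (\<lambda>R. (H, present H \<union> R)) (random_subset (K - exposed H) p)))"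
    by (simp add: map_bind_pmf pmf.map_comp o_def)
  also have "\<dots> = map_pmf (\<lambda>\<Gamma>. (game_history \<Gamma> (Suc k), \<Gamma>)) (gnp n p)"
    unfolding Suc.IH by (simp add: pmf.map_comp o_def game_history_Suc)
  finally show ?case .
qed

definition duration :: nat where "duration = 2 * card K"

lemma measure_decreases:
  assumes "\<not> over H"
  shows "card (K - claimed (advance \<Gamma> H)) + card (K - exposed (advance \<Gamma> H)) < card (K - claimed H) + card (K - exposed H)"
proof (cases "act H")
  case (Flip e)
  then have "K - exposed (advance \<Gamma> H) \<subset> K - exposed H" "K - claimed (advance \<Gamma> H) = K - claimed H"
    using act_Flip[OF assms] assms by (auto simp: advance_def)
  then show ?thesis by (simp add: psubset_card_mono finite_complete_edges)
next
  case (Claim e)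
  then have "K - claimed (advance \<Gamma> H) \<subset> K - claimed H" "K - exposed (advance \<Gamma> H) = K - exposed H"
    using act_Claim[OF assms] assms by (auto simp: advance_def)
  then show ?thesis by (simp add: psubset_card_mono finite_complete_edges)
qed

lemma over_history: "over (history \<Gamma> duration)"
proof -
  have "over (history \<Gamma> k) \<or>
      card (K - claimed (history \<Gamma> k)) + card (K - exposed (history \<Gamma> k)) + k \<le> 2 * card K" for k
  proof (induction k)
    case (Suc k)
    show ?case
    proof (cases "over (history \<Gamma> k)")
      case True
      then show ?thesis by (simp add: history_Suc advance_def)
    next
      case False
      then show ?thesis using Suc measure_decreases[OF False, of \<Gamma>] by (simp add: history_Suc)
    qed
  qed (simp add: history_def)
  from this[of duration] show ?thesis
    by (auto simp: duration_def over_def finite_complete_edges)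
qed

lemma maker_edges_after:
  assumes "K \<subseteq> claimed (history \<Gamma> j)"
  shows "K \<subseteq> claimed (history \<Gamma> (j + i)) \<and> maker_edges (history \<Gamma> (j + i)) = maker_edges (history \<Gamma> j)"
proof (induction i)
  case (Suc i)
  let ?H = "history \<Gamma> (j + i)"
  have "maker_edges (advance \<Gamma> ?H) = maker_edges ?H \<and> claimed (advance \<Gamma> ?H) = claimed ?H"
  proof (cases "over ?H")
    case False
    then show ?thesis using Suc by (cases rule: act_cases) (auto simp: advance_def pending_def)
  qed (simp add: advance_def)
  then show ?case using Suc by (simp add: history_Suc)
qed (use assms in simp)

lemma maker_edges_game_history:
  "maker_edges (game_history \<Gamma> duration) = maker_edges (history \<Gamma> duration)"
proof -
  have "\<exists>j\<le>k. game_history \<Gamma> k = history \<Gamma> j \<and> (j = k \<or> K \<subseteq> claimed (history \<Gamma> j))" for k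
  proof (induction k)
    case 0
    then show ?case by (simp add: game_history_def history_def)
  next
    case (Suc k)
    then obtain j where j: "j \<le> k" "game_history \<Gamma> k = history \<Gamma> j" "j = k \<or> K \<subseteq> claimed (history \<Gamma> j)"
      by blast
    show ?case
    proof (cases "K \<subseteq> claimed (history \<Gamma> j)")
      case True
      then show ?thesis using j by (intro exI[of _ j]) (auto simp: game_history_Suc game_advance_def)
    next
      case False
      then show ?thesis using j
        by (intro exI[of _ "Suc k"]) (auto simp: game_history_Suc game_advance_def history_Suc)
    qed
  qed
  then obtain j where j: "j \<le> duration" "game_history \<Gamma> duration = history \<Gamma> j"
    "j = duration \<or> K \<subseteq> claimed (history \<Gamma> j)" by blast
  then show ?thesis using maker_edges_after[of \<Gamma> j "duration - j"] by auto
qed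

lemma game_coupling:
  "game n p (\<lambda>H. return_pmf (act H)) \<tau> = map_pmf (\<lambda>\<Gamma>. (maker_edges (history \<Gamma> duration), \<Gamma>)) (gnp n p)"
proof -
  have "game n p (\<lambda>H. return_pmf (act H)) \<tau> = map_pmf (\<lambda>(H, \<Gamma>). (maker_edges H, \<Gamma>))
    (bind_pmf (run n p (\<lambda>H. return_pmf (act H)) \<tau> duration)
      (\<lambda>H. map_pmf (\<lambda>R. (H, present H \<union> R)) (random_subset (K - exposed H) p)))"
    by (simp add: game_def duration_def map_bind_pmf pmf.map_comp o_def)
  then show ?thesis
    by (simp add: run_coupling pmf.map_comp o_def maker_edges_game_history)
qed

section \<open>Concentration for coins flipped in an adaptive order\<close>

text \<open>Given the history, the unexposed coins are still independent, whatever strategy decides which of them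
  is flipped next. Hence a function of the history that does not grow on average in one step does not grow
  on average over the whole play.\<close>

lemma supermartingale:
  assumes p: "0 \<le> p" "p \<le> 1"
    and flip: "\<And>H e. p * V (H @ [Coin e True]) + (1 - p) * V (H @ [Coin e False]) \<le> V H"
    and round: "\<And>H e S. V (H @ [Round e S]) \<le> V H"
  shows "expect p (K - exposed H) (\<lambda>R. V ((advance (present H \<union> R) ^^ k) H)) \<le> V H"
proof (induction k arbitrary: H)
  case 0
  then show ?case by (simp add: expect_const)
next
  case (Suc k)
  have fin: "finite (K - A)" for A by (simp add: finite_complete_edges)
  show ?case
  proof (cases "over H")
    case True
    then have "(advance \<Gamma> ^^ Suc k) H = (advance \<Gamma> ^^ k) H" for \<Gamma>
      by (simp add: funpow_Suc_right advance_def del: funpow.simps)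
    then show ?thesis using Suc.IH by (simp del: funpow.simps)
  next
    case False
    show ?thesis
    proof (cases "act H")
      case (Claim e)
      let ?H = "H @ [Round e (reply H e)]"
      have "(advance \<Gamma> ^^ Suc k) H = (advance \<Gamma> ^^ k) ?H" for \<Gamma>
        using False Claim by (simp add: funpow_Suc_right advance_def del: funpow.simps)
      then show ?thesis using Suc.IH[of ?H] round[of H e "reply H e"] by (simp del: funpow.simps)
    next
      case (Flip e)
      then have e: "e \<in> K" "e \<notin> exposed H" using act_Flip[OF False] by auto
      let ?A = "K - insert e (exposed H)"
      have ins: "K - exposed H = insert e ?A" using e by auto
      have np: "e \<notin> present H" using e present_subset_exposed by blast
      have "(advance \<Gamma> ^^ Suc k) H = (advance \<Gamma> ^^ k) (H @ [Coin e (e \<in> \<Gamma>)])" for \<Gamma>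
        using False Flip by (simp add: funpow_Suc_right advance_def del: funpow.simps)
      then have "expect p (K - exposed H) (\<lambda>R. V ((advance (present H \<union> R) ^^ Suc k) H))
          = p * expect p ?A (\<lambda>R. V ((advance (present H \<union> insert e R) ^^ k) (H @ [Coin e True])))
          + (1 - p) * expect p ?A (\<lambda>R. V ((advance (present H \<union> R) ^^ k) (H @ [Coin e (e \<in> present H \<union> R)])))"
        unfolding ins using p by (subst expect_insert) (auto simp: fin)
      also have "expect p ?A (\<lambda>R. V ((advance (present H \<union> R) ^^ k) (H @ [Coin e (e \<in> present H \<union> R)])))
          = expect p ?A (\<lambda>R. V ((advance (present H \<union> R) ^^ k) (H @ [Coin e False])))"
      proof (intro expect_cong fin)
        fix R assume "R \<subseteq> ?A"
        then have "e \<notin> present H \<union> R" using np by blast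
        then show "V ((advance (present H \<union> R) ^^ k) (H @ [Coin e (e \<in> present H \<union> R)]))
          = V ((advance (present H \<union> R) ^^ k) (H @ [Coin e False]))" by simp
      qed
      also have "p * expect p ?A (\<lambda>R. V ((advance (present H \<union> insert e R) ^^ k) (H @ [Coin e True])))
          + (1 - p) * \<dots> \<le> p * V (H @ [Coin e True]) + (1 - p) * V (H @ [Coin e False])"
        using Suc.IH[of "H @ [Coin e True]"] Suc.IH[of "H @ [Coin e False]"] p
        by (intro add_mono mult_left_mono) auto
      also have "\<dots> \<le> V H" by (rule flip)
      finally show ?thesis .
    qed
  qed
qed

text \<open>The supermartingale is \<open>exp ((hit_sum - 2 * p * flip_sum) / L)\<close>: a flip of weight \<open>w = u * L\<close> with
  \<open>0 \<le> u \<le> 1\<close> multiplies the first exponential by \<open>1 + p * (exp u - 1) \<le> exp (2 * p * u)\<close> on average, and the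
  second one compensates for this.\<close>

lemma adaptive_tail:
  assumes p: "0 \<le> p" "p \<le> 1" and L: "0 < L"
    and w: "\<And>H e. 0 \<le> w H e" "\<And>H e. w H e \<le> L"
  shows "measure_pmf.prob (gnp n p)
     {\<Gamma>. hit_sum w (history \<Gamma> k) > 2 * p * flip_sum w (history \<Gamma> k) + t * L} \<le> exp (- t)"
proof -
  define V where "V = (\<lambda>H. exp ((hit_sum w H - 2 * p * flip_sum w H) / L))"
  have "measure_pmf.prob (gnp n p)
     {\<Gamma>. hit_sum w (history \<Gamma> k) > 2 * p * flip_sum w (history \<Gamma> k) + t * L}
     \<le> expect p K (\<lambda>\<Gamma>. V (history \<Gamma> k)) / exp t"
    unfolding gnp_def
  proof (intro expect_markov)
    fix \<Gamma> assume "hit_sum w (history \<Gamma> k) > 2 * p * flip_sum w (history \<Gamma> k) + t * L"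
    then have "t \<le> (hit_sum w (history \<Gamma> k) - 2 * p * flip_sum w (history \<Gamma> k)) / L"
      using L by (simp add: field_simps)
    then show "exp t \<le> V (history \<Gamma> k)" by (simp add: V_def)
  qed (simp_all add: finite_complete_edges V_def)
  also have "expect p K (\<lambda>\<Gamma>. V (history \<Gamma> k)) \<le> 1"
  proof -
    have "expect p (K - exposed []) (\<lambda>R. V ((advance (present [] \<union> R) ^^ k) [])) \<le> V []"
    proof (rule supermartingale[OF p])
      fix H e
      define u where "u = w H e / L"
      have u: "0 \<le> u" "u \<le> 1" using w[of H e] L by (simp_all add: u_def)
      have True': "V (H @ [Coin e True]) = V H * exp (u - 2 * p * u)"
        using L by (simp add: V_def u_def diff_divide_distrib add_divide_distrib algebra_simps flip: exp_add)
      have False': "V (H @ [Coin e False]) = V H * exp (- 2 * p * u)"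
        using L by (simp add: V_def u_def diff_divide_distrib add_divide_distrib algebra_simps flip: exp_add)
      have "p * exp u + (1 - p) \<le> p * (1 + 2 * u) + (1 - p)"
        using exp_le_one_plus_double[OF u] p by (intro add_mono mult_left_mono) auto
      also have "\<dots> \<le> exp (2 * p * u)" using exp_ge_add_one_self[of "2 * p * u"] by (simp add: algebra_simps)
      finally have "exp (- 2 * p * u) * (p * exp u + (1 - p)) \<le> exp (- 2 * p * u) * exp (2 * p * u)"
        by (rule mult_left_mono) simp
      also have "\<dots> = 1" by (simp flip: exp_add)
      finally have "V H * (exp (- 2 * p * u) * (p * exp u + (1 - p))) \<le> V H * 1"
        by (intro mult_left_mono) (auto simp: V_def)
      then show "p * V (H @ [Coin e True]) + (1 - p) * V (H @ [Coin e False]) \<le> V H"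
        unfolding True' False' exp_diff by (simp add: algebra_simps exp_minus divide_inverse)
    qed (simp add: V_def)
    then show ?thesis by (simp add: V_def history_def)
  qed
  then have "expect p K (\<lambda>\<Gamma>. V (history \<Gamma> k)) / exp t \<le> 1 / exp t" by (intro divide_right_mono) auto
  finally show ?thesis by (simp add: exp_minus divide_inverse)
qed

end

section \<open>Wedges and multiplicities\<close>

lemma nbrs_mono: "G \<subseteq> G' \<Longrightarrow> nbrs G v \<subseteq> nbrs G' v"
  by (auto simp: nbrs_def)

lemma nbrs_insert_other: "v \<notin> e \<Longrightarrow> nbrs (insert e G) v = nbrs G v"
  by (auto simp: nbrs_def)

lemma nbrs_insert_edge: "y \<noteq> v \<Longrightarrow> nbrs (insert {v, y} G) v = insert y (nbrs G v)"
  by (auto simp: nbrs_def doubleton_eq_iff)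

lemma not_in_own_nbrs: "f \<subseteq> nbrs G v \<Longrightarrow> v \<notin> f"
  by (auto simp: nbrs_def)

lemma present_append: "present H \<subseteq> present (H @ H')"
  by (auto simp: present_def)

lemma gather_append: "gather g H \<subseteq> gather g (H @ H')"
proof (induction H' rule: rev_induct)
  case (snoc z H')
  then show ?case by (simp only: append_assoc[symmetric] gather_snoc) blast
qed simp

lemma stolen_simps [simp]:
  "stolen [] = {}" "stolen (H @ [Coin e x]) = stolen H" "stolen (H @ [Round e S]) = stolen H \<union> (S - exposed H)"
  by (simp_all add: stolen_def)

lemma stolen_in_simps [simp]:
  "stolen_in v [] = {}" "stolen_in v (H @ [Coin e x]) = stolen_in v H"
  "stolen_in v (H @ [Round e S]) = stolen_in v H \<union> {f \<in> S - exposed H. f \<subseteq> nbrs (present H) v}"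
  by (simp_all add: stolen_in_def)

lemma stolen_append: "stolen H \<subseteq> stolen (H @ H')"
  by (simp add: stolen_def gather_append)

text \<open>The pairs \<open>xy\<close> of \<open>Q\<close> with \<open>x \<in> N\<close> for which \<open>e = vy\<close> is the missing second edge to \<open>v\<close>: if \<open>N\<close> is the
  known neighbourhood of \<open>v\<close>, they are the pairs that a success of \<open>e\<close> would bring into that neighbourhood.\<close>

definition wedges :: "nat \<Rightarrow> edge set \<Rightarrow> nat set \<Rightarrow> edge \<Rightarrow> edge set" where
  "wedges v Q N e = {f \<in> Q. \<exists>x y. x \<noteq> y \<and> e = {v, y} \<and> f = {x, y} \<and> x \<in> N}"

lemma card_wedges_le:
  assumes "finite N"
  shows "card (wedges v Q N e) \<le> card N"
proof (cases "\<exists>y. e = {v, y}")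
  case True
  then obtain y where y: "e = {v, y}" by blast
  then have "wedges v Q N e \<subseteq> (\<lambda>x. {x, y}) ` N" by (auto simp: wedges_def doubleton_eq_iff)
  then show ?thesis using assms by (meson card_image_le card_mono finite_imageI le_trans)
next
  case False
  then have "wedges v Q N e = {}" by (auto simp: wedges_def)
  then show ?thesis by simp
qed

lemma wedges_mono: "Q \<subseteq> Q' \<Longrightarrow> N \<subseteq> N' \<Longrightarrow> wedges v Q N e \<subseteq> wedges v Q' N' e"
  by (auto simp: wedges_def)

lemma finite_wedges: "finite Q \<Longrightarrow> finite (wedges v Q N e)"
  by (simp add: wedges_def)

text \<open>A wedge is determined by its end \<open>x \<in> N\<close> and the pair \<open>f\<close>, as \<open>e = insert v (f - {x})\<close>.\<close>

lemma sum_wedges_le: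
  assumes "finite E" "finite Q" "finite N"
  shows "(\<Sum>e\<in>E. card (wedges v Q N e)) \<le> (\<Sum>x\<in>N. card {f \<in> Q. x \<in> f})"
proof -
  have "(\<Sum>e\<in>E. card (wedges v Q N e)) = card (SIGMA e:E. wedges v Q N e)"
    using assms by (simp add: card_SigmaI finite_wedges)
  also have "\<dots> \<le> card ((\<lambda>(x, f). (insert v (f - {x}), f)) ` (SIGMA x:N. {f \<in> Q. x \<in> f}))"
  proof (intro card_mono subsetI)
    fix z assume "z \<in> (SIGMA e:E. wedges v Q N e)"
    then obtain x y where z: "z = ({v, y}, {x, y})" "{x, y} \<in> Q" "x \<in> N" "x \<noteq> y"
      by (auto simp: wedges_def)
    then show "z \<in> (\<lambda>(x, f). (insert v (f - {x}), f)) ` (SIGMA x:N. {f \<in> Q. x \<in> f})"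
      by (intro image_eqI[of _ _ "(x, {x, y})"]) auto
  qed (use assms in auto)
  also have "\<dots> \<le> card (SIGMA x:N. {f \<in> Q. x \<in> f})"
    using assms by (intro card_image_le) auto
  also have "\<dots> = (\<Sum>x\<in>N. card {f \<in> Q. x \<in> f})"
    using assms by (simp add: card_SigmaI)
  finally show ?thesis .
qed

text \<open>Cauchy-Schwarz for the number of sets \<open>A v\<close> that contain a given element of \<open>F\<close>.\<close>

lemma sum_card_square:
  assumes "finite F" "finite D" "\<And>v. v \<in> D \<Longrightarrow> A v \<subseteq> F"
  shows "(\<Sum>v\<in>D. real (card (A v)))\<^sup>2 \<le> real (card F) * (\<Sum>v\<in>D. \<Sum>u\<in>D. real (card (A v \<inter> A u)))"
proof -
  define m where "m = (\<lambda>f. \<Sum>v\<in>D. of_bool (f \<in> A v) :: real)"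
  have c: "real (card B) = (\<Sum>f\<in>F. of_bool (f \<in> B))" if "B \<subseteq> F" for B
    using assms(1) that by (simp add: of_bool_def sum.inter_restrict[symmetric] Int_absorb1)
  have "(\<Sum>v\<in>D. real (card (A v))) = (\<Sum>f\<in>F. 1 * m f)"
    using assms(3) by (simp add: c m_def sum.swap[of _ D])
  also have "(\<Sum>f\<in>F. 1 * m f)\<^sup>2 \<le> (\<Sum>f\<in>F. 1\<^sup>2) * (\<Sum>f\<in>F. (m f)\<^sup>2)"
    by (rule Cauchy_Schwarz_ineq_sum)
  also have "(\<Sum>f\<in>F. (m f)\<^sup>2) = (\<Sum>f\<in>F. \<Sum>v\<in>D. \<Sum>u\<in>D. of_bool (f \<in> A v \<inter> A u))"
    by (simp add: m_def power2_eq_square sum_product of_bool_conj)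
  also have "\<dots> = (\<Sum>v\<in>D. \<Sum>u\<in>D. \<Sum>f\<in>F. of_bool (f \<in> A v \<inter> A u))"
    by (simp only: sum.swap[of _ D F])
  also have "\<dots> = (\<Sum>v\<in>D. \<Sum>u\<in>D. real (card (A v \<inter> A u)))"
    by (intro sum.cong refl c[symmetric]) (use assms(3) in blast)
  finally show ?thesis by simp
qed

section \<open>Invariants of the play\<close>

context play
begin

inductive reachable :: "event list \<Rightarrow> bool" where
  Nil: "reachable []"
| Flip: "reachable H \<Longrightarrow> pending H = {} \<Longrightarrow> \<not> K \<subseteq> exposed H \<Longrightarrow> e \<in> box (best H) H \<Longrightarrow> e \<notin> exposed H \<Longrightarrow>
    reachable (H @ [Coin e x])"
| Round: "reachable H \<Longrightarrow> e \<in> K \<Longrightarrow> e \<notin> claimed H \<Longrightarrow> e \<in> pending H \<or> pending H = {} \<and> K \<subseteq> exposed H \<Longrightarrow>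
    S \<subseteq> K - insert e (claimed H) \<Longrightarrow> card S \<le> b \<Longrightarrow> reachable (H @ [Round e S])"

lemma reachable_history: "reachable (history \<Gamma> k)"
proof (induction k)
  case 0
  then show ?case by (simp add: history_def reachable.Nil)
next
  case (Suc k)
  let ?H = "history \<Gamma> k"
  show ?case
  proof (cases "over ?H")
    case True
    then show ?thesis using Suc by (simp add: history_Suc advance_def)
  next
    case False
    then show ?thesis
      using reply[of ?H] Suc
      by (cases rule: act_cases)
        (auto simp: history_Suc advance_def pending_def intro!: reachable.Flip reachable.Round)
  qed
qed

lemma flip_in_K: "e \<in> box i H \<Longrightarrow> e \<in> K"
  using box_subset by blast

lemma reachable_subset:
  assumes "reachable H"
  shows "exposed H \<subseteq> K" "claimed H \<subseteq> K" "present H \<subseteq> K" "stolen H \<subseteq> K" "stolen_in v H \<subseteq> stolen H"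
proof -
  show 1: "exposed H \<subseteq> K" using assms by induction (auto simp: flip_in_K)
  show "claimed H \<subseteq> K" using assms by induction auto
  show "present H \<subseteq> K" using 1 present_subset_exposed by blast
  show "stolen H \<subseteq> K" using assms by induction auto
  show "stolen_in v H \<subseteq> stolen H" using assms by induction auto
qed

lemma reachable_finite:
  assumes "reachable H"
  shows "finite (exposed H)" "finite (claimed H)" "finite (present H)" "finite (stolen H)"
    "finite (stolen_in v H)" "finite (nbrs (present H) v)" "nbrs (present H) v \<subseteq> {..<n} - {v}"
  using reachable_subset[OF assms] finite_complete_edges[of n] finite_nbrs nbrs_subset
  by (meson finite_subset)+

lemma history_present: "present (history \<Gamma> k) = exposed (history \<Gamma> k) \<inter> \<Gamma>"
proof (induction k)
  case (Suc k)
  show ?case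
  proof (cases "over (history \<Gamma> k)")
    case True
    then show ?thesis using Suc by (simp add: history_Suc advance_def)
  next
    case False
    then show ?thesis using Suc by (cases rule: act_cases) (auto simp: history_Suc advance_def)
  qed
qed (simp add: history_def)

lemma prefix_reachable:
  assumes "reachable (H @ H')"
  shows "reachable H"
  using assms
proof (induction H' rule: rev_induct)
  case (snoc z H')
  from snoc.prems have "reachable (H @ H')"
    by (cases rule: reachable.cases) (auto simp flip: append_assoc)
  then show ?case by (rule snoc.IH)
qed simp

text \<open>Maker claims only present edges until all coins are flipped, and claims a newly found edge before
  Breaker can. So a present edge can be missing from her graph only if it was stolen.\<close>

lemma bookkeeping:
  assumes "reachable H"
  shows "(\<forall>e e'. e \<in> pending H \<longrightarrow> e' \<in> pending H \<longrightarrow> e = e') \<and>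
    present H \<subseteq> maker_edges H \<union> stolen H \<union> pending H \<and>
    (maker_edges H \<subseteq> present H \<or> K \<subseteq> exposed H) \<and>
    breaker_edges H - exposed H \<subseteq> stolen H"
  using assms
proof induction
  case Nil
  then show ?case by (auto simp: pending_def)
next
  case (Flip H e x)
  have IH: "present H \<subseteq> maker_edges H \<union> stolen H" "maker_edges H \<subseteq> present H"
      "breaker_edges H - exposed H \<subseteq> stolen H"
    using Flip.IH Flip.hyps by simp_all
  have mp: "maker_edges H \<subseteq> exposed H" using IH(2) present_subset_exposed by (rule subset_trans)
  have eK: "e \<in> K" using Flip.hyps flip_in_K by simp
  have p0: "K \<inter> present H \<subseteq> claimed H" using Flip.hyps by (auto simp: pending_def)
  show ?case
  proof (cases "x \<and> e \<notin> claimed H")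
    case True
    then have p: "pending (H @ [Coin e x]) = {e}" using p0 eK by (auto simp: pending_def)
    show ?thesis unfolding p using IH True by auto
  next
    case False
    then have p: "pending (H @ [Coin e x]) = {}" using p0 eK by (auto simp: pending_def)
    have "e \<in> stolen H" if x
    proof -
      have "e \<in> breaker_edges H" using False that mp Flip.hyps(5) by (auto simp: claimed_def)
      then show ?thesis using IH(3) Flip.hyps(5) by blast
    qed
    then show ?thesis unfolding p using IH by auto
  qed
next
  case (Round H e S)
  have IH: "\<And>e e'. e \<in> pending H \<Longrightarrow> e' \<in> pending H \<Longrightarrow> e = e'"
      "present H \<subseteq> maker_edges H \<union> stolen H \<union> pending H"
      "maker_edges H \<subseteq> present H \<or> K \<subseteq> exposed H"
      "breaker_edges H - exposed H \<subseteq> stolen H"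
    using Round.IH by blast+
  have sub: "pending H \<subseteq> {e}" using IH(1) Round.hyps(4) by blast
  then have p: "pending (H @ [Round e S]) = {}" by (auto simp: pending_def)
  have "maker_edges (H @ [Round e S]) \<subseteq> present H \<or> K \<subseteq> exposed H"
    using IH(3) Round.hyps(4) by (auto simp: pending_def)
  then show ?case unfolding p using IH(2,4) sub by auto
qed

lemma pending_after_round:
  assumes "reachable (H @ [Round e S])"
  shows "pending (H @ [Round e S]) = {}"
  using assms
proof (cases rule: reachable.cases)
  case (Round H' e' S')
  then have H: "H' = H" "e' = e" "S' = S" by auto
  have "pending H \<subseteq> {e}" using Round bookkeeping[OF Round(2)] unfolding H by blast
  then show ?thesis by (auto simp: pending_def)
qed auto

lemma lost_stolen:
  assumes "reachable H" "over H" "e \<in> present H" "e \<notin> maker_edges H"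
  shows "e \<in> stolen H"
  using assms bookkeeping[OF assms(1)] by (auto simp: pending_def over_def)

text \<open>As long as unexposed pairs are left, each round in which Breaker may steal is one in which Maker
  has claimed an edge of \<open>\<Gamma>\<close>.\<close>

lemma card_stolen:
  assumes "reachable H"
  shows "card (stolen H) \<le> b * card (maker_edges H \<inter> present H)"
  using assms
proof induction
  case (Flip H e x)
  have "card (maker_edges H \<inter> present H) \<le> card (maker_edges H \<inter> present (H @ [Coin e x]))"
    using reachable_finite[OF Flip(1)] by (intro card_mono) auto
  then have "b * card (maker_edges H \<inter> present H) \<le> b * card (maker_edges H \<inter> present (H @ [Coin e x]))"
    by (rule mult_left_mono) simp
  then show ?case using Flip by (simp only: stolen_simps maker_edges_snoc)
next
  case (Round H e S)
  have fin: "finite (present H)" "finite S"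
    using Round reachable_finite finite_complete_edges finite_subset by (blast, metis finite_Diff)
  show ?case
  proof (cases "e \<in> pending H")
    case True
    then have e: "e \<in> present H" "e \<notin> maker_edges H" by (auto simp: pending_def claimed_def)
    then have "card (insert e (maker_edges H) \<inter> present H) = Suc (card (maker_edges H \<inter> present H))"
      using fin by simp
    moreover have "card (S - exposed H) \<le> b" using Round fin by (meson card_mono Diff_subset le_trans)
    moreover have "card (stolen H \<union> (S - exposed H)) \<le> card (stolen H) + card (S - exposed H)"
      by (rule card_Un_le)
    ultimately show ?thesis using Round by simp
  next
    case False
    then have e: "S - exposed H = {}" using Round by auto
    have "card (maker_edges H \<inter> present H) \<le> card (insert e (maker_edges H) \<inter> present H)"
      using fin by (intro card_mono) auto
    then have "b * card (maker_edges H \<inter> present H) \<le> b * card (insert e (maker_edges H) \<inter> present H)"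
      by (rule mult_left_mono) simp
    with Round.IH show ?thesis
      by (simp only: stolen_simps maker_edges_snoc present_snoc e Un_empty_right)
  qed
qed simp

text \<open>Every coin is flipped at most once.\<close>

lemma flip_sum_le:
  assumes "reachable H" "\<And>H1 e x H2. H = H1 @ Coin e x # H2 \<Longrightarrow> w H1 e \<le> W e"
  shows "flip_sum w H \<le> (\<Sum>e\<in>exposed H. W e)"
  using assms
proof induction
  case (Flip H e x)
  have "flip_sum w H \<le> (\<Sum>e\<in>exposed H. W e)"
    by (rule Flip.IH) (use Flip.prems in fastforce)
  moreover have "w H e \<le> W e" using Flip.prems by blast
  moreover have "(\<Sum>d\<in>exposed (H @ [Coin e x]). W d) = W e + (\<Sum>d\<in>exposed H. W d)"
    using Flip.hyps(5) reachable_finite(1)[OF Flip.hyps(1)] by simp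
  ultimately show ?case by (simp only: flip_sum_simps)
next
  case (Round H e S)
  have "flip_sum w H \<le> (\<Sum>e\<in>exposed H. W e)"
    by (rule Round.IH) (use Round.prems in fastforce)
  then show ?case by simp
qed simp

lemma hit_sum_cong:
  assumes "\<And>H1 e x H2. H = H1 @ Coin e x # H2 \<Longrightarrow> w H1 e = w' H1 e"
  shows "hit_sum w H = hit_sum w' H"
  using assms
proof (induction H rule: rev_induct)
  case (snoc z H)
  have "hit_sum w H = hit_sum w' H"
    by (rule snoc.IH) (use snoc.prems in fastforce)
  then show ?case using snoc.prems by (cases z) auto
qed simp

lemma box_mono: "box i H \<subseteq> box i (H @ H')"
  using nbrs_mono[OF present_append] by (cases i) fastforce+

lemma box_Round: "box i (H @ [Round e S]) = box i H"
  by (cases i) auto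

lemma active_Round: "active i (H @ [Round e S]) \<longleftrightarrow> active i H"
  by (simp only: active_def box_Round exposed_snoc)

lemma attack_simps [simp]:
  "attack i [] = 0" "attack i (H @ [Coin e x]) = attack i H"
  "attack i (H @ [Round e S]) = attack i H + real (card (charged i H S))"
  by (simp_all add: attack_def)

lemma wins_simps [simp]:
  "wins i [] = 0" "wins i (H @ [Coin e x]) = wins i H + of_bool (x \<and> e \<notin> claimed H \<and> e \<in> box i H)"
  "wins i (H @ [Round e S]) = wins i H"
  by (simp_all add: wins_def)

lemma exhausts_simps:
  "exhausts i [] = 0"
  "exhausts i (H @ [Coin e x]) = exhausts i H + of_bool (active i H \<and> \<not> active i (H @ [Coin e x]))"
  "exhausts i (H @ [Round e S]) = exhausts i H"
  by (simp_all add: exhausts_def active_Round)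

lemma wins_le:
  assumes "reachable H"
  shows "wins i H \<le> real (card (present H \<inter> box i H))"
  using assms
proof induction
  case (Flip H e x)
  let ?H = "H @ [Coin e x]"
  have fin: "finite (present ?H)" using reachable_finite(3)[OF Flip.hyps(1)] by simp
  have np: "e \<notin> present H" using Flip present_subset_exposed by blast
  show ?case
  proof (cases "x \<and> e \<notin> claimed H \<and> e \<in> box i H")
    case True
    then have "insert e (present H \<inter> box i H) \<subseteq> present ?H \<inter> box i ?H" using box_mono[of i H] by auto
    then have "card (insert e (present H \<inter> box i H)) \<le> card (present ?H \<inter> box i ?H)"
      using fin by (intro card_mono) auto
    then have "Suc (card (present H \<inter> box i H)) \<le> card (present ?H \<inter> box i ?H)"
      using np reachable_finite[OF Flip(1)] by simp
    then have "real (card (present H \<inter> box i H)) + 1 \<le> real (card (present ?H \<inter> box i ?H))"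
      by linarith
    then show ?thesis using Flip.IH True by simp
  next
    case False
    have "card (present H \<inter> box i H) \<le> card (present ?H \<inter> box i ?H)"
      using fin box_mono[of i H] by (intro card_mono) auto
    then show ?thesis using Flip.IH False by (simp only: wins_simps of_bool_eq)
  qed
next
  case (Round H e S)
  then show ?case by (simp add: box_Round del: box.simps)
qed simp

lemma exhausts_star:
  assumes "reachable H"
  shows "exhausts (Inl x) H + of_bool (active (Inl x) H) \<le> 1"
  using assms
proof induction
  case (Flip H e y)
  have "active (Inl x) (H @ [Coin e y]) \<longrightarrow> active (Inl x) H" by (auto simp: active_def)
  then show ?case using Flip.IH by (auto simp: exhausts_simps of_bool_def split: if_splits)
qed (simp_all add: exhausts_simps active_Round)

text \<open>After the box has been exhausted it can become active again only by a new neighbour of \<open>v\<close>.\<close>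

lemma exhausts_nbrs:
  assumes "reachable H"
  shows "exhausts (Inr v) H + of_bool (active (Inr v) H) \<le> real (card (nbrs (present H) v))"
  using assms
proof induction
  case Nil
  have "box (Inr v) [] = {}" by (auto simp: nbrs_def complete_edges_def)
  then show ?case by (simp add: exhausts_simps active_def del: box.simps)
next
  case (Flip H e x)
  let ?H = "H @ [Coin e x]"
  show ?case
  proof (cases "x \<and> v \<in> e")
    case True
    have eK: "e \<in> K" using Flip flip_in_K by blast
    with True obtain y where y: "e = {v, y}" "y \<noteq> v" using edge_at by (metis insert_commute)
    have "y \<notin> nbrs (present H) v"
      using y Flip present_subset_exposed by (auto simp: nbrs_def insert_commute)
    then have "card (nbrs (present ?H) v) = Suc (card (nbrs (present H) v))"
      using True y reachable_finite[OF Flip(1)] by (simp add: nbrs_insert_edge)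
    then show ?thesis using Flip by (auto simp: exhausts_simps of_bool_def simp del: present_snoc split: if_splits)
  next
    case False
    then have nb: "nbrs (present ?H) v = nbrs (present H) v" by (auto simp: nbrs_insert_other)
    then have "active (Inr v) ?H \<longrightarrow> active (Inr v) H" by (auto simp: active_def)
    then show ?thesis using Flip unfolding nb by (auto simp: exhausts_simps)
  qed
next
  case (Round H e S)
  then show ?case by (simp add: exhausts_simps active_Round)
qed

end

section \<open>Debts stay small\<close>

context play
begin

definition potential :: "event list \<Rightarrow> real" where
  "potential H = (\<Sum>i\<in>boxes. exp (debt i H / (6 * real b)))"

lemma debt_Flip:
  "debt i (H @ [Coin e x]) = debt i H - 6 * real b * (of_bool (x \<and> e \<notin> claimed H \<and> e \<in> box i H)
     + of_bool (active i H \<and> \<not> active i (H @ [Coin e x])))"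
  by (simp add: debt_def exhausts_simps algebra_simps)

lemma debt_Round: "debt i (H @ [Round e S]) = debt i H + real (card (charged i H S))"
  by (simp add: debt_def exhausts_simps)

lemma assigned_unique: "assigned u H f \<Longrightarrow> assigned v H f \<Longrightarrow> u = v"
  unfolding assigned_def by (metis linorder_neqE_nat)

lemma sum_charged:
  assumes "S \<subseteq> K"
  shows "(\<Sum>i\<in>boxes. card (charged i H S)) \<le> 3 * card S"
proof -
  let ?S = "S - exposed H"
  have fin: "finite S" using assms finite_complete_edges finite_subset by blast
  have c: "card {f \<in> ?S. P f} = (\<Sum>f\<in>?S. of_bool (P f))" for P
    using fin by (simp add: of_bool_def sum.If_cases Int_def)
  have "(\<Sum>x<n. card (charged (Inl x) H S)) = (\<Sum>x<n. \<Sum>f\<in>?S. of_bool (x \<in> f))"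
    unfolding charged.simps c ..
  also have "\<dots> = (\<Sum>f\<in>?S. \<Sum>x<n. of_bool (x \<in> f))" by (rule sum.swap)
  also have "\<dots> = (\<Sum>f\<in>?S. 2)"
  proof (rule sum.cong)
    fix f assume "f \<in> ?S"
    then have "f \<subseteq> {..<n}" "card f = 2" using assms by (auto simp: complete_edges_def)
    then show "(\<Sum>x<n. of_bool (x \<in> f)) = (2::nat)"
      by (simp add: of_bool_def sum.If_cases Int_absorb1)
  qed simp
  finally have 1: "(\<Sum>x<n. card (charged (Inl x) H S)) = 2 * card ?S" by simp
  have "(\<Sum>v<n. card (charged (Inr v) H S)) = (\<Sum>v<n. \<Sum>f\<in>?S. of_bool (assigned v H f))"
    unfolding charged.simps c ..
  also have "\<dots> = (\<Sum>f\<in>?S. \<Sum>v<n. of_bool (assigned v H f))" by (rule sum.swap)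
  also have "\<dots> \<le> (\<Sum>f\<in>?S. 1)"
  proof (rule sum_mono)
    fix f
    have "card {v \<in> {..<n}. assigned v H f} \<le> 1"
      using assigned_unique by (auto simp: card_le_Suc0_iff_eq)
    then show "(\<Sum>v<n. of_bool (assigned v H f)) \<le> (1::nat)"
      by (simp add: of_bool_def sum.If_cases Int_def)
  qed
  finally have 2: "(\<Sum>v<n. card (charged (Inr v) H S)) \<le> card ?S" by simp
  have "(\<Sum>i\<in>boxes. card (charged i H S)) = (\<Sum>x<n. card (charged (Inl x) H S)) + (\<Sum>v<n. card (charged (Inr v) H S))"
    unfolding boxes_def by (subst sum.union_disjoint) (auto simp: sum.reindex)
  moreover have "card ?S \<le> card S" using fin by (intro card_mono) auto
  ultimately show ?thesis using 1 2 by linarith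
qed

lemma charged_active:
  assumes "S \<subseteq> K" "charged i H S \<noteq> {}"
  shows "active i H"
proof -
  obtain f where f: "f \<in> charged i H S" using assms by blast
  then have "f \<in> K" "f \<notin> exposed H" "f \<in> box i H"
    using assms(1) by (cases i; auto simp: star_def assigned_def)+
  then show ?thesis by (auto simp: active_def)
qed

lemma exp_gap: "exp (y + c) - exp y \<le> c * exp (y + c)" for y c :: real
proof -
  have "1 - exp (- c) \<le> c" using exp_ge_add_one_self[of "- c"] by simp
  then have "exp (y + c) * (1 - exp (- c)) \<le> exp (y + c) * c" by (rule mult_left_mono) simp
  then show ?thesis by (simp add: algebra_simps flip: exp_add)
qed

lemma exp_minus_one_le: "exp (- 1) \<le> (1 / 2 :: real)"
  using exp_ge_add_one_self[of 1] by (simp add: exp_minus field_simps)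

text \<open>The invariant of the potential argument. Breaker's charges can raise the potential above \<open>2 * n\<close>, but
  only by half the contribution of some active box. Maker's next relief of a box
  takes back at least that much, since she always flips in an active box of greatest debt.\<close>

definition balanced :: "event list \<Rightarrow> bool" where
  "balanced H \<longleftrightarrow> potential H \<le> 2 * real n \<or>
     (pending H = {} \<and> (\<exists>i\<in>boxes. active i H \<and>
        potential H \<le> 2 * real n + exp (debt i H / (6 * real b)) / 2))"

text \<open>The box of greatest debt either loses \<open>6 * b\<close> of its debt, and then its contribution to the
  potential drops by a factor of at least two, or remains active with the same debt and takes over the
  role of the witness.\<close>

lemma balanced_Flip:
  assumes b: "0 < b" and bal: "balanced H"
    and H: "reachable H" "pending H = {}" "\<not> K \<subseteq> exposed H" "e \<in> box (best H) H" "e \<notin> exposed H"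
  shows "balanced (H @ [Coin e x])"
proof -
  let ?H = "H @ [Coin e x]"
  let ?j = "best H"
  let ?E = "\<lambda>i H. exp (debt i H / (6 * real b))"
  note j = best[OF H(3)]
  have le: "potential H \<le> 2 * real n + ?E ?j H / 2"
  proof (cases "potential H \<le> 2 * real n")
    case True
    then show ?thesis by (simp add: add_increasing2)
  next
    case False
    then obtain i where "i \<in> boxes" "active i H" "potential H \<le> 2 * real n + ?E i H / 2"
      using bal by (auto simp: balanced_def)
    moreover from this have "?E i H \<le> ?E ?j H" using j(3) b by (simp add: divide_right_mono)
    ultimately show ?thesis by linarith
  qed
  have mono: "?E i ?H \<le> ?E i H" for i
    using b by (simp add: debt_Flip divide_right_mono)
  have split: "potential H' = ?E ?j H' + (\<Sum>i\<in>boxes - {?j}. ?E i H')" for H'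
    unfolding potential_def using j(1) finite_boxes by (rule sum.remove[rotated])
  have rest: "(\<Sum>i\<in>boxes - {?j}. ?E i ?H) \<le> (\<Sum>i\<in>boxes - {?j}. ?E i H)"
    by (rule sum_mono) (rule mono)
  show ?thesis
  proof (cases "x \<and> e \<notin> claimed H \<or> \<not> active ?j ?H")
    case True
    then have "debt ?j ?H \<le> debt ?j H - 6 * real b"
      using H(4) j(2) by (auto simp: debt_Flip of_bool_def)
    then have "?E ?j ?H \<le> exp (debt ?j H / (6 * real b) + - 1)"
      using b by (simp add: field_simps)
    also have "\<dots> = ?E ?j H * exp (- 1)" by (simp only: exp_add)
    also have "\<dots> \<le> ?E ?j H * (1 / 2)" by (intro mult_left_mono exp_minus_one_le) simp
    finally have "potential ?H \<le> 2 * real n" using le rest split[of H] split[of ?H] by linarith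
    then show ?thesis by (simp add: balanced_def)
  next
    case False
    then have "debt ?j ?H = debt ?j H" by (auto simp: debt_Flip)
    then have "potential ?H \<le> 2 * real n + ?E ?j ?H / 2" using le rest split[of H] split[of ?H] by simp
    moreover have "pending ?H = {}" using False H(2) by (auto simp: pending_def)
    ultimately show ?thesis using False j(1) by (auto simp: balanced_def)
  qed
qed

text \<open>Only active boxes are charged, so each of them contributes at most as much as the active box of greatest
  debt after the round; the total charge \<open>3 * b\<close> then adds at most half of that contribution.\<close>

lemma balanced_Round:
  assumes b: "0 < b" and bal: "balanced H" and re: "reachable (H @ [Round e S])"
    and H: "e \<in> pending H \<or> pending H = {} \<and> K \<subseteq> exposed H" "S \<subseteq> K" "card S \<le> b"
  shows "balanced (H @ [Round e S])"
proof -
  let ?H = "H @ [Round e S]"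
  let ?E = "\<lambda>i H. exp (debt i H / (6 * real b))"
  let ?c = "\<lambda>i. real (card (charged i H S)) / (6 * real b)"
  have le: "potential H \<le> 2 * real n"
  proof (rule ccontr)
    assume "\<not> ?thesis"
    then obtain i where "pending H = {}" "active i H" using bal by (auto simp: balanced_def)
    then show False using H(1) box_subset[of i H] by (auto simp: active_def)
  qed
  have gap: "?E i ?H - ?E i H \<le> ?c i * ?E i ?H" for i
    using exp_gap[of "debt i H / (6 * real b)" "?c i"] by (simp add: debt_Round add_divide_distrib)
  show ?thesis
  proof (cases "K \<subseteq> exposed H")
    case True
    then have "\<not> active i H" for i using box_subset[of i H] by (auto simp: active_def)
    then have "charged i H S = {}" for i using charged_active[OF H(2)] by blast
    then have "potential ?H = potential H" by (simp add: potential_def debt_Round)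
    then show ?thesis using le by (simp add: balanced_def)
  next
    case False
    then have unexp: "\<not> K \<subseteq> exposed ?H" by simp
    note j = best[OF unexp]
    let ?j = "best ?H"
    have "potential ?H - potential H = (\<Sum>i\<in>boxes. ?E i ?H - ?E i H)"
      by (simp add: potential_def sum_subtractf)
    also have "\<dots> \<le> (\<Sum>i\<in>boxes. ?c i * ?E ?j ?H)"
    proof (rule sum_mono)
      fix i assume i: "i \<in> boxes"
      show "?E i ?H - ?E i H \<le> ?c i * ?E ?j ?H"
      proof (cases "charged i H S = {}")
        case True
        then show ?thesis by (simp add: debt_Round)
      next
        case False
        then have "active i ?H" using charged_active[OF H(2)] by (simp add: active_Round)
        then have "?E i ?H \<le> ?E ?j ?H" using j(3)[OF i] b by (simp add: divide_right_mono)
        then have "?c i * ?E i ?H \<le> ?c i * ?E ?j ?H" by (rule mult_left_mono) simp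
        then show ?thesis using gap[of i] by linarith
      qed
    qed
    also have "\<dots> = real (\<Sum>i\<in>boxes. card (charged i H S)) / (6 * real b) * ?E ?j ?H"
      by (simp add: sum_distrib_right sum_divide_distrib)
    also have "\<dots> \<le> 1 / 2 * ?E ?j ?H"
    proof (rule mult_right_mono)
      have "(\<Sum>i\<in>boxes. card (charged i H S)) \<le> 3 * b"
        using sum_charged[OF H(2), of H] H(3) by linarith
      then have "real (\<Sum>i\<in>boxes. card (charged i H S)) \<le> 3 * real b" by linarith
      then show "real (\<Sum>i\<in>boxes. card (charged i H S)) / (6 * real b) \<le> 1 / 2"
        using b by (simp add: divide_simps)
    qed simp
    finally show ?thesis using le j(1,2) pending_after_round[OF re] by (auto simp: balanced_def)
  qed
qed

lemma balanced:
  assumes "reachable H" "0 < b"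
  shows "balanced H"
  using assms(1)
proof induction
  case Nil
  have "potential [] = (\<Sum>i\<in>boxes. 1)"
    unfolding potential_def by (intro sum.cong) (simp_all add: debt_def exhausts_simps)
  also have "\<dots> = 2 * real n" by (simp add: card_boxes)
  finally show ?case by (simp add: balanced_def)
next
  case (Flip H e x)
  then show ?case by (intro balanced_Flip[OF assms(2)]) simp_all
next
  case (Round H e S)
  show ?case
    using Round by (intro balanced_Round[OF assms(2)] reachable.Round) auto
qed

lemma debt_le:
  assumes "reachable H" "0 < b" "i \<in> boxes"
  shows "debt i H \<le> 6 * real b * ln (4 * real n)"
proof -
  let ?E = "\<lambda>i. exp (debt i H / (6 * real b))"
  have single: "?E j \<le> potential H" if "j \<in> boxes" for j
    unfolding potential_def using that finite_boxes by (intro member_le_sum) auto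
  have "potential H \<le> 4 * real n"
  proof (cases "potential H \<le> 2 * real n")
    case False
    then obtain j where "j \<in> boxes" "potential H \<le> 2 * real n + ?E j / 2"
      using balanced[OF assms(1,2)] by (auto simp: balanced_def)
    with single[of j] show ?thesis by linarith
  qed simp
  then have le: "?E i \<le> 4 * real n" using single[OF assms(3)] by linarith
  then have "0 < 4 * real n" by (rule less_le_trans[OF exp_gt_zero])
  then have "debt i H / (6 * real b) \<le> ln (4 * real n)" using le by (simp add: ln_ge_iff)
  then show ?thesis using assms(2) by (simp add: divide_le_eq mult.commute)
qed

lemma attack_le:
  assumes "reachable H" "i \<in> boxes"
  shows "attack i H \<le> 6 * real b * (wins i H + exhausts i H + ln (4 * real n))"
proof (cases "b = 0")
  case False
  then show ?thesis using debt_le[OF assms(1) _ assms(2)] by (simp add: debt_def algebra_simps)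
next
  case True
  have "attack i H = 0"
    using assms(1)
  proof induction
    case (Round H e S)
    then have "finite S" using finite_complete_edges finite_subset by (metis finite_Diff)
    then have "S = {}" using Round True by simp
    then have "charged i H S = {}" by (cases i) auto
    then show ?case using Round by simp
  qed simp_all
  then show ?thesis using True by simp
qed

end

section \<open>The number of stolen pairs\<close>

context play
begin

lemma stolen_at_vertex:
  assumes "reachable H" "x < n"
  shows "real (card {f \<in> stolen H. x \<in> f}) \<le> 6 * real b * (real (card (nbrs (present H) x)) + 1 + ln (4 * real n))"
proof -
  have "real (card {f \<in> stolen H. x \<in> f}) \<le> attack (Inl x) H"
    using assms(1)
  proof induction
    case (Round H e S)
    have "{f \<in> stolen (H @ [Round e S]). x \<in> f} = {f \<in> stolen H. x \<in> f} \<union> charged (Inl x) H S" by auto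
    then have "card {f \<in> stolen (H @ [Round e S]). x \<in> f} \<le> card {f \<in> stolen H. x \<in> f} + card (charged (Inl x) H S)"
      by (simp only: card_Un_le)
    then show ?case using Round.IH by simp
  qed simp_all
  also have "\<dots> \<le> 6 * real b * (wins (Inl x) H + exhausts (Inl x) H + ln (4 * real n))"
    using assms by (intro attack_le) (auto simp: boxes_def)
  also have "\<dots> \<le> 6 * real b * (real (card (nbrs (present H) x)) + 1 + ln (4 * real n))"
  proof (intro mult_left_mono add_mono)
    show "wins (Inl x) H \<le> real (card (nbrs (present H) x))"
      using wins_le[OF assms(1), of "Inl x"] card_nbrs[OF reachable_subset(3)[OF assms(1)] assms(2)] by simp
    show "exhausts (Inl x) H \<le> 1" using exhausts_star[OF assms(1), of x] by (simp add: of_bool_def split: if_splits)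
  qed auto
  finally show ?thesis .
qed

text \<open>Three kinds of aimed steals at \<open>v\<close> are distinguished: those before \<open>v\<close> became dangerous, those charged
  to the box of \<open>v\<close>, and those charged to another dangerous vertex.\<close>

definition early :: "nat \<Rightarrow> event list \<Rightarrow> edge set" where
  "early v = gather (\<lambda>H z. case z of Coin e x \<Rightarrow> {}
     | Round e S \<Rightarrow> {f \<in> S - exposed H. f \<subseteq> nbrs (present H) v \<and> v \<notin> dangerous H})"

lemma early_simps [simp]:
  "early v [] = {}" "early v (H @ [Coin e x]) = early v H"
  "early v (H @ [Round e S]) = early v H \<union> {f \<in> S - exposed H. f \<subseteq> nbrs (present H) v \<and> v \<notin> dangerous H}"
  by (simp_all add: early_def)

text \<open>There are fewer than \<open>\<theta>\<close> of them before the round in which \<open>v\<close> becomes dangerous, and that round adds at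
  most \<open>b\<close>.\<close>

lemma card_early:
  assumes "reachable H" "0 \<le> \<theta>" "v < n"
  shows "real (card (early v H)) \<le> \<theta> + real b"
  using assms(1)
proof induction
  case (Round H e S)
  have sub: "early v H \<subseteq> stolen_in v H" using Round(1) by induction auto
  have finS: "finite S" using Round finite_complete_edges finite_subset by (metis finite_Diff)
  show ?case
  proof (cases "v \<in> dangerous H")
    case True
    then show ?thesis using Round by simp
  next
    case False
    have "card (early v H) \<le> card (stolen_in v H)"
      using sub reachable_finite[OF Round(1)] by (intro card_mono)
    moreover have "real (card (stolen_in v H)) < \<theta>" using False assms(3) by (simp add: dangerous_def)
    moreover have "finite (early v H)" by (rule finite_subset[OF sub reachable_finite(5)[OF Round(1)]])
    then have "card (early v (H @ [Round e S])) \<le> card (early v H \<union> S)"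
      using finS by (intro card_mono) auto
    moreover have "card (early v H \<union> S) \<le> card (early v H) + card S" by (rule card_Un_le)
    ultimately show ?thesis using Round.hyps(6) by linarith
  qed
qed (use assms in simp_all)

definition shared :: "nat \<Rightarrow> event list \<Rightarrow> edge set" where
  "shared v H = (\<Union>u\<in>dangerous H - {v}. pairs (nbrs (present H) v \<inter> nbrs (present H) u))"

definition accounted :: "nat \<Rightarrow> event list \<Rightarrow> edge set" where
  "accounted v = gather (\<lambda>H z. case z of Coin e x \<Rightarrow> {} | Round e S \<Rightarrow> charged (Inr v) H S)"

lemma accounted_simps [simp]:
  "accounted v [] = {}" "accounted v (H @ [Coin e x]) = accounted v H"
  "accounted v (H @ [Round e S]) = accounted v H \<union> charged (Inr v) H S"
  by (simp_all add: accounted_def)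

lemma dangerous_Round:
  assumes "reachable (H @ [Round e S])"
  shows "dangerous H \<subseteq> dangerous (H @ [Round e S])"
proof -
  have "card (stolen_in v H) \<le> card (stolen_in v (H @ [Round e S]))" for v
    by (intro card_mono reachable_finite[OF assms]) simp
  then show ?thesis unfolding dangerous_def by (force intro: order.trans)
qed

lemma stolen_in_cover:
  assumes "reachable H"
  shows "stolen_in v H \<subseteq> early v H \<union> accounted v H \<union> shared v H"
  using assms
proof induction
  case (Flip H e x)
  have d: "dangerous (H @ [Coin e x]) = dangerous H" by (simp add: dangerous_def)
  have "shared v H \<subseteq> shared v (H @ [Coin e x])"
    unfolding shared_def d by (intro UN_mono subset_refl pairs_mono Int_mono nbrs_mono present_append)
  then show ?case using Flip.IH by auto
next
  case (Round H e S)
  let ?H = "H @ [Round e S]"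
  have d: "dangerous H \<subseteq> dangerous ?H" using Round.hyps by (intro dangerous_Round reachable.Round)
  then have sh: "shared v H \<subseteq> shared v ?H" unfolding shared_def by auto
  have "f \<in> early v ?H \<union> accounted v ?H \<union> shared v ?H"
    if f: "f \<in> S" "f \<notin> exposed H" "f \<subseteq> nbrs (present H) v" for f
  proof (cases "v \<in> dangerous H \<and> \<not> assigned v H f")
    case True
    then obtain u where u: "u \<in> dangerous H" "u < v" "f \<subseteq> nbrs (present H) u"
      using f by (auto simp: assigned_def)
    moreover have "card f = 2" using f Round.hyps by (auto simp: complete_edges_def)
    ultimately have "f \<in> shared v H" using f by (auto simp: shared_def pairs_def)
    then show ?thesis using sh by blast
  qed (use f in auto)
  then show ?case using Round.IH sh by auto
qed simp

lemma card_accounted: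
  assumes "reachable H" "v < n"
  shows "real (card (accounted v H)) \<le> 6 * real b *
     (real (card (induced (present H) (nbrs (present H) v))) + real (card (nbrs (present H) v)) + ln (4 * real n))"
proof -
  have "real (card (accounted v H)) \<le> attack (Inr v) H"
    using assms(1)
  proof induction
    case (Round H e S)
    have "card (accounted v (H @ [Round e S])) \<le> card (accounted v H) + card (charged (Inr v) H S)"
      by (simp only: accounted_simps card_Un_le)
    then show ?case using Round.IH by simp
  qed simp_all
  also have "\<dots> \<le> 6 * real b * (wins (Inr v) H + exhausts (Inr v) H + ln (4 * real n))"
    using assms by (intro attack_le) (auto simp: boxes_def)
  also have "\<dots> \<le> 6 * real b * (real (card (induced (present H) (nbrs (present H) v)))
      + real (card (nbrs (present H) v)) + ln (4 * real n))"
  proof (intro mult_left_mono add_mono)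
    have "present H \<inter> box (Inr v) H = induced (present H) (nbrs (present H) v)"
      using reachable_subset[OF assms(1)] by (auto simp: induced_def)
    then show "wins (Inr v) H \<le> real (card (induced (present H) (nbrs (present H) v)))"
      using wins_le[OF assms(1), of "Inr v"] by (simp only:)
    show "exhausts (Inr v) H \<le> real (card (nbrs (present H) v))"
      using exhausts_nbrs[OF assms(1), of v] by (simp add: of_bool_def split: if_splits)
  qed auto
  finally show ?thesis .
qed

lemma dangerous_subset: "dangerous H \<subseteq> {..<n}" and finite_dangerous: "finite (dangerous H)"
  by (auto simp: dangerous_def)

lemma card_shared:
  assumes "reachable H"
  shows "real (card (shared v H)) \<le> (\<Sum>u\<in>dangerous H - {v}. (real (codeg (present H) v u))\<^sup>2)"
proof -
  have "real (card (shared v H)) \<le> (\<Sum>u\<in>dangerous H - {v}. real (card (pairs (nbrs (present H) v \<inter> nbrs (present H) u))))"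
    unfolding shared_def using card_UN_le[of "dangerous H - {v}"] finite_dangerous
    by (simp flip: of_nat_sum)
  also have "\<dots> \<le> (\<Sum>u\<in>dangerous H - {v}. (real (codeg (present H) v u))\<^sup>2)"
  proof (rule sum_mono)
    fix u
    have "finite (nbrs (present H) v \<inter> nbrs (present H) u)" using reachable_finite[OF assms] by simp
    from card_pairs_le[OF this]
    show "real (card (pairs (nbrs (present H) v \<inter> nbrs (present H) u))) \<le> (real (codeg (present H) v u))\<^sup>2"
      unfolding codeg_def by linarith
  qed
  finally show ?thesis .
qed

lemma card_stolen_in:
  assumes "reachable H" "0 \<le> \<theta>" "v < n"
  shows "real (card (stolen_in v H)) \<le> \<theta> + real b
     + 6 * real b * (real (card (induced (present H) (nbrs (present H) v))) + real (card (nbrs (present H) v)) + ln (4 * real n))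
     + (\<Sum>u\<in>dangerous H - {v}. (real (codeg (present H) v u))\<^sup>2)"
proof -
  have "finite (early v H)" using assms(1)
    by induction (auto intro: finite_subset[OF _ finite_complete_edges])
  moreover have "finite (accounted v H)" using assms(1)
  proof induction
    case (Round H e S)
    then have "finite S" using finite_complete_edges finite_subset by (metis finite_Diff)
    then show ?case using Round by simp
  qed simp_all
  moreover have "finite (shared v H)"
    unfolding shared_def using reachable_finite[OF assms(1)] finite_dangerous by (auto intro: finite_pairs)
  ultimately have "card (stolen_in v H) \<le> card (early v H \<union> accounted v H \<union> shared v H)"
    by (intro card_mono stolen_in_cover[OF assms(1)]) auto
  also have "\<dots> \<le> card (early v H \<union> accounted v H) + card (shared v H)" by (rule card_Un_le)
  also have "\<dots> \<le> card (early v H) + card (accounted v H) + card (shared v H)"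
    by (intro add_right_mono card_Un_le)
  finally have "real (card (stolen_in v H)) \<le> real (card (early v H)) + real (card (accounted v H)) + real (card (shared v H))"
    by linarith
  then show ?thesis
    using card_early[OF assms] card_accounted[OF assms(1,3)] card_shared[OF assms(1), of v] by linarith
qed

lemma stolen_in_subset: "stolen_in v H \<subseteq> {f. f \<subseteq> nbrs (present H) v}"
proof (induction H rule: rev_induct)
  case (snoc z H)
  have "stolen_in v (H @ [z]) \<subseteq> {f. f \<subseteq> nbrs (present H) v}" using snoc.IH by (cases z) auto
  moreover have "nbrs (present H) v \<subseteq> nbrs (present (H @ [z])) v" by (intro nbrs_mono present_append)
  ultimately show ?case by blast
qed simp

text \<open>Each of the \<open>k\<close> dangerous neighbourhoods contains at least \<open>\<theta>\<close> stolen pairs. By Cauchy-Schwarz \<open>k * \<theta>\<close> is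
  small unless many stolen pairs lie in several of these neighbourhoods, and codegrees bound how often this
  can happen. With \<open>\<theta>\<close> of order \<open>p\<^sup>2 n\<^sup>2\<close> and \<open>O(c n\<^sup>2)\<close> stolen pairs this yields \<open>k = O(c / p\<^sup>2)\<close>.\<close>

lemma dangerous_count:
  assumes "reachable H" "0 \<le> \<theta>"
  shows "(real (card (dangerous H)) * \<theta>)\<^sup>2 \<le> real (card (stolen H)) *
    (\<Sum>v\<in>dangerous H. (real (card (nbrs (present H) v)))\<^sup>2 + (\<Sum>u\<in>dangerous H - {v}. (real (codeg (present H) v u))\<^sup>2))"
proof -
  let ?D = "dangerous H" and ?N = "nbrs (present H)"
  have le: "real (card (stolen_in v H \<inter> stolen_in u H)) \<le> (real (card (?N v \<inter> ?N u)))\<^sup>2" for u v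
  proof -
    have fin: "finite (?N v \<inter> ?N u)" using reachable_finite[OF assms(1)] by simp
    have "stolen_in v H \<inter> stolen_in u H \<subseteq> pairs (?N v \<inter> ?N u)"
      using stolen_in_subset[of v H] stolen_in_subset[of u H] reachable_subset[OF assms(1)]
      by (fastforce simp: pairs_def complete_edges_def)
    then have "card (stolen_in v H \<inter> stolen_in u H) \<le> card (pairs (?N v \<inter> ?N u))"
      by (intro card_mono finite_pairs fin)
    then show ?thesis using card_pairs_le[OF fin] by linarith
  qed
  have "real (card ?D) * \<theta> \<le> (\<Sum>v\<in>?D. real (card (stolen_in v H)))"
    using sum_bounded_below[of ?D \<theta> "\<lambda>v. real (card (stolen_in v H))"] by (simp add: dangerous_def)
  then have "(real (card ?D) * \<theta>)\<^sup>2 \<le> (\<Sum>v\<in>?D. real (card (stolen_in v H)))\<^sup>2"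
    using assms by (intro power_mono) auto
  also have "\<dots> \<le> real (card (stolen H)) * (\<Sum>v\<in>?D. \<Sum>u\<in>?D. real (card (stolen_in v H \<inter> stolen_in u H)))"
    using reachable_finite[OF assms(1)] reachable_subset[OF assms(1)] finite_dangerous
    by (intro sum_card_square) auto
  also have "\<dots> \<le> real (card (stolen H)) * (\<Sum>v\<in>?D. \<Sum>u\<in>?D. (real (card (?N v \<inter> ?N u)))\<^sup>2)"
    by (intro mult_left_mono sum_mono le) auto
  also have "\<dots> = real (card (stolen H)) * (\<Sum>v\<in>?D. (real (card (?N v)))\<^sup>2 + (\<Sum>u\<in>?D - {v}. (real (codeg (present H) v u))\<^sup>2))"
    by (intro arg_cong[of _ _ "(*) _"] sum.cong refl)
      (simp add: sum.remove[OF finite_dangerous] codeg_def)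
  finally show ?thesis .
qed

end

section \<open>The number of lost edges\<close>

context play
begin

text \<open>The weights count, for the flip of \<open>e\<close>: a lost edge at \<open>x\<close>; the stolen pairs that enter the
  neighbourhood of \<open>v\<close>; a lost edge that completes a triangle at \<open>v\<close> as its last edge; the lost edges that
  complete a triangle at \<open>v\<close> when \<open>e\<close> is its last edge.\<close>

definition star_weight :: "nat \<Rightarrow> event list \<Rightarrow> edge \<Rightarrow> real" where
  "star_weight x H e = of_bool (e \<in> stolen H \<and> x \<in> e)"

definition closing_weight :: "nat \<Rightarrow> event list \<Rightarrow> edge \<Rightarrow> real" where
  "closing_weight v H e = real (card (wedges v (stolen H) (nbrs (present H) v) e))"

definition inner_weight :: "nat \<Rightarrow> event list \<Rightarrow> edge \<Rightarrow> real" where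
  "inner_weight v H e = of_bool (e \<in> stolen H \<and> e \<subseteq> nbrs (present H) v)"

definition outer_weight :: "nat \<Rightarrow> event list \<Rightarrow> edge \<Rightarrow> real" where
  "outer_weight v H e = real (card (wedges v (stolen H \<inter> present H) (nbrs (present H) v) e))"

lemma lost_at_vertex:
  assumes "reachable H"
  shows "real (card {f \<in> stolen H \<inter> present H. x \<in> f}) \<le> hit_sum (star_weight x) H"
  using assms
proof induction
  case (Flip H e y)
  let ?H = "H @ [Coin e y]"
  have "{f \<in> stolen ?H \<inter> present ?H. x \<in> f} \<subseteq> {f \<in> stolen H \<inter> present H. x \<in> f} \<union> (if y \<and> e \<in> stolen H \<and> x \<in> e then {e} else {})"
    by auto
  then have "card {f \<in> stolen ?H \<inter> present ?H. x \<in> f}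
      \<le> card ({f \<in> stolen H \<inter> present H. x \<in> f} \<union> (if y \<and> e \<in> stolen H \<and> x \<in> e then {e} else {}))"
    using reachable_finite[OF Flip(1)] by (intro card_mono) auto
  also have "\<dots> \<le> card {f \<in> stolen H \<inter> present H. x \<in> f} + card (if y \<and> e \<in> stolen H \<and> x \<in> e then {e} else {})"
    by (rule card_Un_le)
  finally show ?case using Flip.IH by (auto simp: star_weight_def split: if_splits)
next
  case (Round H e S)
  have "{f \<in> stolen (H @ [Round e S]) \<inter> present (H @ [Round e S]). x \<in> f} = {f \<in> stolen H \<inter> present H. x \<in> f}"
    using present_subset_exposed[of H] by auto
  then show ?case using Round.IH by simp
qed simp

lemma nbrs_after_flip:
  assumes "e \<in> K" "f \<subseteq> nbrs (insert e G) v" "\<not> f \<subseteq> nbrs G v" "f \<in> K"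
  obtains x y where "x \<noteq> y" "e = {v, y}" "f = {x, y}" "x \<in> nbrs G v"
proof -
  have "v \<in> e" using assms nbrs_insert_other by metis
  with assms(1) obtain y where y: "e = {v, y}" "y \<noteq> v" using edge_at by (metis insert_commute)
  then have nb: "nbrs (insert e G) v = insert y (nbrs G v)" by (simp add: nbrs_insert_edge)
  then have "y \<in> f" using assms by auto
  with assms(4) obtain x where x: "f = {x, y}" "x \<noteq> y" by (rule edge_at)
  then show ?thesis using that y nb assms(2) by blast
qed

text \<open>A stolen pair inside the neighbourhood of \<open>v\<close> that was not aimed entered this neighbourhood later, with the
  flip of the second of its edges to \<open>v\<close>.\<close>

lemma stolen_in_nbrs:
  assumes "reachable H"
  shows "real (card {f \<in> stolen H. f \<subseteq> nbrs (present H) v}) \<le> real (card (stolen_in v H)) + hit_sum (closing_weight v) H"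
  using assms
proof induction
  case (Flip H e y)
  let ?H = "H @ [Coin e y]"
  let ?W = "if y then wedges v (stolen H) (nbrs (present H) v) e else {}"
  have eK: "e \<in> K" using Flip flip_in_K by blast
  have "{f \<in> stolen ?H. f \<subseteq> nbrs (present ?H) v} \<subseteq> {f \<in> stolen H. f \<subseteq> nbrs (present H) v} \<union> ?W"
  proof
    fix f assume f: "f \<in> {f \<in> stolen ?H. f \<subseteq> nbrs (present ?H) v}"
    show "f \<in> {f \<in> stolen H. f \<subseteq> nbrs (present H) v} \<union> ?W"
    proof (cases "f \<subseteq> nbrs (present H) v")
      case False
      then have y and "f \<subseteq> nbrs (insert e (present H)) v" using f by (auto split: if_splits)
      moreover have "f \<in> K" using f reachable_subset[OF Flip(1)] by auto
      ultimately obtain a c where "a \<noteq> c" "e = {v, c}" "f = {a, c}" "a \<in> nbrs (present H) v"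
        using nbrs_after_flip[OF eK _ False] by metis
      then show ?thesis using f \<open>y\<close> by (auto simp: wedges_def)
    qed (use f in simp)
  qed
  then have "card {f \<in> stolen ?H. f \<subseteq> nbrs (present ?H) v} \<le> card ({f \<in> stolen H. f \<subseteq> nbrs (present H) v} \<union> ?W)"
    using reachable_finite[OF Flip(1)] by (intro card_mono) (auto simp: finite_wedges)
  also have "\<dots> \<le> card {f \<in> stolen H. f \<subseteq> nbrs (present H) v} + card ?W" by (rule card_Un_le)
  finally have "real (card {f \<in> stolen ?H. f \<subseteq> nbrs (present ?H) v})
      \<le> real (card {f \<in> stolen H. f \<subseteq> nbrs (present H) v}) + real (card ?W)" by linarith
  moreover have "hit_sum (closing_weight v) ?H = hit_sum (closing_weight v) H + real (card ?W)"
    by (simp add: closing_weight_def)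
  ultimately show ?case using Flip.IH by (simp only: stolen_in_simps)
next
  case (Round H e S)
  let ?H = "H @ [Round e S]"
  let ?N = "{f \<in> S - exposed H. f \<subseteq> nbrs (present H) v}"
  have "finite S" using Round finite_complete_edges finite_subset by (metis finite_Diff)
  then have fin: "finite ?N" by simp
  have "{f \<in> stolen ?H. f \<subseteq> nbrs (present ?H) v} = {f \<in> stolen H. f \<subseteq> nbrs (present H) v} \<union> (?N - stolen H)" by auto
  then have 1: "card {f \<in> stolen ?H. f \<subseteq> nbrs (present ?H) v} \<le> card {f \<in> stolen H. f \<subseteq> nbrs (present H) v} + card (?N - stolen H)"
    by (simp only: card_Un_le)
  have "card (stolen_in v H) + card (?N - stolen H) = card (stolen_in v H \<union> (?N - stolen H))"
    using fin reachable_finite[OF Round(1)] reachable_subset(5)[OF Round(1), of v]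
    by (intro card_Un_disjoint[symmetric]) blast+
  also have "\<dots> \<le> card (stolen_in v ?H)"
    using fin reachable_finite[OF Round(1)] by (intro card_mono) auto
  finally show ?case using 1 Round.IH by (simp only: hit_sum_simps)
qed simp

text \<open>The last flip among the three edges of the triangle decides which of the two sums counts it.\<close>

lemma lost_in_nbrs:
  assumes "reachable H"
  shows "real (card {f \<in> stolen H \<inter> present H. f \<subseteq> nbrs (present H) v}) \<le> hit_sum (inner_weight v) H + hit_sum (outer_weight v) H"
  using assms
proof induction
  case (Flip H e y)
  let ?H = "H @ [Coin e y]"
  let ?W = "if y then wedges v (stolen H \<inter> present H) (nbrs (present H) v) e else {}"
  let ?I = "if y \<and> e \<in> stolen H \<and> e \<subseteq> nbrs (present H) v then {e} else {}"
  let ?L = "{f \<in> stolen H \<inter> present H. f \<subseteq> nbrs (present H) v}"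
  have eK: "e \<in> K" using Flip flip_in_K by blast
  have "{f \<in> stolen ?H \<inter> present ?H. f \<subseteq> nbrs (present ?H) v} \<subseteq> ?L \<union> ?W \<union> ?I"
  proof
    fix f assume f: "f \<in> {f \<in> stolen ?H \<inter> present ?H. f \<subseteq> nbrs (present ?H) v}"
    show "f \<in> ?L \<union> ?W \<union> ?I"
    proof (cases "f = e \<and> y")
      case True
      then have "v \<notin> e" using f not_in_own_nbrs by auto
      then show ?thesis using True f by (auto simp: nbrs_insert_other)
    next
      case fe: False
      then have fp: "f \<in> present H" using f by (auto split: if_splits)
      show ?thesis
      proof (cases "f \<subseteq> nbrs (present H) v")
        case False
        then have y and "f \<subseteq> nbrs (insert e (present H)) v" using f by (auto split: if_splits)
        moreover have "f \<in> K" using f reachable_subset[OF Flip(1)] by auto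
        ultimately obtain a c where "a \<noteq> c" "e = {v, c}" "f = {a, c}" "a \<in> nbrs (present H) v"
          using nbrs_after_flip[OF eK _ False] by metis
        then show ?thesis using f fp \<open>y\<close> by (auto simp: wedges_def)
      qed (use f fp in simp)
    qed
  qed
  then have "card {f \<in> stolen ?H \<inter> present ?H. f \<subseteq> nbrs (present ?H) v} \<le> card (?L \<union> ?W \<union> ?I)"
    using reachable_finite[OF Flip(1)] by (intro card_mono) (auto simp: finite_wedges)
  also have "\<dots> \<le> card (?L \<union> ?W) + card ?I" by (rule card_Un_le)
  also have "\<dots> \<le> card ?L + card ?W + card ?I" by (intro add_right_mono card_Un_le)
  finally have "real (card {f \<in> stolen ?H \<inter> present ?H. f \<subseteq> nbrs (present ?H) v})
      \<le> real (card ?L) + real (card ?W) + real (card ?I)" by linarith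
  moreover have "hit_sum (outer_weight v) ?H = hit_sum (outer_weight v) H + real (card ?W)"
    by (simp add: outer_weight_def)
  moreover have "hit_sum (inner_weight v) ?H = hit_sum (inner_weight v) H + real (card ?I)"
    by (simp add: inner_weight_def)
  ultimately show ?case using Flip.IH by linarith
next
  case (Round H e S)
  let ?H = "H @ [Round e S]"
  have "{f \<in> stolen ?H \<inter> present ?H. f \<subseteq> nbrs (present ?H) v} = {f \<in> stolen H \<inter> present H. f \<subseteq> nbrs (present H) v}"
    using present_subset_exposed[of H] by auto
  then show ?case using Round.IH by simp
qed simp

lemma sum_of_bool_le_card:
  assumes "finite B"
  shows "(\<Sum>e\<in>A. of_bool (e \<in> B)) \<le> real (card B)"
proof (cases "finite A")
  case True
  then have "(\<Sum>e\<in>A. of_bool (e \<in> B)) = real (card (A \<inter> B))"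
    by (simp add: of_bool_def sum.If_cases Int_def)
  also have "\<dots> \<le> real (card B)" using assms by (auto intro: card_mono)
  finally show ?thesis .
qed simp

lemma flips_star:
  assumes "reachable H"
  shows "flip_sum (star_weight x) H \<le> real (card {f \<in> stolen H. x \<in> f})"
proof -
  have "flip_sum (star_weight x) H \<le> (\<Sum>e\<in>exposed H. of_bool (e \<in> {f \<in> stolen H. x \<in> f}))"
    using assms by (rule flip_sum_le) (use stolen_append in \<open>auto simp: star_weight_def of_bool_def\<close>)
  also have "\<dots> \<le> real (card {f \<in> stolen H. x \<in> f})"
    using reachable_finite[OF assms] by (intro sum_of_bool_le_card) simp
  finally show ?thesis .
qed

lemma flips_inner:
  assumes "reachable H"
  shows "flip_sum (inner_weight v) H \<le> real (card {f \<in> stolen H. f \<subseteq> nbrs (present H) v})"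
proof -
  have "flip_sum (inner_weight v) H \<le> (\<Sum>e\<in>exposed H. of_bool (e \<in> {f \<in> stolen H. f \<subseteq> nbrs (present H) v}))"
    using assms
  proof (rule flip_sum_le)
    fix H1 e x H2 assume "H = H1 @ Coin e x # H2"
    then have "stolen H1 \<subseteq> stolen H" "nbrs (present H1) v \<subseteq> nbrs (present H) v"
      by (auto intro!: nbrs_mono present_append stolen_append)
    then show "inner_weight v H1 e \<le> of_bool (e \<in> {f \<in> stolen H. f \<subseteq> nbrs (present H) v})"
      by (auto simp: inner_weight_def of_bool_def)
  qed
  also have "\<dots> \<le> real (card {f \<in> stolen H. f \<subseteq> nbrs (present H) v})"
    using reachable_finite[OF assms] by (intro sum_of_bool_le_card) simp
  finally show ?thesis .
qed

lemma flips_wedges: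
  assumes "reachable H" "\<And>H1 H2. H = H1 @ H2 \<Longrightarrow> Q H1 \<subseteq> Q H" "finite (Q H)"
    and w: "\<And>H1 e. w H1 e \<le> real (card (wedges v (Q H1) (nbrs (present H1) v) e))"
  shows "flip_sum w H \<le> (\<Sum>x\<in>nbrs (present H) v. real (card {f \<in> Q H. x \<in> f}))"
proof -
  have "flip_sum w H \<le> (\<Sum>e\<in>exposed H. real (card (wedges v (Q H) (nbrs (present H) v) e)))"
    using assms(1)
  proof (rule flip_sum_le)
    fix H1 e x H2 assume H: "H = H1 @ Coin e x # H2"
    then have "wedges v (Q H1) (nbrs (present H1) v) e \<subseteq> wedges v (Q H) (nbrs (present H) v) e"
      by (intro wedges_mono nbrs_mono assms(2)[OF H]) (auto intro: present_append[THEN subsetD])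
    then have "card (wedges v (Q H1) (nbrs (present H1) v) e) \<le> card (wedges v (Q H) (nbrs (present H) v) e)"
      using assms(3) by (intro card_mono finite_wedges)
    then show "w H1 e \<le> real (card (wedges v (Q H) (nbrs (present H) v) e))"
      using w[of H1 e] by linarith
  qed
  also have "\<dots> \<le> (\<Sum>x\<in>nbrs (present H) v. real (card {f \<in> Q H. x \<in> f}))"
    using sum_wedges_le[of "exposed H" "Q H" "nbrs (present H) v" v] reachable_finite[OF assms(1)] assms(3)
    by (simp flip: of_nat_sum)
  finally show ?thesis .
qed

lemma closing_weight_le:
  assumes "reachable H" "H = H1 @ H2"
  shows "closing_weight v H1 e \<le> real (card (nbrs (present H) v))"
proof -
  have r: "reachable H1" using assms prefix_reachable by blast
  have "card (wedges v (stolen H1) (nbrs (present H1) v) e) \<le> card (nbrs (present H1) v)"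
    by (intro card_wedges_le reachable_finite[OF r])
  also have "\<dots> \<le> card (nbrs (present H) v)"
    unfolding assms(2) using reachable_finite[OF assms(1)] assms(2) by (intro card_mono nbrs_mono present_append) auto
  finally show ?thesis by (simp add: closing_weight_def)
qed

text \<open>The edges \<open>xy\<close> counted for \<open>e = vy\<close> are present, so \<open>x\<close> is a common neighbour of \<open>v\<close> and \<open>y\<close>. The trivial
  bound by the degree would be too weak: with it the deviation is governed by \<open>p\<^sup>2 n\<close>, which may be a
  constant and does not survive a union bound over \<open>n\<close> vertices.\<close>

lemma outer_weight_le:
  assumes "reachable H" "H = H1 @ H2" "e \<in> K"
    and "\<And>y. y < n \<Longrightarrow> y \<noteq> v \<Longrightarrow> real (codeg (present H) v y) \<le> L" "0 \<le> L"
  shows "outer_weight v H1 e \<le> L"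
proof (cases "v \<in> e")
  case True
  then obtain y where y: "e = {v, y}" "y \<noteq> v" "y < n" using edge_at[OF assms(3)] by (metis insert_commute)
  have P: "present H1 \<subseteq> present H" using assms(2) present_append by simp
  have "wedges v (stolen H1 \<inter> present H1) (nbrs (present H1) v) e
      \<subseteq> (\<lambda>x. {x, y}) ` (nbrs (present H) v \<inter> nbrs (present H) y)"
  proof
    fix f assume "f \<in> wedges v (stolen H1 \<inter> present H1) (nbrs (present H1) v) e"
    then obtain x c where f: "x \<noteq> c" "e = {v, c}" "f = {x, c}" "x \<in> nbrs (present H1) v" "f \<in> present H1"
      by (auto simp: wedges_def)
    then have "c = y" using y by (auto simp: doubleton_eq_iff)
    then have "x \<in> nbrs (present H) v \<inter> nbrs (present H) y"
      using f nbrs_mono[OF P, of v] P by (auto simp: nbrs_def)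
    then show "f \<in> (\<lambda>x. {x, y}) ` (nbrs (present H) v \<inter> nbrs (present H) y)" using f \<open>c = y\<close> by blast
  qed
  then have "card (wedges v (stolen H1 \<inter> present H1) (nbrs (present H1) v) e) \<le> codeg (present H) v y"
    unfolding codeg_def using reachable_finite[OF assms(1)]
    by (meson card_image_le card_mono finite_Int finite_imageI le_trans)
  then show ?thesis using assms(4)[OF y(3,2)] by (simp add: outer_weight_def)
next
  case False
  then have "wedges v (stolen H1 \<inter> present H1) (nbrs (present H1) v) e = {}" by (auto simp: wedges_def)
  then show ?thesis using assms(5) by (simp add: outer_weight_def)
qed

end

section \<open>Outcomes of the game\<close>

context play
begin

lemma flips_le:
  assumes r: "reachable H"
  shows "flip_sum (\<lambda>H e. min (closing_weight v H e) L) H \<le> (\<Sum>x\<in>nbrs (present H) v. real (card {f \<in> stolen H. x \<in> f}))"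
    and "flip_sum (\<lambda>H e. min (outer_weight v H e) L) H \<le> (\<Sum>x\<in>nbrs (present H) v. real (card {f \<in> stolen H \<inter> present H. x \<in> f}))"
proof -
  show "flip_sum (\<lambda>H e. min (closing_weight v H e) L) H \<le> (\<Sum>x\<in>nbrs (present H) v. real (card {f \<in> stolen H. x \<in> f}))"
    using r by (rule flips_wedges) (auto simp: closing_weight_def reachable_finite[OF r] intro: stolen_append[THEN subsetD])
  show "flip_sum (\<lambda>H e. min (outer_weight v H e) L) H \<le> (\<Sum>x\<in>nbrs (present H) v. real (card {f \<in> stolen H \<inter> present H. x \<in> f}))"
    using r by (rule flips_wedges[where Q = "\<lambda>H. stolen H \<inter> present H"])
      (auto simp: outer_weight_def reachable_finite[OF r] intro: stolen_append[THEN subsetD] present_append[THEN subsetD])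
qed

definition tail_bound :: "real \<Rightarrow> real \<Rightarrow> real \<Rightarrow> (event list \<Rightarrow> edge \<Rightarrow> real) \<Rightarrow> event list \<Rightarrow> bool" where
  "tail_bound p t L w H \<longleftrightarrow> hit_sum w H \<le> 2 * p * flip_sum w H + t * L"

text \<open>Truncation makes the last two weights bounded for all histories, as \<open>adaptive_tail\<close> requires; in the play
  of a pseudorandom graph the truncation never takes effect.\<close>

definition concentrated :: "real \<Rightarrow> real \<Rightarrow> event list \<Rightarrow> bool" where
  "concentrated p t H \<longleftrightarrow> (\<forall>v<n.
     tail_bound p t 1 (star_weight v) H \<and>
     tail_bound p t 1 (inner_weight v) H \<and>
     tail_bound p t (3 * p * real n) (\<lambda>H e. min (closing_weight v H e) (3 * p * real n)) H \<and>
     tail_bound p t (6 * (p\<^sup>2 * real n) + t) (\<lambda>H e. min (outer_weight v H e) (6 * (p\<^sup>2 * real n) + t)) H)"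

lemma prob_not_concentrated:
  assumes "0 < p" "p \<le> 1" "0 < t" "0 < n"
  shows "measure_pmf.prob (gnp n p) {\<Gamma>. \<not> concentrated p t (history \<Gamma> k)} \<le> real n * (4 * exp (- t))"
proof -
  have L: "0 < 3 * p * real n" "0 < 6 * (p\<^sup>2 * real n) + t" using assms by (simp_all add: add_pos_pos)
  have tail: "measure_pmf.prob (gnp n p) {\<Gamma>. \<not> tail_bound p t L w (history \<Gamma> k)} \<le> exp (- t)"
    if "0 < L" "\<And>H e. 0 \<le> w H e" "\<And>H e. w H e \<le> L" for w L
    unfolding tail_bound_def not_le using assms that by (intro adaptive_tail) auto
  have "measure_pmf.prob (gnp n p) {\<Gamma>. \<not> concentrated p t (history \<Gamma> k)}
      \<le> real (card {..<n}) * (exp (- t) + (exp (- t) + (exp (- t) + exp (- t))))"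
    unfolding concentrated_def not_all not_imp Bex_def[symmetric] lessThan_iff[symmetric] de_Morgan_conj
    using L by (intro prob_bex finite_lessThan order.trans[OF prob_disj] add_mono tail)
      (auto simp: star_weight_def inner_weight_def closing_weight_def outer_weight_def)
  then show ?thesis by simp
qed

text \<open>With \<open>m = n\<close> and up to constants: \<open>c m\<close> stolen pairs and \<open>c p m\<close> lost edges at every vertex; \<open>O(c / p\<^sup>2)\<close>
  dangerous vertices up to powers of \<open>\<epsilon>\<close>; hence few steals inside each neighbourhood beyond the
  threshold \<open>\<theta>\<close>, so that a small multiple of \<open>\<epsilon> p\<^sup>2 m\<^sup>2\<close> pairs are stolen there, and \<open>p\<close> times as many edges
  are lost.\<close>

lemma good_outcome:
  fixes p \<epsilon> t c :: real
  defines "lg \<equiv> ln (4 * real n)"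
  assumes H: "reachable H" "over H"
    and ps: "pseudorandom n p \<epsilon> t (present H)" and con: "concentrated p t H"
    and p: "0 < p" "p \<le> 1" and eps: "0 < \<epsilon>" "\<epsilon> < 1" and t: "0 < t" and n: "0 < n"
    and \<theta>: "\<theta> = \<epsilon> / 100 * (p\<^sup>2 * (real n)\<^sup>2)"
    and c: "c = \<epsilon> ^ 3 / 10 ^ 12" "real b * p \<le> c"
    and A1: "3 * t \<le> c * (p * real n)"
    and A2: "6 * real b * (1 + lg) \<le> c * real n"
    and A4: "t \<le> c * (p ^ 3 * (real n)\<^sup>2)"
    and A5: "t * (6 * (p\<^sup>2 * real n) + t) \<le> c * (p ^ 3 * (real n)\<^sup>2)"
    and A6: "real b * (1 + 6 * lg + 6 * t) \<le> c * (p\<^sup>2 * (real n)\<^sup>2)"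
    and A7: "1 \<le> p\<^sup>2 * real n"
    and A8: "10 \<le> \<epsilon> * real n"
    and A9: "10 \<le> \<epsilon> * (p * real n)"
  shows "(1 - \<epsilon>) * p * real n \<le> real (min_degree n (present H \<inter> maker_edges H)) \<and>
     (\<forall>v<n. (1 - \<epsilon>) * (p ^ 3 * (real n)\<^sup>2 / 2)
        \<le> real (card (induced (present H \<inter> maker_edges H) (nbrs (present H) v))))"
proof -
  define \<Gamma> where "\<Gamma> = present H"
  define G where "G = \<Gamma> \<inter> maker_edges H"
  define N where "N = nbrs \<Gamma>"
  define m where "m = real n"
  define P2 where "P2 = p\<^sup>2 * m\<^sup>2"
  define P3 where "P3 = p ^ 3 * m\<^sup>2"
  have \<Gamma>K: "\<Gamma> \<subseteq> K" unfolding \<Gamma>_def using reachable_subset[OF H(1)] by simp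
  have finN: "finite (N v)" for v unfolding N_def \<Gamma>_def using reachable_finite[OF H(1)] by simp
  have m: "0 < m" using n by (simp add: m_def)
  have pm: "0 < p * m" using p m by simp
  have c0: "0 < c" using eps by (simp add: c)
  have ce: "c * 10 ^ 12 \<le> \<epsilon>" "c * 10 ^ 12 \<le> \<epsilon>\<^sup>2"
  proof -
    have "\<epsilon> ^ 3 \<le> \<epsilon> ^ 1" "\<epsilon> ^ 3 \<le> \<epsilon> ^ 2" using eps by (intro power_decreasing; simp)+
    then show "c * 10 ^ 12 \<le> \<epsilon>" "c * 10 ^ 12 \<le> \<epsilon>\<^sup>2" by (simp_all add: c)
  qed
  have P2: "0 < P2" and P3: "0 < P3" using p m by (simp_all add: P2_def P3_def)
  have P23: "p * P2 = P3" by (simp add: P2_def P3_def power2_eq_square power3_eq_cube)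
  have mP2: "m \<le> P2"
  proof -
    have "1 * m \<le> (p\<^sup>2 * m) * m" using A7 m by (intro mult_right_mono) (auto simp: m_def)
    then show ?thesis by (simp add: P2_def power2_eq_square mult_ac)
  qed
  have ps_at: "pseudorandom_at n p \<epsilon> t v \<Gamma>" if "v < n" for v
    using ps that by (simp add: pseudorandom_def \<Gamma>_def)
  have deg: "(1 - \<epsilon> / 10) * p * (m - 1) \<le> real (card (N v))" "real (card (N v)) \<le> 3 * p * m" if "v < n" for v
    using ps_at[OF that] by (auto simp: pseudorandom_at_def N_def m_def)
  have inner: "(1 - \<epsilon> / 10) * p * real (card (pairs (N v))) \<le> real (card (induced \<Gamma> (N v)))"
    "real (card (induced \<Gamma> (N v))) \<le> 2 * p * real (card (pairs (N v))) + t" if "v < n" for v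
    using ps_at[OF that] by (auto simp: pseudorandom_at_def N_def)
  have cod: "real (codeg \<Gamma> v u) \<le> 6 * (p\<^sup>2 * m) + t" if "v < n" "u < n" "u \<noteq> v" for u v
    using ps_at[OF that(1)] that by (auto simp: pseudorandom_at_def m_def)
  have cod2: "(\<Sum>u\<in>D. (real (codeg \<Gamma> v u))\<^sup>2) \<le> 400 * real (card D) * (p\<^sup>2 * m)\<^sup>2 + \<epsilon> / 100 * P2"
    if "v < n" "D \<subseteq> {..<n} - {v}" for v D
    using ps_at[OF that(1)] that by (auto simp: pseudorandom_at_def m_def P2_def)
  have Nn: "N v \<subseteq> {..<n}" for v using nbrs_subset[OF \<Gamma>K, of v] by (auto simp: N_def)

  \<comment> \<open>By \<open>A2\<close> the debt is of lower order, and a vertex star contains at most \<open>3 * p * m\<close> edges of \<open>\<Gamma>\<close>.\<close>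
  have d: "real (card {f \<in> stolen H. x \<in> f}) \<le> 19 * c * m" if "x < n" for x
  proof -
    have "real (card {f \<in> stolen H. x \<in> f}) \<le> 6 * real b * (real (card (N x)) + 1 + lg)"
      using stolen_at_vertex[OF H(1) that] by (simp add: N_def \<Gamma>_def lg_def)
    also have "\<dots> = 6 * real b * real (card (N x)) + 6 * real b * (1 + lg)" by (simp add: algebra_simps)
    also have "\<dots> \<le> 6 * real b * (3 * p * m) + c * m"
      using deg[OF that] A2 by (intro add_mono mult_left_mono) (auto simp: m_def)
    also have "6 * real b * (3 * p * m) = 18 * m * (real b * p)" by simp
    also have "\<dots> \<le> 18 * m * c" using c m by (intro mult_left_mono) auto
    finally show ?thesis by (simp add: algebra_simps)
  qed
  have lost: "real (card {f \<in> stolen H \<inter> \<Gamma>. x \<in> f}) \<le> 39 * c * (p * m)" if "x < n" for x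
  proof -
    have "real (card {f \<in> stolen H \<inter> \<Gamma>. x \<in> f}) \<le> hit_sum (star_weight x) H"
      using lost_at_vertex[OF H(1)] by (simp add: \<Gamma>_def)
    also have "\<dots> \<le> 2 * p * flip_sum (star_weight x) H + t" using con that by (simp add: concentrated_def tail_bound_def)
    also have "\<dots> \<le> 2 * p * (19 * c * m) + c * (p * m)"
      using order.trans[OF flips_star[OF H(1)] d[OF that]] p A1 t
      by (intro add_mono mult_left_mono) (auto simp: m_def)
    finally show ?thesis by (simp add: algebra_simps)
  qed

  define D where "D = dangerous H"
  define k where "k = real (card D)"
  define y where "y = k * p\<^sup>2"
  have D: "D \<subseteq> {..<n}" "finite D" by (simp_all add: D_def dangerous_subset finite_dangerous)
  have k0: "0 \<le> k" by (simp add: k_def)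
  have codD: "(\<Sum>u\<in>D - {v}. (real (codeg \<Gamma> v u))\<^sup>2) \<le> (400 * y + \<epsilon> / 100) * P2" if "v < n" for v
  proof -
    have "(\<Sum>u\<in>D - {v}. (real (codeg \<Gamma> v u))\<^sup>2) \<le> 400 * real (card (D - {v})) * (p\<^sup>2 * m)\<^sup>2 + \<epsilon> / 100 * P2"
      using D that by (intro cod2) auto
    also have "\<dots> \<le> 400 * k * (p\<^sup>2 * m)\<^sup>2 + \<epsilon> / 100 * P2"
      using D by (intro add_right_mono mult_right_mono mult_left_mono) (auto simp: k_def intro: card_mono)
    also have "\<dots> = (400 * y + \<epsilon> / 100) * P2"
      by (simp add: y_def P2_def power2_eq_square algebra_simps)
    finally show ?thesis .
  qed
  have st: "real (card (stolen H)) \<le> 3 * c * m\<^sup>2"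
  proof -
    have "\<Gamma> \<subseteq> (\<Union>v<n. \<Gamma> \<inter> star n v)"
    proof
      fix e assume "e \<in> \<Gamma>"
      then have "e \<in> K" using \<Gamma>K by blast
      then have "card e = 2" "e \<subseteq> {..<n}" by (auto simp: complete_edges_def)
      then obtain v where "v \<in> e" "v < n" by (auto simp: card_2_iff)
      then show "e \<in> (\<Union>v<n. \<Gamma> \<inter> star n v)" using \<open>e \<in> \<Gamma>\<close> \<open>e \<in> K\<close> by (auto simp: star_def)
    qed
    then have "card \<Gamma> \<le> card (\<Union>v<n. \<Gamma> \<inter> star n v)" by (intro card_mono) (auto simp: finite_star)
    also have "\<dots> \<le> (\<Sum>v<n. card (\<Gamma> \<inter> star n v))" by (rule card_UN_le) simp
    also have "\<dots> = (\<Sum>v<n. card (N v))" using card_nbrs[OF \<Gamma>K] by (simp add: N_def)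
    finally have "real (card \<Gamma>) \<le> (\<Sum>v<n. real (card (N v)))" by (simp flip: of_nat_sum)
    also have "\<dots> \<le> (\<Sum>v<n. 3 * p * m)" using deg(2) by (intro sum_mono) simp
    also have "\<dots> = 3 * p * m\<^sup>2" by (simp add: m_def power2_eq_square)
    finally have e: "real (card \<Gamma>) \<le> 3 * p * m\<^sup>2" .
    have "card (maker_edges H \<inter> present H) \<le> card \<Gamma>"
      unfolding \<Gamma>_def using reachable_finite[OF H(1)] by (intro card_mono) auto
    then have "b * card (maker_edges H \<inter> present H) \<le> b * card \<Gamma>" by (rule mult_left_mono) simp
    then have "card (stolen H) \<le> b * card \<Gamma>" using card_stolen[OF H(1)] by linarith
    then have "real (card (stolen H)) \<le> real b * real (card \<Gamma>)" by (simp flip: of_nat_mult)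
    also have "\<dots> \<le> real b * (3 * p * m\<^sup>2)" using e by (intro mult_left_mono) auto
    also have "\<dots> = 3 * m\<^sup>2 * (real b * p)" by simp
    also have "\<dots> \<le> 3 * m\<^sup>2 * c" using c by (intro mult_left_mono) auto
    finally show ?thesis by (simp add: mult_ac)
  qed
  have \<theta>0: "\<theta> = \<epsilon> / 100 * P2" by (simp add: \<theta> P2_def m_def)
  have \<theta>_nonneg: "0 \<le> \<theta>" using P2 eps by (simp add: \<theta>0)
  \<comment> \<open>The bound of \<open>dangerous_count\<close> is \<open>y * (\<epsilon> / 100)\<^sup>2 \<le> 3 * c * (10 + 400 * y)\<close>; the term linear in \<open>y\<close> on the
    right is absorbed by the left-hand side because \<open>c\<close> is tiny compared with \<open>\<epsilon>\<^sup>2\<close>.\<close>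
  have y_small: "400 * y \<le> \<epsilon> / 1000"
  proof (cases "k = 0")
    case False
    have "(k * \<theta>)\<^sup>2 \<le> real (card (stolen H)) *
        (\<Sum>v\<in>D. (real (card (N v)))\<^sup>2 + (\<Sum>u\<in>D - {v}. (real (codeg \<Gamma> v u))\<^sup>2))"
      using dangerous_count[OF H(1) \<theta>_nonneg] by (simp add: D_def k_def N_def \<Gamma>_def)
    also have "\<dots> \<le> (3 * c * m\<^sup>2) * (\<Sum>v\<in>D. (10 + 400 * y) * P2)"
    proof (intro mult_mono st sum_mono)
      fix v assume "v \<in> D"
      then have v: "v < n" using D by auto
      have "(real (card (N v)))\<^sup>2 \<le> (3 * p * m)\<^sup>2" using deg(2)[OF v] by (intro power_mono) auto
      also have "\<dots> = 9 * P2" by (simp add: P2_def power_mult_distrib)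
      finally have "(real (card (N v)))\<^sup>2 + (\<Sum>u\<in>D - {v}. (real (codeg \<Gamma> v u))\<^sup>2) \<le> 9 * P2 + (400 * y + \<epsilon> / 100) * P2"
        using codD[OF v] by linarith
      also have "\<dots> \<le> (10 + 400 * y) * P2"
        using eps P2 by (simp add: algebra_simps)
      finally show "(real (card (N v)))\<^sup>2 + (\<Sum>u\<in>D - {v}. (real (codeg \<Gamma> v u))\<^sup>2) \<le> (10 + 400 * y) * P2" .
    qed (use c0 in \<open>auto intro!: sum_nonneg add_nonneg_nonneg\<close>)
    also have "\<dots> = k * (3 * c * m\<^sup>2 * (10 + 400 * y) * P2)" by (simp add: k_def)
    finally have "k * (k * \<theta>\<^sup>2) \<le> k * (3 * c * m\<^sup>2 * (10 + 400 * y) * P2)"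
      by (simp add: power2_eq_square mult_ac)
    then have "k * \<theta>\<^sup>2 \<le> 3 * c * m\<^sup>2 * (10 + 400 * y) * P2" using False k0 by simp
    moreover have "k * \<theta>\<^sup>2 = (m\<^sup>2 * P2) * (y * (\<epsilon> / 100)\<^sup>2)"
      by (simp add: \<theta>0 y_def P2_def power2_eq_square mult_ac)
    moreover have "3 * c * m\<^sup>2 * (10 + 400 * y) * P2 = (m\<^sup>2 * P2) * (3 * c * (10 + 400 * y))" by simp
    ultimately have "(m\<^sup>2 * P2) * (y * (\<epsilon> / 100)\<^sup>2) \<le> (m\<^sup>2 * P2) * (3 * c * (10 + 400 * y))" by linarith
    moreover have "0 < m\<^sup>2 * P2" using m P2 by simp
    ultimately have "y * (\<epsilon> / 100)\<^sup>2 \<le> 3 * c * (10 + 400 * y)" by (rule mult_left_le_imp_le)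
    then have main: "y * \<epsilon>\<^sup>2 / 10000 \<le> 30 * c + 1200 * c * y" by (simp add: power_divide algebra_simps)
    have y0: "0 \<le> y" using k0 by (simp add: y_def)
    have "c * y * 10 ^ 12 \<le> y * \<epsilon>\<^sup>2" using mult_left_mono[OF ce(2) y0] by (simp add: mult_ac)
    then have "y * \<epsilon>\<^sup>2 \<le> 600000 * c" using main c0 by simp
    also have "\<dots> \<le> (6 / 10 ^ 7) * \<epsilon> * \<epsilon>\<^sup>2" by (simp add: c power2_eq_square power3_eq_cube)
    finally have "y * \<epsilon>\<^sup>2 \<le> ((6 / 10 ^ 7) * \<epsilon>) * \<epsilon>\<^sup>2" .
    then have "y \<le> (6 / 10 ^ 7) * \<epsilon>" using eps by (simp only: mult_le_cancel_right) simp
    then show ?thesis using eps by simp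
  qed (use eps in \<open>simp add: y_def\<close>)

  have lost_in: "real (card {f \<in> stolen H \<inter> \<Gamma>. f \<subseteq> N v}) \<le> \<epsilon> / 20 * P3" if v: "v < n" for v
  proof -
    have L1: "0 < 3 * p * m" and L2: "0 \<le> 6 * (p\<^sup>2 * m) + t" using p m t by (simp_all add: add_nonneg_pos)
    have "real (card (pairs (N v))) \<le> (3 * p * m)\<^sup>2 / 2"
      using card_pairs_le[OF finN, of v] power_mono[OF deg(2)[OF v], of 2] by simp
    also have "\<dots> = 9 / 2 * P2" by (simp add: P2_def power_mult_distrib)
    finally have "2 * p * real (card (pairs (N v))) \<le> 2 * p * (9 / 2 * P2)"
      using p by (intro mult_left_mono) auto
    also have "\<dots> = 9 * (p * P2)" by simp
    finally have ind: "real (card (induced \<Gamma> (N v))) \<le> 9 * (p * P2) + t" using inner(2)[OF v] by linarith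

    have bp: "real b * (p * z) \<le> c * z" if "0 \<le> z" for z
      using mult_right_mono[OF c(2) that] by (simp add: mult_ac)
    have "real (card (stolen_in v H)) \<le> \<theta> + real b
       + 6 * real b * (real (card (induced \<Gamma> (N v))) + real (card (N v)) + lg)
       + (\<Sum>u\<in>D - {v}. (real (codeg \<Gamma> v u))\<^sup>2)"
      using card_stolen_in[OF H(1) \<theta>_nonneg v] by (simp add: \<Gamma>_def N_def lg_def D_def)
    also have "\<dots> \<le> \<epsilon> / 100 * P2 + real b + 6 * real b * ((9 * (p * P2) + t) + 3 * p * m + lg) + (400 * y + \<epsilon> / 100) * P2"
      using ind deg(2)[OF v] codD[OF v] unfolding \<theta>0 by (intro add_mono order_refl mult_left_mono) auto
    also have "\<dots> = \<epsilon> / 100 * P2 + real b * (1 + 6 * lg + 6 * t) + 54 * (real b * (p * P2)) + 18 * (real b * (p * m))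
        + (400 * y + \<epsilon> / 100) * P2"
      by (simp add: algebra_simps)
    also have "\<dots> \<le> \<epsilon> / 100 * P2 + c * P2 + 54 * (c * P2) + 18 * (c * P2) + (\<epsilon> / 1000 + \<epsilon> / 100) * P2"
    proof -
      have "real b * (p * m) \<le> c * P2" using m c0 by (intro order.trans[OF bp mult_left_mono[OF mP2]]) auto
      moreover have "(400 * y + \<epsilon> / 100) * P2 \<le> (\<epsilon> / 1000 + \<epsilon> / 100) * P2"
        using y_small P2 by (intro mult_right_mono) auto
      moreover have "real b * (1 + 6 * lg + 6 * t) \<le> c * P2" using A6 by (simp add: P2_def m_def)
      ultimately show ?thesis using bp[of P2] P2 by linarith
    qed
    also have "\<dots> = (21 / 1000 * \<epsilon> + 73 * c) * P2" by (simp add: algebra_simps)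
    also have "\<dots> \<le> (22 / 1000 * \<epsilon>) * P2" using ce(1) P2 c0 eps by (intro mult_right_mono) auto
    finally have s_in: "real (card (stolen_in v H)) \<le> (22 / 1000 * \<epsilon>) * P2" .

    have sumN: "(\<Sum>x\<in>N v. f x) \<le> 3 * p * m * B" if "\<And>x. x < n \<Longrightarrow> f x \<le> B" "0 \<le> B" for f :: "nat \<Rightarrow> real" and B
    proof -
      have "(\<Sum>x\<in>N v. f x) \<le> (\<Sum>x\<in>N v. B)" using Nn[of v] that(1) by (intro sum_mono) auto
      also have "\<dots> = real (card (N v)) * B" by simp
      also have "\<dots> \<le> 3 * p * m * B" using deg(2)[OF v] that(2) by (intro mult_right_mono)
      finally show ?thesis .
    qed

    let ?w2 = "\<lambda>H e. min (closing_weight v H e) (3 * p * m)"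
    let ?w4 = "\<lambda>H e. min (outer_weight v H e) (6 * (p\<^sup>2 * m) + t)"
    have "hit_sum (closing_weight v) H = hit_sum ?w2 H"
    proof (rule hit_sum_cong)
      fix H1 e x H2 assume h: "H = H1 @ Coin e x # H2"
      have "closing_weight v H1 e \<le> real (card (N v))"
        using closing_weight_le[OF H(1) h] by (simp add: N_def \<Gamma>_def)
      also note deg(2)[OF v]
      finally show "closing_weight v H1 e = min (closing_weight v H1 e) (3 * p * m)" by simp
    qed
    also have "\<dots> \<le> 2 * p * flip_sum ?w2 H + t * (3 * p * m)"
      using con v by (simp add: concentrated_def tail_bound_def m_def)
    also have "\<dots> \<le> 2 * p * (3 * p * m * (19 * c * m)) + (c * (p * m)) * (p * m)"
    proof (intro add_mono mult_left_mono)
      have "flip_sum ?w2 H \<le> (\<Sum>x\<in>N v. real (card {f \<in> stolen H. x \<in> f}))"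
        using flips_le(1)[OF H(1)] by (simp add: N_def \<Gamma>_def)
      also have "\<dots> \<le> 3 * p * m * (19 * c * m)" using d c0 m by (intro sumN) auto
      finally show "flip_sum ?w2 H \<le> 3 * p * m * (19 * c * m)" .
      show "t * (3 * p * m) \<le> c * (p * m) * (p * m)"
        using mult_right_mono[OF A1, of "p * m"] pm by (simp add: m_def mult_ac)
    qed (use p in auto)
    also have "\<dots> = 115 * c * P2" by (simp add: P2_def power2_eq_square algebra_simps)
    finally have X2: "hit_sum (closing_weight v) H \<le> 115 * c * P2" .

    have "real (card {f \<in> stolen H. f \<subseteq> N v}) \<le> real (card (stolen_in v H)) + hit_sum (closing_weight v) H"
      using stolen_in_nbrs[OF H(1)] by (simp add: N_def \<Gamma>_def)
    also have "\<dots> \<le> (22 / 1000 * \<epsilon> + 115 * c) * P2" using s_in X2 by (simp add: algebra_simps)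
    also have "\<dots> \<le> (23 / 1000 * \<epsilon>) * P2" using ce(1) P2 c0 eps by (intro mult_right_mono) auto
    finally have N3: "real (card {f \<in> stolen H. f \<subseteq> N v}) \<le> (23 / 1000 * \<epsilon>) * P2" .

    have "hit_sum (inner_weight v) H \<le> 2 * p * flip_sum (inner_weight v) H + t"
      using con v by (simp add: concentrated_def tail_bound_def)
    also have "\<dots> \<le> 2 * p * ((23 / 1000 * \<epsilon>) * P2) + c * P3"
    proof (intro add_mono mult_left_mono)
      show "flip_sum (inner_weight v) H \<le> (23 / 1000 * \<epsilon>) * P2"
        using flips_inner[OF H(1), of v] N3 by (simp add: N_def \<Gamma>_def)
      show "t \<le> c * P3" using A4 by (simp add: P3_def m_def)
    qed (use p in auto)
    also have "\<dots> = (46 / 1000 * \<epsilon> + c) * P3" by (simp add: algebra_simps flip: P23)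
    finally have X3: "hit_sum (inner_weight v) H \<le> (46 / 1000 * \<epsilon> + c) * P3" .

    have "hit_sum (outer_weight v) H = hit_sum ?w4 H"
    proof (rule hit_sum_cong)
      fix H1 e x H2 assume h: "H = H1 @ Coin e x # H2"
      then have "e \<in> exposed H" by (auto simp: exposed_def)
      then have "e \<in> K" using reachable_subset[OF H(1)] by blast
      then have "outer_weight v H1 e \<le> 6 * (p\<^sup>2 * m) + t"
        using cod[OF v] L2 by (intro outer_weight_le[OF H(1) h]) (auto simp: \<Gamma>_def)
      then show "outer_weight v H1 e = min (outer_weight v H1 e) (6 * (p\<^sup>2 * m) + t)" by simp
    qed
    also have "\<dots> \<le> 2 * p * flip_sum ?w4 H + t * (6 * (p\<^sup>2 * m) + t)"
      using con v by (simp add: concentrated_def tail_bound_def m_def)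
    also have "\<dots> \<le> 2 * p * (3 * p * m * (39 * c * (p * m))) + c * P3"
    proof (intro add_mono mult_left_mono)
      have "flip_sum ?w4 H \<le> (\<Sum>x\<in>N v. real (card {f \<in> stolen H \<inter> \<Gamma>. x \<in> f}))"
        using flips_le(2)[OF H(1)] by (simp add: N_def \<Gamma>_def)
      also have "\<dots> \<le> 3 * p * m * (39 * c * (p * m))" using lost c0 pm by (intro sumN) auto
      finally show "flip_sum ?w4 H \<le> 3 * p * m * (39 * c * (p * m))" .
      show "t * (6 * (p\<^sup>2 * m) + t) \<le> c * P3" using A5 by (simp add: P3_def m_def)
    qed (use p in auto)
    also have "\<dots> = 235 * c * P3" by (simp add: P3_def power2_eq_square power3_eq_cube algebra_simps)
    finally have X4: "hit_sum (outer_weight v) H \<le> 235 * c * P3" .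

    have "real (card {f \<in> stolen H \<inter> \<Gamma>. f \<subseteq> N v}) \<le> hit_sum (inner_weight v) H + hit_sum (outer_weight v) H"
      using lost_in_nbrs[OF H(1)] by (simp add: N_def \<Gamma>_def)
    also have "\<dots> \<le> (46 / 1000 * \<epsilon> + 236 * c) * P3" using X3 X4 by (simp add: algebra_simps)
    also have "\<dots> \<le> \<epsilon> / 20 * P3" using ce(1) P3 c0 eps by (intro mult_right_mono) auto
    finally show ?thesis .
  qed

  have lostG: "\<Gamma> - G \<subseteq> stolen H" using lost_stolen[OF H] by (auto simp: \<Gamma>_def G_def)
  have finst: "finite (stolen H)" using reachable_finite[OF H(1)] by simp
  have n1: "(1 - \<epsilon> / 10) * m \<le> m - 1" using A8 by (simp add: m_def algebra_simps)
  have prod2: "(1 - \<epsilon> / 5) * (p * m) \<le> (1 - \<epsilon> / 10) * p * (m - 1)"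
  proof -
    have "(1 - \<epsilon> / 5) \<le> (1 - \<epsilon> / 10) * (1 - \<epsilon> / 10)" by (simp add: algebra_simps)
    then have "(1 - \<epsilon> / 5) * (p * m) \<le> ((1 - \<epsilon> / 10) * (1 - \<epsilon> / 10)) * (p * m)"
      using pm by (intro mult_right_mono) auto
    also have "\<dots> = ((1 - \<epsilon> / 10) * p) * ((1 - \<epsilon> / 10) * m)" by simp
    also have "\<dots> \<le> ((1 - \<epsilon> / 10) * p) * (m - 1)" using n1 eps p by (intro mult_left_mono) auto
    finally show ?thesis .
  qed

  have degG: "(1 - \<epsilon>) * p * m \<le> real (card (nbrs G v))" if v: "v < n" for v
  proof -
    have GK: "G \<subseteq> K" using \<Gamma>K by (auto simp: G_def)
    have "\<Gamma> \<inter> star n v \<subseteq> (G \<inter> star n v) \<union> {f \<in> stolen H \<inter> \<Gamma>. v \<in> f}"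
      using lostG by (auto simp: star_def)
    then have "card (\<Gamma> \<inter> star n v) \<le> card ((G \<inter> star n v) \<union> {f \<in> stolen H \<inter> \<Gamma>. v \<in> f})"
      using finst by (intro card_mono) (auto simp: finite_star)
    also have "\<dots> \<le> card (G \<inter> star n v) + card {f \<in> stolen H \<inter> \<Gamma>. v \<in> f}" by (rule card_Un_le)
    finally have "real (card (N v)) \<le> real (card (nbrs G v)) + real (card {f \<in> stolen H \<inter> \<Gamma>. v \<in> f})"
      by (simp add: N_def card_nbrs[OF \<Gamma>K v] card_nbrs[OF GK v])
    then have "real (card (nbrs G v)) \<ge> (1 - \<epsilon> / 5) * (p * m) - 39 * c * (p * m)"
      using lost[OF v] deg(1)[OF v] prod2 by linarith
    also have "(1 - \<epsilon> / 5) * (p * m) - 39 * c * (p * m) = (1 - \<epsilon> / 5 - 39 * c) * (p * m)" by (simp add: algebra_simps)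
    moreover have "(1 - \<epsilon>) * (p * m) \<le> (1 - \<epsilon> / 5 - 39 * c) * (p * m)"
      using ce(1) pm c0 eps by (intro mult_right_mono) auto
    ultimately show ?thesis by (simp add: mult.assoc)
  qed
  have "min_degree n G \<in> (\<lambda>v. card (nbrs G v)) ` {..<n}"
    unfolding min_degree_def using n by (intro Min_in) auto
  then have mindeg: "(1 - \<epsilon>) * p * m \<le> real (min_degree n G)" using degG by auto

  have indG: "(1 - \<epsilon>) * (P3 / 2) \<le> real (card (induced G (N v)))" if v: "v < n" for v
  proof -
    have "induced \<Gamma> (N v) \<subseteq> induced G (N v) \<union> {f \<in> stolen H \<inter> \<Gamma>. f \<subseteq> N v}"
      using lostG by (auto simp: induced_def)
    moreover have "finite (induced G (N v))"
      using \<Gamma>K finite_complete_edges by (auto simp: induced_def G_def intro: finite_subset)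
    ultimately have "card (induced \<Gamma> (N v)) \<le> card (induced G (N v) \<union> {f \<in> stolen H \<inter> \<Gamma>. f \<subseteq> N v})"
      using finst by (intro card_mono) auto
    also have "\<dots> \<le> card (induced G (N v)) + card {f \<in> stolen H \<inter> \<Gamma>. f \<subseteq> N v}" by (rule card_Un_le)
    finally have 1: "real (card (induced \<Gamma> (N v))) \<le> real (card (induced G (N v))) + \<epsilon> / 20 * P3"
      using lost_in[OF v] by linarith
    define s where "s = real (card (N v))"
    have s: "(1 - \<epsilon> / 5) * (p * m) \<le> s" using deg(1)[OF v] prod2 by (simp add: s_def)
    have "(1 - 3 * \<epsilon> / 10) * (p * m) = (1 - \<epsilon> / 5) * (p * m) - \<epsilon> * (p * m) / 10" by (simp add: algebra_simps)
    then have s1: "(1 - 3 * \<epsilon> / 10) * (p * m) \<le> s - 1" using s A9 by (simp add: m_def)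
    have "((1 - \<epsilon> / 5) * (p * m)) * ((1 - 3 * \<epsilon> / 10) * (p * m)) \<le> s * (s - 1)"
      using s s1 eps pm by (intro mult_mono) (auto simp: s_def)
    then have "((1 - \<epsilon> / 10) * p / 2) * (((1 - \<epsilon> / 5) * (p * m)) * ((1 - 3 * \<epsilon> / 10) * (p * m)))
        \<le> ((1 - \<epsilon> / 10) * p / 2) * (s * (s - 1))"
      using eps p by (intro mult_left_mono) auto
    also have "\<dots> = (1 - \<epsilon> / 10) * p * real (card (pairs (N v)))"
      by (simp add: card_pairs_real finN s_def)
    also have "\<dots> \<le> real (card (induced \<Gamma> (N v)))" using inner(1)[OF v] .
    finally have "((1 - \<epsilon> / 10) * (1 - \<epsilon> / 5) * (1 - 3 * \<epsilon> / 10)) * (P3 / 2) \<le> real (card (induced \<Gamma> (N v)))"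
      by (simp add: P3_def power2_eq_square power3_eq_cube mult_ac)
    moreover have "(1 - 6 * \<epsilon> / 10) * (P3 / 2) \<le> ((1 - \<epsilon> / 10) * (1 - \<epsilon> / 5) * (1 - 3 * \<epsilon> / 10)) * (P3 / 2)"
    proof (rule mult_right_mono)
      have "\<epsilon>\<^sup>2 * \<epsilon> \<le> \<epsilon>\<^sup>2 * 1" using eps by (intro mult_left_mono) auto
      moreover have "(1 - \<epsilon> / 10) * (1 - \<epsilon> / 5) * (1 - 3 * \<epsilon> / 10) = 1 - 6 * \<epsilon> / 10 + 11 / 100 * \<epsilon>\<^sup>2 - 6 / 1000 * (\<epsilon>\<^sup>2 * \<epsilon>)"
        by (simp add: power2_eq_square algebra_simps)
      ultimately show "1 - 6 * \<epsilon> / 10 \<le> (1 - \<epsilon> / 10) * (1 - \<epsilon> / 5) * (1 - 3 * \<epsilon> / 10)"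
        using zero_le_power2[of \<epsilon>] by linarith
    qed (use P3 in simp)
    ultimately have "(1 - 6 * \<epsilon> / 10) * (P3 / 2) - \<epsilon> / 20 * P3 \<le> real (card (induced G (N v)))" using 1 by linarith
    moreover have "(1 - 6 * \<epsilon> / 10) * (P3 / 2) - \<epsilon> / 20 * P3 = (1 - \<epsilon>) * (P3 / 2) + 3 / 20 * (\<epsilon> * P3)"
      by (simp add: field_simps)
    moreover have "0 \<le> \<epsilon> * P3" using eps P3 by simp
    ultimately show ?thesis by linarith
  qed
  show ?thesis using mindeg indG by (simp add: G_def \<Gamma>_def N_def m_def P3_def)
qed

end

section \<open>Asymptotics\<close>

text \<open>All lower bounds on \<open>n\<close> that the estimates need, in terms of \<open>\<epsilon>\<close> only. The estimates for a given \<open>p\<close> are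
  reduced to them by means of \<open>q = p * sqrt n \<ge> 1\<close>, a power of which appears on the side that has to be
  large. With \<open>t = 4 ln n\<close> each of the \<open>O(n\<^sup>2)\<close> bad events has probability at most \<open>n\<^sup>-\<^sup>4\<close>.\<close>

definition large :: "real \<Rightarrow> nat \<Rightarrow> bool" where
  "large \<epsilon> n \<longleftrightarrow> (let c = \<epsilon> ^ 3 / 10 ^ 12; s = sqrt (real n); t = 4 * ln (real n) in
     3 * t \<le> c * s \<and> 12 * t \<le> c * s \<and> 2 * t\<^sup>2 \<le> c * s \<and> 1 + 6 * ln (4 * real n) + 6 * t \<le> s \<and>
     6 * (1 + ln (4 * real n)) \<le> s \<and> t \<le> (\<epsilon> / 10)\<^sup>2 * s / 40 \<and> 2500 * t ^ 3 \<le> \<epsilon> * real n \<and>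
     3750 * t\<^sup>2 \<le> \<epsilon> * s \<and> 10 \<le> \<epsilon> * s \<and> 10 \<le> s \<and> 0 < t)"

lemma eventually_large:
  assumes "0 < \<epsilon>"
  shows "\<forall>\<^sub>F n in sequentially. large \<epsilon> n"
proof -
  have c: "0 < \<epsilon> ^ 3 / 10 ^ 12" "0 < (\<epsilon> / 10)\<^sup>2 / 40" using assms by simp_all
  have 1: "\<forall>\<^sub>F n in sequentially. 3 * (4 * ln (real n)) \<le> c * sqrt (real n)" if "0 < c" for c
    using that by real_asymp
  have 2: "\<forall>\<^sub>F n in sequentially. 12 * (4 * ln (real n)) \<le> c * sqrt (real n)" if "0 < c" for c
    using that by real_asymp
  have 3: "\<forall>\<^sub>F n in sequentially. 2 * (4 * ln (real n))\<^sup>2 \<le> c * sqrt (real n)" if "0 < c" for c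
    using that by real_asymp
  have 4: "\<forall>\<^sub>F n in sequentially. 1 + 6 * ln (4 * real n) + 6 * (4 * ln (real n)) \<le> sqrt (real n)"
    by real_asymp
  have 5: "\<forall>\<^sub>F n in sequentially. 6 * (1 + ln (4 * real n)) \<le> sqrt (real n)"
    by real_asymp
  have 6: "\<forall>\<^sub>F n in sequentially. 4 * ln (real n) \<le> c * sqrt (real n)" if "0 < c" for c
    using that by real_asymp
  have 7: "\<forall>\<^sub>F n in sequentially. 2500 * (4 * ln (real n)) ^ 3 \<le> \<epsilon> * real n"
    using assms by real_asymp
  have 8: "\<forall>\<^sub>F n in sequentially. 3750 * (4 * ln (real n))\<^sup>2 \<le> \<epsilon> * sqrt (real n)"
    using assms by real_asymp
  have 9: "\<forall>\<^sub>F n in sequentially. 10 \<le> \<epsilon> * sqrt (real n)"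
    using assms by real_asymp
  have 10: "\<forall>\<^sub>F n in sequentially. 10 \<le> sqrt (real n)"
    by real_asymp
  have 11: "\<forall>\<^sub>F n in sequentially. 0 < 4 * ln (real n)"
    by real_asymp
  show ?thesis
    using 1[OF c(1)] 2[OF c(1)] 3[OF c(1)] 4 5 6[OF c(2)] 7 8 9 10 11
    by eventually_elim (simp add: large_def Let_def mult_ac)
qed

context
  fixes \<epsilon> p :: real and n b :: nat
  assumes eps: "0 < \<epsilon>" "\<epsilon> < 1" and p: "p \<le> 1" "10 ^ 8 / \<epsilon>\<^sup>2 \<le> p * sqrt (real n)"
    and b: "real b * p \<le> \<epsilon> ^ 3 / 10 ^ 12" and large: "large \<epsilon> n"
begin

lemma outcome_probability:
  assumes \<tau>: "legal_breaker n b \<tau>"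
  defines "\<theta> \<equiv> \<epsilon> / 100 * (p\<^sup>2 * (real n)\<^sup>2)"
  shows "measure_pmf.prob (game n p (\<lambda>H. return_pmf (strategy.act n b \<theta> H)) \<tau>)
      {(M, \<Gamma>). \<exists>G. G \<subseteq> \<Gamma> \<and> G \<subseteq> M \<and>
         real (min_degree n G) \<ge> (1 - \<epsilon>) * p * real n \<and>
         (\<forall>v<n. real (card (induced G (nbrs \<Gamma> v))) \<ge> (1 - \<epsilon>) * (p ^ 3 * real n ^ 2 / 2))}
    \<ge> 1 - real n * (real n + 9) * exp (- (4 * ln (real n)))"
    (is "measure_pmf.prob _ ?S \<ge> _")
proof -
  interpret play n b \<theta> \<tau> by unfold_locales (rule \<tau>)
  define c where "c = \<epsilon> ^ 3 / 10 ^ 12"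
  define s where "s = sqrt (real n)"
  define t where "t = 4 * ln (real n)"
  define q where "q = p * s"
  define lg where "lg = ln (4 * real n)"
  have E: "3 * t \<le> c * s" "12 * t \<le> c * s" "2 * t\<^sup>2 \<le> c * s" "1 + 6 * lg + 6 * t \<le> s"
     "6 * (1 + lg) \<le> s" "t \<le> (\<epsilon> / 10)\<^sup>2 * s / 40" "2500 * t ^ 3 \<le> \<epsilon> * real n"
     "3750 * t\<^sup>2 \<le> \<epsilon> * s" "10 \<le> \<epsilon> * s" "10 \<le> s" and t: "0 < t"
    using large by (simp_all add: large_def Let_def c_def s_def t_def lg_def)
  have n: "real n = s * s" "0 < s" "0 < n" using E(10) by (auto simp: s_def intro: Nat.gr0I)
  have c: "0 < c" "c \<le> 1" using eps power_le_one[of \<epsilon> 3] by (simp_all add: c_def)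
  have "\<epsilon>\<^sup>2 \<le> 1" "\<epsilon>\<^sup>2 \<le> \<epsilon>" using eps by (simp_all add: power2_eq_square mult_le_one)
  then have "10 ^ 8 / 1 \<le> 10 ^ 8 / \<epsilon>\<^sup>2" "10 ^ 8 / \<epsilon> \<le> 10 ^ 8 / \<epsilon>\<^sup>2"
    using eps by (intro divide_left_mono; simp)+
  then have q: "10 ^ 8 \<le> q" "10 ^ 8 / \<epsilon> \<le> q" using p(2) by (simp_all add: q_def s_def)
  then have q1: "1 \<le> q" and eq: "10 ^ 8 \<le> \<epsilon> * q" using eps by (simp_all add: divide_simps mult_ac)
  have q2: "1 \<le> q\<^sup>2" "1 \<le> q ^ 3" "q \<le> q\<^sup>2" "q\<^sup>2 \<le> q ^ 3" using q1
    by (simp_all add: power2_eq_square power3_eq_cube mult_ge1_I)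
  have p0: "0 < p" using q1 n(2) by (metis q_def less_le_trans zero_less_one zero_less_mult_pos2)
  have pn: "p * real n = q * s" "p\<^sup>2 * real n = q\<^sup>2" "p\<^sup>2 * (real n)\<^sup>2 = q\<^sup>2 * real n" "p ^ 3 * (real n)\<^sup>2 = q ^ 3 * s"
    by (simp_all add: q_def n(1) power2_eq_square power3_eq_cube)
  have bc: "real b \<le> c * s"
  proof -
    have "real b * p \<le> c * 1" using b by (simp add: c_def)
    also have "\<dots> \<le> c * q" using q1 c by (intro mult_left_mono) auto
    also have "\<dots> = (c * s) * p" by (simp add: q_def)
    finally show ?thesis using p0 by simp
  qed
  have big: "x \<le> a * s \<Longrightarrow> 0 \<le> a \<Longrightarrow> x \<le> a * (q * s)" "x \<le> a * s \<Longrightarrow> 0 \<le> a \<Longrightarrow> x \<le> a * (q ^ 3 * s)" for x a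
    using mult_left_mono[OF mult_right_mono[OF q1, of s], of a] mult_left_mono[OF mult_right_mono[OF q2(2), of s], of a] n(2)
    by simp_all
  have n2: "real n / 2 \<le> real n - 1"
  proof -
    have "10 * 10 \<le> s * s" using E(10) by (intro mult_mono) auto
    then show ?thesis by (simp add: n(1))
  qed
  have pn2: "q * s / 2 \<le> p * (real n - 1)" using mult_left_mono[OF n2, of p] p0 pn(1) by simp
  have "c * s \<le> 1 * s" using c n(2) by (intro mult_right_mono) auto
  then have ts: "t \<le> s" using E(1) t by linarith

  have pseudo: "measure_pmf.prob (gnp n p) {\<Gamma>. \<not> pseudorandom n p \<epsilon> t \<Gamma>} \<le> real n * ((real n + 5) * exp (- t))"
  proof (rule prob_pseudorandom)
    show "t \<le> p * real n" using big(1)[of t 1] ts by (simp add: pn)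
    have "(\<epsilon> / 10)\<^sup>2 / 4 * (q * s) \<le> (\<epsilon> / 10)\<^sup>2 / 2 * (p * (real n - 1))"
      using mult_left_mono[OF pn2, of "(\<epsilon> / 10)\<^sup>2 / 2"] by simp
    moreover have "0 \<le> (\<epsilon> / 10)\<^sup>2 * s" using n(2) by simp
    then have "t \<le> (\<epsilon> / 10)\<^sup>2 / 4 * s" using E(6) by simp
    then have "t \<le> (\<epsilon> / 10)\<^sup>2 / 4 * (q * s)" by (intro big(1)) auto
    ultimately show "t \<le> (\<epsilon> / 10)\<^sup>2 * p * (real n - 1) / 2" by (simp add: mult_ac)
    show "t \<le> (\<epsilon> / 10)\<^sup>2 * p * (x * (x - 1) / 2) / 2" if x: "(1 - \<epsilon> / 10) * p * (real n - 1) \<le> x" for x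
    proof -
      have "(9 / 10) * (q * s / 2) \<le> (1 - \<epsilon> / 10) * (p * (real n - 1))"
        using pn2 eps q1 n(2) by (intro mult_mono) auto
      also have "\<dots> \<le> x" using x by (simp only: mult.assoc)
      finally have x1: "9 / 20 * (q * s) \<le> x" by simp
      have qs: "10 \<le> q * s" using mult_mono[OF q1 E(10)] q1 by simp
      then have x2: "9 / 40 * (q * s) \<le> x - 1" using x1 by linarith
      have "(9 / 20 * (q * s)) * (9 / 40 * (q * s)) \<le> x * (x - 1)"
        using x1 x2 qs by (intro mult_mono) auto
      moreover have "(9 / 20 * (q * s)) * (9 / 40 * (q * s)) = 81 / 800 * ((q * s) * (q * s))" by simp
      moreover have "0 \<le> (q * s) * (q * s)" by (rule zero_le_square)
      ultimately have "1 / 10 * ((q * s) * (q * s)) \<le> x * (x - 1)" by linarith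
      then have "(\<epsilon> / 10)\<^sup>2 * p / 4 * (1 / 10 * ((q * s) * (q * s))) \<le> (\<epsilon> / 10)\<^sup>2 * p / 4 * (x * (x - 1))"
        using p0 by (intro mult_left_mono) auto
      moreover have "(\<epsilon> / 10)\<^sup>2 * p / 4 * (1 / 10 * ((q * s) * (q * s))) = (\<epsilon> / 10)\<^sup>2 / 40 * (q ^ 3 * s)"
        by (simp add: q_def power3_eq_cube)
      moreover have "t \<le> (\<epsilon> / 10)\<^sup>2 / 40 * (q ^ 3 * s)" using E(6) by (intro big(2)) auto
      moreover have "(\<epsilon> / 10)\<^sup>2 * p / 4 * (x * (x - 1)) = (\<epsilon> / 10)\<^sup>2 * p * (x * (x - 1) / 2) / 2" by simp
      ultimately show ?thesis by linarith
    qed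
    have "8 * exp (- 4 * q\<^sup>2) \<le> 8 * 1" by (intro mult_left_mono) auto
    also have "\<dots> \<le> \<epsilon> / 200 * q" using eq by simp
    also have "\<dots> \<le> \<epsilon> / 200 * q\<^sup>2" using q2 eps by (intro mult_left_mono) auto
    finally show "8 * exp (- 4 * (p\<^sup>2 * real n)) \<le> \<epsilon> / 200 * (p\<^sup>2 * real n)" by (simp add: pn)
    have "2500 * t ^ 3 * 1 \<le> (\<epsilon> * real n) * q\<^sup>2" using eps by (intro mult_mono[OF E(7) q2(1)]) auto
    then show "t \<le> \<epsilon> / 200 * (p\<^sup>2 * real n) * real n / (2 * (5 / 2 * t)\<^sup>2)"
      unfolding pn using t by (simp add: field_simps power2_eq_square power3_eq_cube)
    have "3750 * t\<^sup>2 \<le> \<epsilon> * (q * s)" using E(8) eps by (intro big(1)) auto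
    then have "(q * s) * (3750 * t\<^sup>2) \<le> (q * s) * (\<epsilon> * (q * s))" using q1 n(2) by (intro mult_left_mono) auto
    moreover have "3 * (p * real n) * (5 / 2 * t)\<^sup>2 = (q * s) * (3750 * t\<^sup>2) / 200"
      unfolding pn by (simp add: power2_eq_square)
    moreover have "\<epsilon> / 200 * (p\<^sup>2 * real n) * real n = (q * s) * (\<epsilon> * (q * s)) / 200"
      unfolding pn by (simp add: n(1) power2_eq_square)
    ultimately have "3 * (p * real n) * (5 / 2 * t)\<^sup>2 \<le> \<epsilon> / 200 * (p\<^sup>2 * real n) * real n" by linarith
    then show "3 * p * real n * (5 / 2 * t)\<^sup>2 \<le> \<epsilon> / 200 * (p\<^sup>2 * real n) * real n" by (simp only: mult.assoc)
  qed (use p0 p eps t in auto)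

  define S where "S = ?S"
  have good: "(M, \<Gamma>) \<in> S"
    if G: "\<Gamma> \<subseteq> K" "pseudorandom n p \<epsilon> t \<Gamma>" "concentrated p t (history \<Gamma> duration)" "M = maker_edges (history \<Gamma> duration)" for M \<Gamma>
  proof -
    let ?H = "history \<Gamma> duration"
    have pr: "present ?H = \<Gamma>" using history_present[of \<Gamma> duration] over_history[of \<Gamma>] G(1) by (auto simp: over_def)
    have "(1 - \<epsilon>) * p * real n \<le> real (min_degree n (present ?H \<inter> maker_edges ?H)) \<and>
     (\<forall>v<n. (1 - \<epsilon>) * (p ^ 3 * (real n)\<^sup>2 / 2)
        \<le> real (card (induced (present ?H \<inter> maker_edges ?H) (nbrs (present ?H) v))))"
    proof (rule good_outcome[where t = t and c = c])
      show "3 * t \<le> c * (p * real n)" using big(1)[OF E(1)] c by (simp add: pn)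
      have "6 * real b * (1 + lg) = real b * (6 * (1 + lg))" by simp
      also have "\<dots> \<le> (c * s) * s" using bc E(5) c n(2) by (intro order.trans[OF mult_left_mono mult_right_mono]) auto
      finally show "6 * real b * (1 + ln (4 * real n)) \<le> c * real n" by (simp add: n(1) lg_def)
      have "t \<le> c * s" using E(1) t by simp
      then show "t \<le> c * (p ^ 3 * (real n)\<^sup>2)" using big(2)[of t c] c by (simp add: pn)
      have "(12 * t) * q\<^sup>2 \<le> (c * s) * q ^ 3" using c n(2) by (intro mult_mono[OF E(2) q2(4)]) auto
      moreover have "2 * t\<^sup>2 \<le> c * (q ^ 3 * s)" using E(3) c by (intro big(2)) auto
      ultimately show "t * (6 * (p\<^sup>2 * real n) + t) \<le> c * (p ^ 3 * (real n)\<^sup>2)"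
        unfolding pn by (simp add: algebra_simps power2_eq_square)
      have "real b * (1 + 6 * lg + 6 * t) \<le> (c * s) * s"
        using bc E(4) c n(2) by (intro order.trans[OF mult_left_mono mult_right_mono]) auto
      also have "\<dots> = (c * real n) * 1" by (simp add: n(1))
      also have "\<dots> \<le> (c * real n) * q\<^sup>2" using q2 c by (intro mult_left_mono) auto
      finally show "real b * (1 + 6 * ln (4 * real n) + 6 * t) \<le> c * (p\<^sup>2 * (real n)\<^sup>2)"
        unfolding pn lg_def by (simp add: mult_ac)
      show "1 \<le> p\<^sup>2 * real n" using q2 by (simp add: pn)
      have "10 * 1 \<le> (\<epsilon> * s) * s" using E(10) n(2) eps by (intro mult_mono[OF E(9)]) auto
      then show "10 \<le> \<epsilon> * real n" by (simp add: n(1))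
      show "10 \<le> \<epsilon> * (p * real n)" using big(1)[OF E(9)] eps by (simp add: pn)
    qed (use G pr p0 p eps t n b reachable_history over_history in \<open>auto simp: \<theta>_def c_def\<close>)
    then show ?thesis unfolding pr S_def G(4) by (auto intro!: exI[of _ "\<Gamma> \<inter> maker_edges ?H"])
  qed

  let ?T = "\<lambda>\<Gamma>. (maker_edges (history \<Gamma> duration), \<Gamma>) \<in> S"
  have "measure_pmf.prob (gnp n p) {\<Gamma>. \<not> ?T \<Gamma>}
    \<le> measure_pmf.prob (gnp n p) {\<Gamma>. \<not> pseudorandom n p \<epsilon> t \<Gamma> \<or> \<not> concentrated p t (history \<Gamma> duration)}"
    unfolding gnp_def using good by (intro prob_mono_on finite_complete_edges) blast
  also have "\<dots> \<le> real n * ((real n + 5) * exp (- t)) + real n * (4 * exp (- t))"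
    using p0 p t n by (intro order.trans[OF prob_disj] add_mono pseudo prob_not_concentrated) auto
  also have "\<dots> = real n * (real n + 9) * exp (- t)" by (simp add: algebra_simps)
  finally have bad: "measure_pmf.prob (gnp n p) {\<Gamma>. \<not> ?T \<Gamma>} \<le> real n * (real n + 9) * exp (- t)" .
  have "measure_pmf.prob (game n p (\<lambda>H. return_pmf (act H)) \<tau>) S = measure_pmf.prob (gnp n p) {\<Gamma>. ?T \<Gamma>}"
    unfolding game_coupling by (simp add: vimage_def)
  also have "\<dots> = 1 - measure_pmf.prob (gnp n p) (UNIV - {\<Gamma>. ?T \<Gamma>})"
    using measure_pmf.prob_compl[of "{\<Gamma>. ?T \<Gamma>}" "gnp n p"] by simp
  also have "UNIV - {\<Gamma>. ?T \<Gamma>} = {\<Gamma>. \<not> ?T \<Gamma>}" by auto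
  finally show ?thesis using bad unfolding S_def t_def by linarith
qed

end

lemma powr_bound:
  shows "0 < \<epsilon> \<Longrightarrow> 10 ^ 8 * \<epsilon> powr (-2) * real n powr (-1/2) = 10 ^ 8 / \<epsilon>\<^sup>2 / sqrt (real n)"
    and "10 powr (-24) = (1 / 10 ^ 24 :: real)"
proof -
  assume "0 < \<epsilon>"
  then have "\<epsilon> powr (-2) = 1 / \<epsilon>\<^sup>2" using powr_minus_divide[of \<epsilon> 2] by simp
  moreover have "real n powr (-1/2) = 1 / sqrt (real n)"
    using powr_minus_divide[of "real n" "1/2"] powr_half_sqrt[of "real n"] by simp
  ultimately show "10 ^ 8 * \<epsilon> powr (-2) * real n powr (-1/2) = 10 ^ 8 / \<epsilon>\<^sup>2 / sqrt (real n)" by simp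
next
  show "10 powr (-24) = (1 / 10 ^ 24 :: real)" using powr_minus_divide[of "10::real" 24] by simp
qed

theorem theorem1p2:
  fixes \<epsilon> :: real and p :: "nat \<Rightarrow> real" and b :: "nat \<Rightarrow> nat"
  assumes "0 < \<epsilon>" and "\<epsilon> < 1"
    and "\<forall>\<^sub>F n in sequentially.
           0 \<le> p n \<and> p n \<le> 1 \<and>
           p n \<ge> 10 ^ 8 * \<epsilon> powr (-2) * real n powr (-1/2) \<and>
           real (b n) \<le> 10 powr (-24) * \<epsilon> ^ 6 * inverse (p n)"
  shows "\<exists>\<sigma> :: nat \<Rightarrow> maker_strategy.
           (\<forall>n. legal_maker n (\<sigma> n)) \<and>
           (\<forall>\<tau> :: nat \<Rightarrow> breaker_strategy.
              (\<forall>n. legal_breaker n (b n) (\<tau> n)) \<longrightarrow>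
              (\<forall>n. 0 \<le> p n \<and> p n \<le> 1 \<longrightarrow>
                 map_pmf snd (game n (p n) (\<sigma> n) (\<tau> n)) = gnp n (p n)) \<and>
              (\<lambda>n. measure_pmf.prob (game n (p n) (\<sigma> n) (\<tau> n))
                 {(M, \<Gamma>). \<exists>G. G \<subseteq> \<Gamma> \<and> G \<subseteq> M \<and>
                    real (min_degree n G) \<ge> (1 - \<epsilon>) * p n * real n \<and>
                    (\<forall>v<n. real (card (induced G (nbrs \<Gamma> v)))
                              \<ge> (1 - \<epsilon>) * (p n ^ 3 * real n ^ 2 / 2))})
                \<longlonglongrightarrow> 1)"
proof -
  define \<theta> where "\<theta> = (\<lambda>n. \<epsilon> / 100 * ((p n)\<^sup>2 * (real n)\<^sup>2))"
  define \<sigma> where "\<sigma> = (\<lambda>n H. return_pmf (strategy.act n (b n) (\<theta> n) H))"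
  have legal: "legal_maker n (\<sigma> n)" for n
    unfolding \<sigma>_def by (rule strategy.legal_maker)
  have marginal: "map_pmf snd (game n (p n) (\<sigma> n) \<tau>) = gnp n (p n)" if "legal_breaker n (b n) \<tau>" for n \<tau>
  proof -
    interpret play n "b n" "\<theta> n" \<tau> by unfold_locales (rule that)
    show ?thesis unfolding \<sigma>_def game_coupling by (simp add: pmf.map_comp o_def)
  qed
  let ?S = "\<lambda>n. {(M, \<Gamma>). \<exists>G. G \<subseteq> \<Gamma> \<and> G \<subseteq> M \<and>
                    real (min_degree n G) \<ge> (1 - \<epsilon>) * p n * real n \<and>
                    (\<forall>v<n. real (card (induced G (nbrs \<Gamma> v)))
                              \<ge> (1 - \<epsilon>) * (p n ^ 3 * real n ^ 2 / 2))}"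
  have lim: "(\<lambda>n. measure_pmf.prob (game n (p n) (\<sigma> n) (\<tau> n)) (?S n)) \<longlonglongrightarrow> 1"
    if \<tau>: "\<And>n. legal_breaker n (b n) (\<tau> n)" for \<tau>
  proof (rule tendsto_sandwich[where h = "\<lambda>_. 1"])
    show "\<forall>\<^sub>F n in sequentially. 1 - real n * (real n + 9) * exp (- (4 * ln (real n)))
        \<le> measure_pmf.prob (game n (p n) (\<sigma> n) (\<tau> n)) (?S n)"
      using assms(3) eventually_large[OF assms(1)] eventually_gt_at_top[of 0]
    proof eventually_elim
      case (elim n)
      have s: "0 < sqrt (real n)" using elim by simp
      have "10 ^ 8 / \<epsilon>\<^sup>2 / sqrt (real n) \<le> p n"
        using elim powr_bound(1)[OF assms(1), of n] by simp
      then have p: "10 ^ 8 / \<epsilon>\<^sup>2 \<le> p n * sqrt (real n)" using s by (simp only: pos_divide_le_eq)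
      have "0 < 10 ^ 8 / \<epsilon>\<^sup>2" using assms(1) by simp
      then have "0 < p n * sqrt (real n)" using p by (rule less_le_trans)
      then have p0: "0 < p n" by (rule zero_less_mult_pos2) (rule s)
      have "real (b n) * p n \<le> 10 powr (-24) * \<epsilon> ^ 6"
        using elim p0 by (simp only: inverse_eq_divide mult_1_right times_divide_eq_right pos_le_divide_eq)
      also have "\<dots> = \<epsilon> ^ 3 * \<epsilon> ^ 3 / 10 ^ 24"
        using powr_bound(2) by (simp flip: power_add)
      also have "\<dots> \<le> \<epsilon> ^ 3 * 1 / 10 ^ 12"
        using assms(1,2) by (intro frac_le mult_left_mono power_le_one) auto
      finally have "real (b n) * p n \<le> \<epsilon> ^ 3 / 10 ^ 12" by simp
      then show ?case
        unfolding \<sigma>_def \<theta>_def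
        by (intro outcome_probability assms(1,2) p \<tau>) (use elim in auto)
    qed
    show "(\<lambda>n. 1 - real n * (real n + 9) * exp (- (4 * ln (real n)))) \<longlonglongrightarrow> 1"
      by real_asymp
  qed (auto intro: always_eventually)
  show ?thesis
    using legal marginal lim by (intro exI[of _ \<sigma>]) blast
qed

end
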